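(* For every flat $A$-algebra $R$, the group $\underline M^*(R)$ acts on the right of $\underline H(R)$ by $(h+f)\cdot m=(h+f)\circ m$, where $((h+f)\circ m)(v,w)=(h+f)(m(v),m(w))$; in particular $(h+f)\circ m\in\underline H(R)$ for all $h+f\in\underline H(R)$ and $m\in\underline M^*(R)$. This action is represented by an action morphism $\underline H\times\underline M^*\to\underline H$ of $A$-schemes.
   Context: $F$ is a non-Archimedean local field with ring of integers $A$ and residue characteristic $p$. $(K,\sigma)$ is one of: $K=F$ with $\mathrm{char}\,F\neq2$, $\sigma=\mathrm{id}$; $K=E$ a separable quadratic extension with nontrivial automorphism $\sigma$; $K=F\oplus F$, $\sigma(x,y)=(y,x)$; $K=D$ the quaternion division algebra with standard involution. $B$ is the maximal $A$-order of $K$; $\epsilon\in\{\pm1\}$. If $(K,\epsilon,p)\ne(F,1,2)$, $L$ is a free right $B$-module of rank $n$ with a $(\sigma,\epsilon)$-hermitian form $h:L\times L\to B$ and "hermitian form" means such a form; if $(K,\epsilon,p)=(F,1,2)$, $L$ is a free $A$-module of rank $n$ with quadratic form $h$, $h(v,w)=\frac12(h(v+w)-h(v)-h(w))$, and "hermitian form" means quadratic form (conditions/formulas via the associated bilinear form). $V=L\otimes_AF$ is nondegenerate; $L^{\#}=\{x\in V:h(x,L)\subset B\}$ and $(L^{\#})^{\#}=L$ is assumed. Adjoint $X^{ad}$: $h(X(v),w)=h(v,X^{ad}(w))$. For a flat $A$-algebra $R$: $T^0(R)=\{X\in\mathrm{End}_{B\otimes R}(L\otimes R):X(L^{\#}\otimes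 R)\subset L^{\#}\otimes R\}$; $H^0(R)$ = hermitian forms $f$ on $L\otimes R$ with $f(L\otimes R,L^{\#}\otimes R)\subset B\otimes R$; $\varphi_{0,R}(X)=h\circ X$ with $(h\circ X)(v,w)=h(X(v),X(w))$; $\psi_{0,R}(X)(v,w)=h(v,X(w))+h(X(v),w)$. Recursively, $\overline{\varphi_{m,A}}:T^m(A)\to H^0(A)/\psi_{0,A}(T^m(A))$ is $\varphi_{0,A}$ followed by the quotient, $T^{m+1}(A)=\{X\in T^m(A):\overline{\varphi_{m,A}}(X)=0=\overline{\varphi_{m,A}}(X^{ad})\}$, and $T^m(R)=R\otimes_AT^m(A)$ for flat $R$. Let $\alpha\ge0$ be the smallest integer with $T^m(A)=T^\alpha(A)$ for all $m\ge\alpha$ (it exists), $\tilde T:=T^\alpha$, $\tilde H(R)=\psi_{0,R}(\tilde T(R))$. For flat $R$: $\underline M(R)=\{1+X:X\in\tilde T(R)\}$, $\underline H(R)=\{h+f:f\in\tilde H(R)\}$ (both represented by affine spaces over $A$), and $\underline M^*(R)$ is the group of elements of $\underline M(R)$ having a two-sided inverse in $\underline M(R)$; $\underline M^*$ is represented by an open subgroup scheme of $\underline M$. *)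

theory Defs
  imports
    "HOL-Computational_Algebra.Polynomial"
    "HOL-Algebra.Free_Abelian_Groups"
    "HOL-Algebra.QuotRing"
    "HOL-Algebra.Module"
begin

section \<open>Tensor products, base change and flatness over a commutative ring\<close>

type_synonym 'a frag = "('a, int) poly_mapping"

definition linear_maps :: "('a, 's) ring_scheme \<Rightarrow> ('a, 'm, 't) module_scheme \<Rightarrow>
    ('a, 'n, 'u) module_scheme \<Rightarrow> ('m \<Rightarrow> 'n) set" where
  "linear_maps A M N = {g \<in> hom (add_monoid M) (add_monoid N).
     \<forall>a\<in>carrier A. \<forall>x\<in>carrier M. g (a \<odot>\<^bsub>M\<^esub> x) = a \<odot>\<^bsub>N\<^esub> g x}"

definition tensor_relations :: "('a, 's) ring_scheme \<Rightarrow> ('a, 'm, 't) module_scheme \<Rightarrow>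
    ('a, 'n, 'u) module_scheme \<Rightarrow> ('m \<times> 'n) frag set" where
  "tensor_relations A M N =
     {frag_of (x \<oplus>\<^bsub>M\<^esub> x', y) - frag_of (x, y) - frag_of (x', y) | x x' y.
        x \<in> carrier M \<and> x' \<in> carrier M \<and> y \<in> carrier N} \<union>
     {frag_of (x, y \<oplus>\<^bsub>N\<^esub> y') - frag_of (x, y) - frag_of (x, y') | x y y'.
        x \<in> carrier M \<and> y \<in> carrier N \<and> y' \<in> carrier N} \<union>
     {frag_of (a \<odot>\<^bsub>M\<^esub> x, y) - frag_of (x, a \<odot>\<^bsub>N\<^esub> y) | a x y.
        a \<in> carrier A \<and> x \<in> carrier M \<and> y \<in> carrier N}"

definition tensor_null :: "('a, 's) ring_scheme \<Rightarrow> ('a, 'm, 't) module_scheme \<Rightarrow>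
    ('a, 'n, 'u) module_scheme \<Rightarrow> ('m \<times> 'n) frag set" where
  "tensor_null A M N =
     generate (free_Abelian_group (carrier M \<times> carrier N)) (tensor_relations A M N)"

definition tensor_group :: "('a, 's) ring_scheme \<Rightarrow> ('a, 'm, 't) module_scheme \<Rightarrow>
    ('a, 'n, 'u) module_scheme \<Rightarrow> ('m \<times> 'n) frag set monoid" where
  "tensor_group A M N = free_Abelian_group (carrier M \<times> carrier N) Mod tensor_null A M N"

definition pure_tensor :: "('a, 's) ring_scheme \<Rightarrow> ('a, 'm, 't) module_scheme \<Rightarrow>
    ('a, 'n, 'u) module_scheme \<Rightarrow> 'm \<Rightarrow> 'n \<Rightarrow> ('m \<times> 'n) frag set" where
  "pure_tensor A M N x y =
     tensor_null A M N #>\<^bsub>free_Abelian_group (carrier M \<times> carrier N)\<^esub> frag_of (x, y)"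

text \<open>The additive map on the tensor product induced by a balanced biadditive map \<open>\<beta>\<close> into the
  abelian group \<open>G\<close>; it is only meaningful for such \<open>\<beta>\<close>.\<close>

definition tensor_lift :: "('a, 's) ring_scheme \<Rightarrow> ('a, 'm, 't) module_scheme \<Rightarrow>
    ('a, 'n, 'u) module_scheme \<Rightarrow> ('g, 'w) monoid_scheme \<Rightarrow> ('m \<Rightarrow> 'n \<Rightarrow> 'g) \<Rightarrow>
    ('m \<times> 'n) frag set \<Rightarrow> 'g" where
  "tensor_lift A M N G \<beta> = (THE F.
     F \<in> extensional (carrier (tensor_group A M N)) \<and>
     F \<in> hom (tensor_group A M N) G \<and>
     (\<forall>x\<in>carrier M. \<forall>y\<in>carrier N. F (pure_tensor A M N x y) = \<beta> x y))"

definition tensor_map :: "('a, 's) ring_scheme \<Rightarrow> ('a, 'm, 't) module_scheme \<Rightarrow>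
    ('a, 'n, 'u) module_scheme \<Rightarrow> ('a, 'm2, 't2) module_scheme \<Rightarrow> ('a, 'n2, 'u2) module_scheme \<Rightarrow>
    ('m \<Rightarrow> 'm2) \<Rightarrow> ('n \<Rightarrow> 'n2) \<Rightarrow> ('m \<times> 'n) frag set \<Rightarrow> ('m2 \<times> 'n2) frag set" where
  "tensor_map A M N M2 N2 f g =
     tensor_lift A M N (tensor_group A M2 N2) (\<lambda>x y. pure_tensor A M2 N2 (f x) (g y))"

text \<open>The \<open>R\<close>-module \<open>M \<otimes>\<^sub>A R\<close>; the ring-multiplicative fields of a module record carry
  no information.\<close>

definition base_change :: "('a, 's) ring_scheme \<Rightarrow> ('a, 'm, 't) module_scheme \<Rightarrow>
    ('a, 'r) module \<Rightarrow> ('r, ('m \<times> 'r) frag set) module" where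
  "base_change A M R =
     \<lparr>carrier = carrier (tensor_group A M R),
      monoid.mult = undefined, one = undefined,
      zero = \<one>\<^bsub>tensor_group A M R\<^esub>,
      add = (\<lambda>t t'. t \<otimes>\<^bsub>tensor_group A M R\<^esub> t'),
      module.smult = (\<lambda>r. tensor_lift A M R (tensor_group A M R)
                 (\<lambda>x s. pure_tensor A M R x (r \<otimes>\<^bsub>R\<^esub> s)))\<rparr>"

text \<open>The \<open>A\<close>-algebra \<open>S \<otimes>\<^sub>A T\<close>, i.e. the coordinate ring of the fibre product
  \<open>Spec S \<times>\<^sub>A Spec T\<close>.\<close>

definition tensor_algebra :: "('a, 's) ring_scheme \<Rightarrow> ('a, 'm) module \<Rightarrow> ('a, 'n) module \<Rightarrow>
    ('a, ('m \<times> 'n) frag set) module" where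
  "tensor_algebra A S T =
     \<lparr>carrier = carrier (tensor_group A S T),
      monoid.mult = (\<lambda>t t'. tensor_lift A S T (tensor_group A S T)
                (\<lambda>x y. tensor_lift A S T (tensor_group A S T)
                   (\<lambda>x' y'. pure_tensor A S T (x \<otimes>\<^bsub>S\<^esub> x') (y \<otimes>\<^bsub>T\<^esub> y')) t') t),
      one = pure_tensor A S T \<one>\<^bsub>S\<^esub> \<one>\<^bsub>T\<^esub>,
      zero = \<one>\<^bsub>tensor_group A S T\<^esub>,
      add = (\<lambda>t t'. t \<otimes>\<^bsub>tensor_group A S T\<^esub> t'),
      module.smult = (\<lambda>a. tensor_lift A S T (tensor_group A S T)
                 (\<lambda>x y. pure_tensor A S T (a \<odot>\<^bsub>S\<^esub> x) y))\<rparr>"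

text \<open>Tensoring with \<open>N\<close> preserves injectivity. The test modules have carriers in the type of
  scalars; this already contains the inclusions of ideals of \<open>A\<close>, which suffice to test
  flatness.\<close>

definition flat :: "('a, 's) ring_scheme \<Rightarrow> ('a, 'n, 'u) module_scheme \<Rightarrow> bool" where
  "flat A N \<longleftrightarrow> (\<forall>(M :: ('a, 'a) module) (M' :: ('a, 'a) module) g.
     Module.module A M \<and> Module.module A M' \<and> g \<in> linear_maps A M M' \<and> inj_on g (carrier M) \<longrightarrow>
     inj_on (tensor_map A M N M' N g (\<lambda>y. y)) (carrier (tensor_group A M N)))"

definition flat_algebra :: "('a, 's) ring_scheme \<Rightarrow> ('a, 'r) module \<Rightarrow> bool" where
  "flat_algebra A R \<longleftrightarrow> Module.algebra A R \<and> flat A R"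

text \<open>\<open>R\<close>-valued points of the affine \<open>A\<close>-scheme with coordinate ring \<open>S\<close>; equivalently
  (contravariantly) morphisms of affine \<open>A\<close>-schemes.\<close>

definition alg_homs :: "('a, 's) ring_scheme \<Rightarrow> ('a, 'm) module \<Rightarrow> ('a, 'n) module \<Rightarrow>
    ('m \<Rightarrow> 'n) set" where
  "alg_homs A S R = {y \<in> ring_hom S R \<inter> extensional (carrier S).
     \<forall>a\<in>carrier A. \<forall>s\<in>carrier S. y (a \<odot>\<^bsub>S\<^esub> s) = a \<odot>\<^bsub>R\<^esub> y s}"

text \<open>The point of \<open>Spec S \<times>\<^sub>A Spec T\<close> with components \<open>y\<close> and \<open>x\<close>.\<close>

definition point_pair :: "('a, 's) ring_scheme \<Rightarrow> ('a, 'm) module \<Rightarrow> ('a, 'n) module \<Rightarrow>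
    ('a, 'r) module \<Rightarrow> ('m \<Rightarrow> 'r) \<Rightarrow> ('n \<Rightarrow> 'r) \<Rightarrow> ('m \<times> 'n) frag set \<Rightarrow> 'r" where
  "point_pair A S T R y x =
     tensor_lift A S T (add_monoid R) (\<lambda>s t. y s \<otimes>\<^bsub>R\<^esub> x t)"


section \<open>Non-Archimedean local fields\<close>

text \<open>The value of a valuation at \<open>0\<close> is irrelevant.\<close>

definition val_ring_set :: "('f::field \<Rightarrow> int) \<Rightarrow> 'f set" where
  "val_ring_set v = {x. x = 0 \<or> 0 \<le> v x}"

definition val_ideal :: "('f::field \<Rightarrow> int) \<Rightarrow> 'f set" where
  "val_ideal v = {x. x = 0 \<or> 0 < v x}"

definition val_ring :: "('f::field \<Rightarrow> int) \<Rightarrow> 'f ring" where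
  "val_ring v = \<lparr>carrier = val_ring_set v, monoid.mult = (*), one = 1, zero = 0, add = (+)\<rparr>"

definition discrete_valuation :: "('f::field \<Rightarrow> int) \<Rightarrow> bool" where
  "discrete_valuation v \<longleftrightarrow>
     (\<forall>x y. x \<noteq> 0 \<and> y \<noteq> 0 \<longrightarrow> v (x * y) = v x + v y) \<and>
     (\<forall>x y. x \<noteq> 0 \<and> y \<noteq> 0 \<and> x + y \<noteq> 0 \<longrightarrow> min (v x) (v y) \<le> v (x + y)) \<and>
     v ` (- {0}) = UNIV"

definition complete_valuation :: "('f::field \<Rightarrow> int) \<Rightarrow> bool" where
  "complete_valuation v \<longleftrightarrow> (\<forall>s :: nat \<Rightarrow> 'f.
     (\<forall>N. \<exists>k. \<forall>i\<ge>k. \<forall>j\<ge>k. s i = s j \<or> N \<le> v (s i - s j)) \<longrightarrow>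
     (\<exists>l. \<forall>N. \<exists>k. \<forall>i\<ge>k. s i = l \<or> N \<le> v (s i - l)))"

definition nonarch_local_field :: "('f::field \<Rightarrow> int) \<Rightarrow> bool" where
  "nonarch_local_field v \<longleftrightarrow> discrete_valuation v \<and> complete_valuation v \<and>
     finite (carrier (val_ring v Quot val_ideal v))"

definition residue_char :: "('f::field \<Rightarrow> int) \<Rightarrow> nat" where
  "residue_char v = (LEAST p. 0 < p \<and> of_nat p \<in> val_ideal v)"


section \<open>Hermitian and quadratic lattices\<close>

datatype ('v, 'k) form = Hermitian "'v \<Rightarrow> 'v \<Rightarrow> 'k" | Quadratic "'v \<Rightarrow> 'k"

text \<open>
  The field \<open>F\<close> is the type \<open>'f\<close>, the algebra \<open>K\<close> is the type \<open>'k\<close>, and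
  \<open>V = L \<otimes>\<^sub>A F\<close> is the type \<open>'v\<close>, a right \<open>K\<close>-module through \<open>act\<close>. The lattice
  \<open>L\<close> is a subset of \<open>V\<close>, \<open>B\<close> a subset of \<open>K\<close>, \<open>emb\<close> is the structure map
  \<open>F \<rightarrow> K\<close>, and the form \<open>h\<close> is given through its unique extension to \<open>V\<close>.\<close>

record ('f, 'k, 'v) lattice_data =
  val :: "'f \<Rightarrow> int"
  emb :: "'f \<Rightarrow> 'k"
  invol :: "'k \<Rightarrow> 'k"
  max_order :: "'k set"
  eps :: int
  act :: "'v \<Rightarrow> 'k \<Rightarrow> 'v"
  lat :: "'v set"
  herm :: "('v, 'k) form"

text \<open>\<open>'v\<close> occurs in the next definitions only through the type of the record.\<close>

definition central_embedding :: "('f::field, 'k::ring_1, 'v) lattice_data \<Rightarrow> bool" where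
  "central_embedding D \<longleftrightarrow> emb D 1 = 1 \<and>
     (\<forall>a b. emb D (a + b) = emb D a + emb D b \<and> emb D (a * b) = emb D a * emb D b) \<and>
     (\<forall>a x. emb D a * x = x * emb D a)"

definition case_base :: "('f::field, 'k::ring_1, 'v) lattice_data \<Rightarrow> bool" where
  "case_base D \<longleftrightarrow> bij (emb D) \<and> (2::'f) \<noteq> 0 \<and> invol D = id"

definition dim_over_base :: "('f::field, 'k::ring_1, 'v) lattice_data \<Rightarrow> nat" where
  "dim_over_base D = vector_space.dim (\<lambda>a x. emb D a * x) (UNIV :: 'k set)"

definition case_quadratic_ext :: "('f::field, 'k::ring_1, 'v) lattice_data \<Rightarrow> bool" where
  "case_quadratic_ext D \<longleftrightarrow>
     (\<forall>x y :: 'k. x * y = y * x) \<and> (\<forall>x :: 'k. x \<noteq> 0 \<longrightarrow> (\<exists>y. x * y = 1)) \<and>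
     dim_over_base D = 2 \<and>
     (\<forall>x. \<exists>q :: 'f poly. coprime q (pderiv q) \<and>
        (\<Sum>i\<le>degree q. emb D (coeff q i) * x ^ i) = 0) \<and>
     bij (invol D) \<and>
     (\<forall>x y. invol D (x + y) = invol D x + invol D y \<and> invol D (x * y) = invol D x * invol D y) \<and>
     (\<forall>a. invol D (emb D a) = emb D a) \<and> invol D \<noteq> id"

definition case_split :: "('f::field, 'k::ring_1, 'v) lattice_data \<Rightarrow> bool" where
  "case_split D \<longleftrightarrow> (\<exists>g :: 'k \<Rightarrow> 'f \<times> 'f. bij g \<and> g 1 = (1, 1) \<and>
     (\<forall>x y. g (x + y) = (fst (g x) + fst (g y), snd (g x) + snd (g y)) \<and>
            g (x * y) = (fst (g x) * fst (g y), snd (g x) * snd (g y))) \<and>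
     (\<forall>a. g (emb D a) = (a, a)) \<and>
     (\<forall>x. g (invol D x) = prod.swap (g x)))"

text \<open>A four-dimensional division algebra with centre \<open>F\<close>; an involution is called standard if
  \<open>x + \<sigma>(x)\<close> and \<open>\<sigma>(x) x\<close> are always scalars.\<close>

definition case_quaternion :: "('f::field, 'k::ring_1, 'v) lattice_data \<Rightarrow> bool" where
  "case_quaternion D \<longleftrightarrow>
     (\<forall>x :: 'k. x \<noteq> 0 \<longrightarrow> (\<exists>y. x * y = 1 \<and> y * x = 1)) \<and>
     {x :: 'k. \<forall>y. x * y = y * x} = range (emb D) \<and>
     dim_over_base D = 4 \<and>
     (\<forall>x y. invol D (x + y) = invol D x + invol D y \<and> invol D (x * y) = invol D y * invol D x) \<and>
     (\<forall>x. invol D (invol D x) = x) \<and> (\<forall>a. invol D (emb D a) = emb D a) \<and>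
     (\<forall>x. x + invol D x \<in> range (emb D) \<and> invol D x * x \<in> range (emb D))"

definition is_order :: "('f::field, 'k::ring_1, 'v) lattice_data \<Rightarrow> 'k set \<Rightarrow> bool" where
  "is_order D S \<longleftrightarrow>
     1 \<in> S \<and> (\<forall>x\<in>S. \<forall>y\<in>S. x - y \<in> S \<and> x * y \<in> S) \<and>
     (\<exists>G. finite G \<and> S = {\<Sum>g\<in>G. emb D (c g) * g | c. \<forall>g\<in>G. c g \<in> val_ring_set (val D)}) \<and>
     (\<forall>x. \<exists>c. \<exists>s\<in>S. x = emb D c * s)"

definition is_maximal_order :: "('f::field, 'k::ring_1, 'v) lattice_data \<Rightarrow> 'k set \<Rightarrow> bool" where
  "is_maximal_order D S \<longleftrightarrow> is_order D S \<and> (\<forall>S'. is_order D S' \<and> S \<subseteq> S' \<longrightarrow> S' = S)"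

text \<open>The exceptional case \<open>(K, \<epsilon>, p) = (F, 1, 2)\<close>, where forms are quadratic forms.\<close>

definition quadratic_case :: "('f::field, 'k::ring_1, 'v) lattice_data \<Rightarrow> bool" where
  "quadratic_case D \<longleftrightarrow> case_base D \<and> eps D = 1 \<and> residue_char (val D) = 2"

definition right_module :: "('f::field, 'k::ring_1, 'v::ab_group_add) lattice_data \<Rightarrow> bool" where
  "right_module D \<longleftrightarrow>
     (\<forall>v w a. act D (v + w) a = act D v a + act D w a) \<and>
     (\<forall>v a b. act D v (a + b) = act D v a + act D v b) \<and>
     (\<forall>v a b. act D v (a * b) = act D (act D v a) b) \<and>
     (\<forall>v. act D v 1 = v)"

definition is_lattice_basis :: "('f::field, 'k::ring_1, 'v::ab_group_add) lattice_data \<Rightarrow>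
    nat \<Rightarrow> (nat \<Rightarrow> 'v) \<Rightarrow> bool" where
  "is_lattice_basis D n e \<longleftrightarrow>
     (\<forall>v. \<exists>!c. c \<in> extensional {..<n} \<and> v = (\<Sum>i<n. act D (e i) (c i))) \<and>
     lat D = {\<Sum>i<n. act D (e i) (c i) | c. \<forall>i<n. c i \<in> max_order D}"

definition sesquilinear_hermitian :: "('f::field, 'k::ring_1, 'v::ab_group_add) lattice_data \<Rightarrow>
    ('v \<Rightarrow> 'v \<Rightarrow> 'k) \<Rightarrow> bool" where
  "sesquilinear_hermitian D f \<longleftrightarrow>
     (\<forall>v v' w. f (v + v') w = f v w + f v' w) \<and>
     (\<forall>v w w'. f v (w + w') = f v w + f v w') \<and>
     (\<forall>v w a b. f (act D v a) (act D w b) = invol D a * f v w * b) \<and>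
     (\<forall>v w. f w v = of_int (eps D) * invol D (f v w))"

definition quadratic_form :: "('f::field, 'k::ring_1, 'v::ab_group_add) lattice_data \<Rightarrow>
    ('v \<Rightarrow> 'k) \<Rightarrow> bool" where
  "quadratic_form D q \<longleftrightarrow>
     (\<forall>v a. q (act D v a) = q v * a ^ 2) \<and>
     (let b = (\<lambda>v w. q (v + w) - q v - q w) in
        (\<forall>v v' w. b (v + v') w = b v w + b v' w) \<and>
        (\<forall>v w w'. b v (w + w') = b v w + b v w') \<and>
        (\<forall>v w a. b (act D v a) w = b v w * a \<and> b v (act D w a) = b v w * a))"

fun assoc_bilinear :: "('f::field, 'k::ring_1, 'v::ab_group_add) lattice_data \<Rightarrow>
    ('v, 'k) form \<Rightarrow> 'v \<Rightarrow> 'v \<Rightarrow> 'k" where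
  "assoc_bilinear D (Hermitian f) = f"
| "assoc_bilinear D (Quadratic q) = (\<lambda>v w. emb D (1 / 2) * (q (v + w) - q v - q w))"

definition hermitian_form_on_lat :: "('f::field, 'k::ring_1, 'v::ab_group_add) lattice_data \<Rightarrow>
    ('v, 'k) form \<Rightarrow> bool" where
  "hermitian_form_on_lat D f \<longleftrightarrow>
     (if quadratic_case D
      then \<exists>q. f = Quadratic q \<and> quadratic_form D q \<and> (\<forall>v\<in>lat D. q v \<in> max_order D)
      else \<exists>g. f = Hermitian g \<and> sesquilinear_hermitian D g \<and>
             (\<forall>v\<in>lat D. \<forall>w\<in>lat D. g v w \<in> max_order D))"

definition dual_lattice :: "('f::field, 'k::ring_1, 'v::ab_group_add) lattice_data \<Rightarrow>
    'v set \<Rightarrow> 'v set" where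
  "dual_lattice D S = {x. \<forall>l\<in>S. assoc_bilinear D (herm D) x l \<in> max_order D}"

definition hermitian_lattice :: "('f::field, 'k::ring_1, 'v::ab_group_add) lattice_data \<Rightarrow>
    nat \<Rightarrow> bool" where
  "hermitian_lattice D n \<longleftrightarrow>
     nonarch_local_field (val D) \<and>
     central_embedding D \<and>
     (case_base D \<or> case_quadratic_ext D \<or> case_split D \<or> case_quaternion D) \<and>
     is_maximal_order D (max_order D) \<and>
     eps D \<in> {1, -1} \<and>
     right_module D \<and>
     (\<exists>e. is_lattice_basis D n e) \<and>
     hermitian_form_on_lat D (herm D) \<and>
     (\<forall>v. (\<forall>w. assoc_bilinear D (herm D) v w = 0) \<longrightarrow> v = 0) \<and>
     dual_lattice D (dual_lattice D (lat D)) = lat D"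


section \<open>Operations on forms\<close>

text \<open>Forms live on a set \<open>C\<close> and take values in the additive group of \<open>W\<close>; functions are
  \<open>undefined\<close> off \<open>C\<close>, so that equality of forms is equality on \<open>C\<close>.\<close>

fun form_add :: "('w, 's) ring_scheme \<Rightarrow> 'v set \<Rightarrow> ('v, 'w) form \<Rightarrow> ('v, 'w) form \<Rightarrow>
    ('v, 'w) form" where
  "form_add W C (Hermitian f) (Hermitian g) = Hermitian (\<lambda>v\<in>C. \<lambda>w\<in>C. f v w \<oplus>\<^bsub>W\<^esub> g v w)"
| "form_add W C (Quadratic f) (Quadratic g) = Quadratic (\<lambda>v\<in>C. f v \<oplus>\<^bsub>W\<^esub> g v)"
| "form_add W C _ _ = undefined"

fun form_pullback :: "'v set \<Rightarrow> ('v, 'w) form \<Rightarrow> ('v \<Rightarrow> 'v) \<Rightarrow> ('v, 'w) form" where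
  "form_pullback C (Hermitian f) m = Hermitian (\<lambda>v\<in>C. \<lambda>w\<in>C. f (m v) (m w))"
| "form_pullback C (Quadratic q) m = Quadratic (\<lambda>v\<in>C. q (m v))"

text \<open>In the quadratic case, the quadratic form with associated bilinear form \<open>b\<close> is
  \<open>v \<mapsto> b(v, v)\<close>.\<close>

definition form_of :: "('f::field, 'k::ring_1, 'x) lattice_data \<Rightarrow> 'v set \<Rightarrow>
    ('v \<Rightarrow> 'v \<Rightarrow> 'w) \<Rightarrow> ('v, 'w) form" where
  "form_of D C b = (if quadratic_case D then Quadratic (\<lambda>v\<in>C. b v v)
                    else Hermitian (\<lambda>v\<in>C. \<lambda>w\<in>C. b v w))"


section \<open>The modules \<open>T\<^sup>m(A)\<close>\<close>

definition base_ring :: "('f::field, 'k, 'v) lattice_data \<Rightarrow> 'f ring" where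
  "base_ring D = val_ring (val D)"

definition lat_module :: "('f::field, 'k::ring_1, 'v::ab_group_add) lattice_data \<Rightarrow>
    ('f, 'v) module" where
  "lat_module D = \<lparr>carrier = lat D, monoid.mult = undefined, one = undefined, zero = 0, add = (+),
     module.smult = (\<lambda>a v. act D v (emb D a))\<rparr>"

definition alg_module :: "('f::field, 'k::ring_1, 'v) lattice_data \<Rightarrow> ('f, 'k) module" where
  "alg_module D = \<lparr>carrier = UNIV, monoid.mult = (*), one = 1, zero = 0, add = (+),
     module.smult = (\<lambda>a x. emb D a * x)\<rparr>"

definition End_K :: "('f::field, 'k::ring_1, 'v::ab_group_add) lattice_data \<Rightarrow> ('v \<Rightarrow> 'v) set" where
  "End_K D = {X. (\<forall>v w. X (v + w) = X v + X w) \<and> (\<forall>v a. X (act D v a) = act D (X v) a)}"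

definition adjoint :: "('f::field, 'k::ring_1, 'v::ab_group_add) lattice_data \<Rightarrow>
    ('v \<Rightarrow> 'v) \<Rightarrow> 'v \<Rightarrow> 'v" where
  "adjoint D X = (THE Y. Y \<in> End_K D \<and>
     (\<forall>v w. assoc_bilinear D (herm D) (X v) w = assoc_bilinear D (herm D) v (Y w)))"

text \<open>\<open>End\<^sub>B(L)\<close> is identified with the \<open>K\<close>-endomorphisms of \<open>V\<close> that preserve \<open>L\<close>.\<close>

definition T0 :: "('f::field, 'k::ring_1, 'v::ab_group_add) lattice_data \<Rightarrow> ('v \<Rightarrow> 'v) set" where
  "T0 D = {X \<in> End_K D. X ` lat D \<subseteq> lat D \<and>
     X ` dual_lattice D (lat D) \<subseteq> dual_lattice D (lat D)}"

definition H0 :: "('f::field, 'k::ring_1, 'v::ab_group_add) lattice_data \<Rightarrow> ('v, 'k) form set" where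
  "H0 D = {f. hermitian_form_on_lat D f \<and>
     (\<forall>v\<in>lat D. \<forall>w\<in>dual_lattice D (lat D). assoc_bilinear D f v w \<in> max_order D)}"

definition H0_group :: "('f::field, 'k::ring_1, 'v::ab_group_add) lattice_data \<Rightarrow>
    ('v, 'k) form monoid" where
  "H0_group D = \<lparr>carrier = H0 D, monoid.mult = form_add (alg_module D) UNIV,
     one = form_of D UNIV (\<lambda>v w. 0)\<rparr>"

definition phi0 :: "('f::field, 'k::ring_1, 'v::ab_group_add) lattice_data \<Rightarrow>
    ('v \<Rightarrow> 'v) \<Rightarrow> ('v, 'k) form" where
  "phi0 D X = form_pullback UNIV (herm D) X"

definition psi0 :: "('f::field, 'k::ring_1, 'v::ab_group_add) lattice_data \<Rightarrow>
    ('v \<Rightarrow> 'v) \<Rightarrow> ('v, 'k) form" where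
  "psi0 D X = form_of D UNIV (\<lambda>v w.
     assoc_bilinear D (herm D) v (X w) + assoc_bilinear D (herm D) (X v) w)"

text \<open>The class of \<open>h \<circ> X\<close> in \<open>H\<^sup>0(A) / \<psi>\<^sub>0(T)\<close>, and the condition that it vanishes.\<close>

definition phibar :: "('f::field, 'k::ring_1, 'v::ab_group_add) lattice_data \<Rightarrow>
    ('v \<Rightarrow> 'v) set \<Rightarrow> ('v \<Rightarrow> 'v) \<Rightarrow> ('v, 'k) form set" where
  "phibar D T X = (psi0 D ` T) #>\<^bsub>H0_group D\<^esub> phi0 D X"

primrec Tm :: "('f::field, 'k::ring_1, 'v::ab_group_add) lattice_data \<Rightarrow> nat \<Rightarrow> ('v \<Rightarrow> 'v) set" where
  "Tm D 0 = T0 D"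
| "Tm D (Suc m) = {X \<in> Tm D m.
     phibar D (Tm D m) X = \<one>\<^bsub>H0_group D Mod (psi0 D ` Tm D m)\<^esub> \<and>
     phibar D (Tm D m) (adjoint D X) = \<one>\<^bsub>H0_group D Mod (psi0 D ` Tm D m)\<^esub>}"

definition is_stabilization_index ::
    "('f::field, 'k::ring_1, 'v::ab_group_add) lattice_data \<Rightarrow> nat \<Rightarrow> bool" where
  "is_stabilization_index D \<alpha> \<longleftrightarrow> (\<forall>m\<ge>\<alpha>. Tm D m = Tm D \<alpha>) \<and>
     (\<forall>\<beta>. (\<forall>m\<ge>\<beta>. Tm D m = Tm D \<beta>) \<longrightarrow> \<alpha> \<le> \<beta>)"


section \<open>The functors of points on flat \<open>A\<close>-algebras\<close>

definition lat_R :: "('f::field, 'k::ring_1, 'v::ab_group_add) lattice_data \<Rightarrow>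
    ('f, 'r) module \<Rightarrow> ('r, ('v \<times> 'r) frag set) module" where
  "lat_R D R = base_change (base_ring D) (lat_module D) R"

definition alg_R :: "('f::field, 'k::ring_1, 'v) lattice_data \<Rightarrow>
    ('f, 'r) module \<Rightarrow> ('r, ('k \<times> 'r) frag set) module" where
  "alg_R D R = base_change (base_ring D) (alg_module D) R"

definition endo_R :: "('f::field, 'k::ring_1, 'v::ab_group_add) lattice_data \<Rightarrow>
    ('f, 'r) module \<Rightarrow> ('v \<Rightarrow> 'v) \<Rightarrow> ('v \<times> 'r) frag set \<Rightarrow> ('v \<times> 'r) frag set" where
  "endo_R D R X = tensor_map (base_ring D) (lat_module D) R (lat_module D) R X (\<lambda>r. r)"

text \<open>The extension \<open>(x \<otimes> r, y \<otimes> s) \<mapsto> h(x, y) \<otimes> r s\<close> of (the bilinear form associated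
  with) \<open>h\<close> to \<open>L \<otimes> R\<close>. It is valued in \<open>K \<otimes> R\<close>, which contains \<open>B \<otimes> R\<close> for
  flat \<open>R\<close>, because in the quadratic case \<open>h(x, y)\<close> need not lie in \<open>B\<close>.\<close>

definition bilinear_R :: "('f::field, 'k::ring_1, 'v::ab_group_add) lattice_data \<Rightarrow>
    ('f, 'r) module \<Rightarrow> ('v \<times> 'r) frag set \<Rightarrow> ('v \<times> 'r) frag set \<Rightarrow> ('k \<times> 'r) frag set" where
  "bilinear_R D R t t' =
     tensor_lift (base_ring D) (lat_module D) R (add_monoid (alg_R D R))
       (\<lambda>x r. tensor_lift (base_ring D) (lat_module D) R (add_monoid (alg_R D R))
         (\<lambda>y s. pure_tensor (base_ring D) (alg_module D) R
            (assoc_bilinear D (herm D) x y) (r \<otimes>\<^bsub>R\<^esub> s)) t') t"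

definition herm_R :: "('f::field, 'k::ring_1, 'v::ab_group_add) lattice_data \<Rightarrow>
    ('f, 'r) module \<Rightarrow> (('v \<times> 'r) frag set, ('k \<times> 'r) frag set) form" where
  "herm_R D R = form_of D (carrier (lat_R D R)) (bilinear_R D R)"

definition psi_R :: "('f::field, 'k::ring_1, 'v::ab_group_add) lattice_data \<Rightarrow>
    ('f, 'r) module \<Rightarrow> (('v \<times> 'r) frag set \<Rightarrow> ('v \<times> 'r) frag set) \<Rightarrow>
    (('v \<times> 'r) frag set, ('k \<times> 'r) frag set) form" where
  "psi_R D R X = form_of D (carrier (lat_R D R))
     (\<lambda>v w. bilinear_R D R v (X w) \<oplus>\<^bsub>alg_R D R\<^esub> bilinear_R D R (X v) w)"

text \<open>\<open>R \<otimes>\<^sub>A T\<^sup>m(A)\<close> as a submodule of the endomorphisms of \<open>L \<otimes> R\<close>: the image of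
  \<open>\<Sum>\<^sub>i r\<^sub>i \<otimes> X\<^sub>i\<close> is \<open>\<Sum>\<^sub>i r\<^sub>i (X\<^sub>i \<otimes> id)\<close>.\<close>

definition Tm_R :: "('f::field, 'k::ring_1, 'v::ab_group_add) lattice_data \<Rightarrow> nat \<Rightarrow>
    ('f, 'r) module \<Rightarrow> (('v \<times> 'r) frag set \<Rightarrow> ('v \<times> 'r) frag set) set" where
  "Tm_R D m R =
     {(\<lambda>t\<in>carrier (lat_R D R).
         \<Oplus>\<^bsub>lat_R D R\<^esub>i\<in>{..<k}. r i \<odot>\<^bsub>lat_R D R\<^esub> endo_R D R (X i) t) | (k::nat) r X.
       \<forall>i<k. r i \<in> carrier R \<and> X i \<in> Tm D m}"

definition M_points :: "('f::field, 'k::ring_1, 'v::ab_group_add) lattice_data \<Rightarrow> nat \<Rightarrow>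
    ('f, 'r) module \<Rightarrow> (('v \<times> 'r) frag set \<Rightarrow> ('v \<times> 'r) frag set) set" where
  "M_points D \<alpha> R =
     {(\<lambda>t\<in>carrier (lat_R D R). t \<oplus>\<^bsub>lat_R D R\<^esub> X t) | X. X \<in> Tm_R D \<alpha> R}"

definition M_star_points :: "('f::field, 'k::ring_1, 'v::ab_group_add) lattice_data \<Rightarrow> nat \<Rightarrow>
    ('f, 'r) module \<Rightarrow> (('v \<times> 'r) frag set \<Rightarrow> ('v \<times> 'r) frag set) set" where
  "M_star_points D \<alpha> R = {m \<in> M_points D \<alpha> R. \<exists>m'\<in>M_points D \<alpha> R.
     compose (carrier (lat_R D R)) m m' = (\<lambda>t\<in>carrier (lat_R D R). t) \<and>
     compose (carrier (lat_R D R)) m' m = (\<lambda>t\<in>carrier (lat_R D R). t)}"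

definition M_star_group :: "('f::field, 'k::ring_1, 'v::ab_group_add) lattice_data \<Rightarrow> nat \<Rightarrow>
    ('f, 'r) module \<Rightarrow> (('v \<times> 'r) frag set \<Rightarrow> ('v \<times> 'r) frag set) monoid" where
  "M_star_group D \<alpha> R = \<lparr>carrier = M_star_points D \<alpha> R,
     monoid.mult = (\<lambda>m m'. compose (carrier (lat_R D R)) m m'),
     one = (\<lambda>t\<in>carrier (lat_R D R). t)\<rparr>"

definition H_points :: "('f::field, 'k::ring_1, 'v::ab_group_add) lattice_data \<Rightarrow> nat \<Rightarrow>
    ('f, 'r) module \<Rightarrow> (('v \<times> 'r) frag set, ('k \<times> 'r) frag set) form set" where
  "H_points D \<alpha> R = {form_add (alg_R D R) (carrier (lat_R D R)) (herm_R D R) f | f.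
     f \<in> psi_R D R ` Tm_R D \<alpha> R}"

definition right_group_action :: "('g, 's) monoid_scheme \<Rightarrow> 'x set \<Rightarrow> ('x \<Rightarrow> 'g \<Rightarrow> 'x) \<Rightarrow> bool" where
  "right_group_action G X \<rho> \<longleftrightarrow> group G \<and>
     (\<forall>x\<in>X. \<forall>g\<in>carrier G. \<rho> x g \<in> X) \<and>
     (\<forall>x\<in>X. \<rho> x \<one>\<^bsub>G\<^esub> = x) \<and>
     (\<forall>x\<in>X. \<forall>g\<in>carrier G. \<forall>g'\<in>carrier G. \<rho> x (g \<otimes>\<^bsub>G\<^esub> g') = \<rho> (\<rho> x g) g')"


section \<open>Representing affine schemes\<close>

definition lat_push :: "('f::field, 'k::ring_1, 'v::ab_group_add) lattice_data \<Rightarrow>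
    ('f, 'q) module \<Rightarrow> ('f, 'r) module \<Rightarrow> ('q \<Rightarrow> 'r) \<Rightarrow>
    ('v \<times> 'q) frag set \<Rightarrow> ('v \<times> 'r) frag set" where
  "lat_push D Q R y = tensor_map (base_ring D) (lat_module D) Q (lat_module D) R (\<lambda>v. v) y"

definition alg_push :: "('f::field, 'k::ring_1, 'v) lattice_data \<Rightarrow>
    ('f, 'q) module \<Rightarrow> ('f, 'r) module \<Rightarrow> ('q \<Rightarrow> 'r) \<Rightarrow>
    ('k \<times> 'q) frag set \<Rightarrow> ('k \<times> 'r) frag set" where
  "alg_push D Q R y = tensor_map (base_ring D) (alg_module D) Q (alg_module D) R (\<lambda>c. c) y"

text \<open>Functoriality of the functors of points along \<open>y : Q \<rightarrow> R\<close>, as a relation: an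
  \<open>R\<close>-linear endomorphism of \<open>L \<otimes> R\<close>, or a form on \<open>L \<otimes> R\<close>, is determined by its
  values on the image of \<open>L \<otimes> Q\<close>.\<close>

definition is_endo_base_change :: "('f::field, 'k::ring_1, 'v::ab_group_add) lattice_data \<Rightarrow>
    ('f, 'q) module \<Rightarrow> ('f, 'r) module \<Rightarrow> ('q \<Rightarrow> 'r) \<Rightarrow>
    (('v \<times> 'q) frag set \<Rightarrow> ('v \<times> 'q) frag set) \<Rightarrow>
    (('v \<times> 'r) frag set \<Rightarrow> ('v \<times> 'r) frag set) \<Rightarrow> bool" where
  "is_endo_base_change D Q R y w m \<longleftrightarrow>
     (\<forall>t\<in>carrier (lat_R D Q). m (lat_push D Q R y t) = lat_push D Q R y (w t))"

fun is_form_base_change :: "('f::field, 'k::ring_1, 'v::ab_group_add) lattice_data \<Rightarrow>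
    ('f, 'q) module \<Rightarrow> ('f, 'r) module \<Rightarrow> ('q \<Rightarrow> 'r) \<Rightarrow>
    (('v \<times> 'q) frag set, ('k \<times> 'q) frag set) form \<Rightarrow>
    (('v \<times> 'r) frag set, ('k \<times> 'r) frag set) form \<Rightarrow> bool" where
  "is_form_base_change D Q R y (Hermitian u) (Hermitian f) \<longleftrightarrow>
     (\<forall>t\<in>carrier (lat_R D Q). \<forall>t'\<in>carrier (lat_R D Q).
        f (lat_push D Q R y t) (lat_push D Q R y t') = alg_push D Q R y (u t t'))"
| "is_form_base_change D Q R y (Quadratic u) (Quadratic f) \<longleftrightarrow>
     (\<forall>t\<in>carrier (lat_R D Q). f (lat_push D Q R y t) = alg_push D Q R y (u t))"
| "is_form_base_change D Q R y _ _ \<longleftrightarrow> False"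

text \<open>The flat affine \<open>A\<close>-scheme \<open>Spec Q\<close> represents \<open>H\<close> (resp. \<open>M\<^sup>*\<close>) on the flat
  \<open>A\<close>-algebras with carrier in the type \<open>'t\<close>, by means of the universal element \<open>u\<close>
  (resp. \<open>w\<close>).\<close>

definition represents_H :: "'t itself \<Rightarrow> ('f::field, 'k::ring_1, 'v::ab_group_add) lattice_data \<Rightarrow>
    nat \<Rightarrow> ('f, 'q) module \<Rightarrow> (('v \<times> 'q) frag set, ('k \<times> 'q) frag set) form \<Rightarrow> bool" where
  "represents_H U D \<alpha> Q u \<longleftrightarrow> flat_algebra (base_ring D) Q \<and> u \<in> H_points D \<alpha> Q \<and>
     (\<forall>R :: ('f, 't) module. flat_algebra (base_ring D) R \<longrightarrow>
        (\<forall>f\<in>H_points D \<alpha> R. \<exists>!y. y \<in> alg_homs (base_ring D) Q R \<and>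
           is_form_base_change D Q R y u f))"

definition represents_M_star ::
    "'t itself \<Rightarrow> ('f::field, 'k::ring_1, 'v::ab_group_add) lattice_data \<Rightarrow>
    nat \<Rightarrow> ('f, 'q) module \<Rightarrow> (('v \<times> 'q) frag set \<Rightarrow> ('v \<times> 'q) frag set) \<Rightarrow> bool" where
  "represents_M_star U D \<alpha> Q w \<longleftrightarrow> flat_algebra (base_ring D) Q \<and> w \<in> M_star_points D \<alpha> Q \<and>
     (\<forall>R :: ('f, 't) module. flat_algebra (base_ring D) R \<longrightarrow>
        (\<forall>m\<in>M_star_points D \<alpha> R. \<exists>!x. x \<in> alg_homs (base_ring D) Q R \<and>
           is_endo_base_change D Q R x w m))"

text \<open>The morphism \<open>Spec OH \<times>\<^sub>A Spec OM \<rightarrow> Spec OH\<close> with comorphism \<open>\<phi>\<close> induces on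
  \<open>R\<close>-points the map \<open>(f, m) \<mapsto> f \<circ> m\<close>.\<close>

definition induces_action :: "('f::field, 'k::ring_1, 'v::ab_group_add) lattice_data \<Rightarrow> nat \<Rightarrow>
    ('f, 'oh) module \<Rightarrow> (('v \<times> 'oh) frag set, ('k \<times> 'oh) frag set) form \<Rightarrow>
    ('f, 'om) module \<Rightarrow> (('v \<times> 'om) frag set \<Rightarrow> ('v \<times> 'om) frag set) \<Rightarrow>
    ('oh \<Rightarrow> ('oh \<times> 'om) frag set) \<Rightarrow> ('f, 'r) module \<Rightarrow> bool" where
  "induces_action D \<alpha> OH u OM w \<phi> R \<longleftrightarrow>
     (\<forall>f\<in>H_points D \<alpha> R. \<forall>m\<in>M_star_points D \<alpha> R.
      \<forall>y\<in>alg_homs (base_ring D) OH R. \<forall>x\<in>alg_homs (base_ring D) OM R.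
        is_form_base_change D OH R y u f \<and> is_endo_base_change D OM R x w m \<longrightarrow>
        is_form_base_change D OH R
          (compose (carrier OH) (point_pair (base_ring D) OH OM R y x) \<phi>) u
          (form_pullback (carrier (lat_R D R)) f m))"

end

(*
  Write T for the stable module T^alpha(A). It is a subring of End(L) closed under the adjoint, and
  for X in T there is Z in T with h o X = psi(Z); both survive base change to R. Since
  psi(Y) o m = psi(m^ad Y m), this gives for m = 1 + X
    (h + psi(Y)) o m = h + psi(X + Z + m^ad Y m),
  which is again a point of H. That T is a subring is proved by induction on m for T^m(A), from
    h o (X + Y) = h o X + h o Y + psi(X^ad Y)  and  h o (X Y) = psi(Y^ad Z Y).

  For the morphism, let S be the tensor product of the coordinate rings of H and M^*. It is flat over
  the valuation ring A, so the action applied to the two universal points over S yields a point of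
  H(S), that is, the comorphism. It induces the action on R-points because a form or endomorphism over
  S is determined by its values on the image of the lattice over either factor.
*)

theory Submission
  imports Defs
begin

text \<open>The obstacle is that \<open>represents_H\<close> speaks about flat algebras only: a form
  over the tensor product S of the coordinate rings can be classified only once S is known to be
  flat. Over the valuation ring \<open>A\<close>, flat and torsion-free are the same, because
  finitely many elements of a torsion-free module lie in a submodule with a basis; and
  multiplication by a nonzero scalar on S is a base change of an injective map. In the quadratic
  case a form records only the diagonal of its bilinear form. The computations are done with
  bilinear forms, and polarization leads back; the division by 2 takes place in K or in K \<otimes>
  R, where 1/2 acts through F. Finally, h o X is quadratic in X, so h o X = \<psi>(Z) does not pass
  to R-linear combinations by itself: each new summand brings a cross term, and the adjoint turns it
  into \<psi> of an element of the span. This is why stability under the adjoint accompanies every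
  T^m. Adjoints exist since V has finite dimension over F, and they preserve L since L is its own
  bidual.\<close>

section \<open>Tensor products\<close>

lemma linear_mapsD:
  assumes "f \<in> linear_maps A M N"
  shows "x \<in> carrier M \<Longrightarrow> f x \<in> carrier N"
    and "x \<in> carrier M \<Longrightarrow> y \<in> carrier M \<Longrightarrow> f (x \<oplus>\<^bsub>M\<^esub> y) = f x \<oplus>\<^bsub>N\<^esub> f y"
    and "a \<in> carrier A \<Longrightarrow> x \<in> carrier M \<Longrightarrow> f (a \<odot>\<^bsub>M\<^esub> x) = a \<odot>\<^bsub>N\<^esub> f x"
  using assms by (auto simp: linear_maps_def hom_def)

text \<open>Scalars are only required to cross from one factor to the other, since
  \<open>tensor_lift\<close> yields additive maps; the target \<open>W\<close> serves as an abelian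
  group and is a ring record for the notation of its sum.\<close>

definition balanced :: "('a, 's) ring_scheme \<Rightarrow> ('a, 'm, 't) module_scheme \<Rightarrow>
    ('a, 'n, 'u) module_scheme \<Rightarrow> ('w, 'v) ring_scheme \<Rightarrow> ('m \<Rightarrow> 'n \<Rightarrow> 'w) \<Rightarrow> bool" where
  "balanced A M N W \<beta> \<longleftrightarrow>
     (\<forall>x\<in>carrier M. \<forall>y\<in>carrier N. \<beta> x y \<in> carrier W) \<and>
     (\<forall>x\<in>carrier M. \<forall>x'\<in>carrier M. \<forall>y\<in>carrier N. \<beta> (x \<oplus>\<^bsub>M\<^esub> x') y = \<beta> x y \<oplus>\<^bsub>W\<^esub> \<beta> x' y) \<and>
     (\<forall>x\<in>carrier M. \<forall>y\<in>carrier N. \<forall>y'\<in>carrier N. \<beta> x (y \<oplus>\<^bsub>N\<^esub> y') = \<beta> x y \<oplus>\<^bsub>W\<^esub> \<beta> x y') \<and>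
     (\<forall>a\<in>carrier A. \<forall>x\<in>carrier M. \<forall>y\<in>carrier N. \<beta> (a \<odot>\<^bsub>M\<^esub> x) y = \<beta> x (a \<odot>\<^bsub>N\<^esub> y))"

lemma balancedI:
  assumes "\<And>x y. x \<in> carrier M \<Longrightarrow> y \<in> carrier N \<Longrightarrow> \<beta> x y \<in> carrier W"
    and "\<And>x x' y. x \<in> carrier M \<Longrightarrow> x' \<in> carrier M \<Longrightarrow> y \<in> carrier N \<Longrightarrow>
           \<beta> (x \<oplus>\<^bsub>M\<^esub> x') y = \<beta> x y \<oplus>\<^bsub>W\<^esub> \<beta> x' y"
    and "\<And>x y y'. x \<in> carrier M \<Longrightarrow> y \<in> carrier N \<Longrightarrow> y' \<in> carrier N \<Longrightarrow>
           \<beta> x (y \<oplus>\<^bsub>N\<^esub> y') = \<beta> x y \<oplus>\<^bsub>W\<^esub> \<beta> x y'"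
    and "\<And>a x y. a \<in> carrier A \<Longrightarrow> x \<in> carrier M \<Longrightarrow> y \<in> carrier N \<Longrightarrow>
           \<beta> (a \<odot>\<^bsub>M\<^esub> x) y = \<beta> x (a \<odot>\<^bsub>N\<^esub> y)"
  shows "balanced A M N W \<beta>"
  using assms by (simp add: balanced_def)

lemma tensor_algebra_simps [simp]:
  "carrier (tensor_algebra A M N) = carrier (tensor_group A M N)"
  "add (tensor_algebra A M N) = monoid.mult (tensor_group A M N)"
  "zero (tensor_algebra A M N) = one (tensor_group A M N)"
  by (simp_all add: tensor_algebra_def)

lemma base_change_simps [simp]:
  "carrier (base_change A M R) = carrier (tensor_group A M R)"
  "add (base_change A M R) = monoid.mult (tensor_group A M R)"
  "zero (base_change A M R) = one (tensor_group A M R)"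
  by (simp_all add: base_change_def)

lemma additive_zero:
  assumes "f \<in> hom (add_monoid V) (add_monoid W)" "abelian_group V" "abelian_group W"
  shows "f \<zero>\<^bsub>V\<^esub> = \<zero>\<^bsub>W\<^esub>"
proof -
  interpret V: abelian_group V by fact
  interpret W: abelian_group W by fact
  show ?thesis
    using hom_one[OF assms(1) V.a_group W.a_group] by simp
qed

text \<open>The parameter \<open>T\<close> is instantiated by both \<open>tensor_algebra A M N\<close> and
  \<open>base_change A M N\<close>, which share their additive structure.\<close>

locale tensor_product = M: module A M + N: module A N
  for A :: "('a, 's) ring_scheme" and M :: "('a, 'm) module" and N :: "('a, 'n) module" +
  fixes T :: "(('m \<times> 'n) frag set, 'w) ring_scheme"
  assumes carrier_T: "carrier T = carrier (tensor_group A M N)"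
    and add_T: "add T = monoid.mult (tensor_group A M N)"
    and zero_T: "zero T = one (tensor_group A M N)"
begin

abbreviation "free \<equiv> free_Abelian_group (carrier M \<times> carrier N)"
abbreviation "null \<equiv> tensor_null A M N"
abbreviation "pure \<equiv> pure_tensor A M N"

lemma relations_subset: "tensor_relations A M N \<subseteq> carrier free"
proof
  fix z assume "z \<in> tensor_relations A M N"
  then show "z \<in> carrier free"
    unfolding tensor_relations_def
    by (auto dest!: subsetD[OF keys_diff])
qed

lemma null_subgroup: "subgroup null free"
  unfolding tensor_null_def
  by (rule group.generate_is_subgroup[OF group_free_Abelian_group relations_subset])

lemma null_normal: "null \<lhd> free"
  by (rule comm_group.subgroup_imp_normal[OF abelian_free_Abelian_group null_subgroup])

lemma coset_eqI:
  assumes "x \<in> carrier free" "y \<in> carrier free" "x - y \<in> null"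
  shows "null #>\<^bsub>free\<^esub> x = null #>\<^bsub>free\<^esub> y"
proof -
  interpret free: group free by simp
  have "x \<in> null #>\<^bsub>free\<^esub> y"
    unfolding r_coset_def using assms(3) by (auto intro!: bexI[of _ "x - y"])
  then show ?thesis
    using free.repr_independence[OF _ assms(2) null_subgroup] by simp
qed

lemma abelian_group_T: "abelian_group T"
proof -
  interpret G: comm_group "tensor_group A M N"
    unfolding tensor_group_def
    by (rule comm_group.abelian_FactGroup[OF abelian_free_Abelian_group null_subgroup])
  show ?thesis
    by (rule abelian_groupI)
      (auto simp: carrier_T add_T zero_T G.m_ac intro!: bexI[of _ "inv\<^bsub>tensor_group A M N\<^esub> _"])
qed

sublocale T: abelian_group T
  by (rule abelian_group_T)

lemma coset_add:
  assumes "x \<in> carrier free" "y \<in> carrier free"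
  shows "(null #>\<^bsub>free\<^esub> x) \<oplus>\<^bsub>T\<^esub> (null #>\<^bsub>free\<^esub> y) = null #>\<^bsub>free\<^esub> (x + y)"
  using normal.rcos_sum[OF null_normal assms] by (simp add: add_T tensor_group_def)

lemma carrier_T_cosets: "carrier T = (\<lambda>x. null #>\<^bsub>free\<^esub> x) ` carrier free"
  by (simp add: carrier_T tensor_group_def carrier_FactGroup)

lemma pure_closed [simp, intro]:
  "x \<in> carrier M \<Longrightarrow> y \<in> carrier N \<Longrightarrow> pure x y \<in> carrier T"
  unfolding carrier_T_cosets pure_tensor_def by (auto intro!: imageI)

lemma pure_add_left:
  assumes "x \<in> carrier M" "x' \<in> carrier M" "y \<in> carrier N"
  shows "pure (x \<oplus>\<^bsub>M\<^esub> x') y = pure x y \<oplus>\<^bsub>T\<^esub> pure x' y"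
proof -
  have "frag_of (x \<oplus>\<^bsub>M\<^esub> x', y) - (frag_of (x, y) + frag_of (x', y)) \<in> null"
    unfolding tensor_null_def
    by (rule generate.incl) (use assms in \<open>force simp: tensor_relations_def algebra_simps\<close>)
  then show ?thesis
    using assms keys_add[of "frag_of (x, y)" "frag_of (x', y)"]
    by (simp add: pure_tensor_def coset_add) (rule coset_eqI, auto)
qed

lemma pure_add_right:
  assumes "x \<in> carrier M" "y \<in> carrier N" "y' \<in> carrier N"
  shows "pure x (y \<oplus>\<^bsub>N\<^esub> y') = pure x y \<oplus>\<^bsub>T\<^esub> pure x y'"
proof -
  have "frag_of (x, y \<oplus>\<^bsub>N\<^esub> y') - (frag_of (x, y) + frag_of (x, y')) \<in> null"
    unfolding tensor_null_def
    by (rule generate.incl) (use assms in \<open>force simp: tensor_relations_def algebra_simps\<close>)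
  then show ?thesis
    using assms keys_add[of "frag_of (x, y)" "frag_of (x, y')"]
    by (simp add: pure_tensor_def coset_add) (rule coset_eqI, auto)
qed

lemma pure_smult:
  assumes "a \<in> carrier A" "x \<in> carrier M" "y \<in> carrier N"
  shows "pure (a \<odot>\<^bsub>M\<^esub> x) y = pure x (a \<odot>\<^bsub>N\<^esub> y)"
proof -
  have "frag_of (a \<odot>\<^bsub>M\<^esub> x, y) - frag_of (x, a \<odot>\<^bsub>N\<^esub> y) \<in> null"
    unfolding tensor_null_def
    by (rule generate.incl) (use assms in \<open>force simp: tensor_relations_def\<close>)
  then show ?thesis
    using assms unfolding pure_tensor_def by (intro coset_eqI) auto
qed

lemma pure_zero_left [simp]: "y \<in> carrier N \<Longrightarrow> pure \<zero>\<^bsub>M\<^esub> y = \<zero>\<^bsub>T\<^esub>"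
  using pure_add_left[of "\<zero>\<^bsub>M\<^esub>" "\<zero>\<^bsub>M\<^esub>" y] by simp

lemma pure_zero_right [simp]: "x \<in> carrier M \<Longrightarrow> pure x \<zero>\<^bsub>N\<^esub> = \<zero>\<^bsub>T\<^esub>"
  using pure_add_right[of x "\<zero>\<^bsub>N\<^esub>" "\<zero>\<^bsub>N\<^esub>"] by simp

lemma pure_minus_left:
  assumes "x \<in> carrier M" "y \<in> carrier N"
  shows "pure (\<ominus>\<^bsub>M\<^esub> x) y = \<ominus>\<^bsub>T\<^esub> pure x y"
proof -
  have "pure (\<ominus>\<^bsub>M\<^esub> x) y \<oplus>\<^bsub>T\<^esub> pure x y = \<zero>\<^bsub>T\<^esub>"
    using assms pure_add_left[of "\<ominus>\<^bsub>M\<^esub> x" x y] by (simp add: M.l_neg)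
  then show ?thesis
    using assms by (simp add: T.minus_equality)
qed

text \<open>Sums of pure tensors already exhaust the tensor product, because the negative of
  \<open>pure x y\<close> is the pure tensor with the negative of \<open>x\<close>.\<close>

lemma T_induct [consumes 1, case_names pure add]:
  assumes "t \<in> carrier T"
    and pure: "\<And>x y. x \<in> carrier M \<Longrightarrow> y \<in> carrier N \<Longrightarrow> P (pure x y)"
    and add: "\<And>t t'. t \<in> carrier T \<Longrightarrow> t' \<in> carrier T \<Longrightarrow> P t \<Longrightarrow> P t' \<Longrightarrow> P (t \<oplus>\<^bsub>T\<^esub> t')"
  shows "P t"
proof -
  let ?c = "\<lambda>z. null #>\<^bsub>free\<^esub> z"
  have c_closed: "?c z \<in> carrier T" if "z \<in> carrier free" for z
    using that unfolding carrier_T_cosets by (rule imageI)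
  have zero: "?c 0 = \<zero>\<^bsub>T\<^esub>"
    using coset_add[of 0 0] c_closed[of 0] by simp
  have minus: "?c (- frag_of (x, y)) = pure (\<ominus>\<^bsub>M\<^esub> x) y" if "x \<in> carrier M" "y \<in> carrier N" for x y
  proof -
    have "?c (- frag_of (x, y)) \<oplus>\<^bsub>T\<^esub> pure x y = \<zero>\<^bsub>T\<^esub>"
      using that unfolding pure_tensor_def by (subst coset_add) (auto simp: zero)
    then show ?thesis
      using that c_closed[of "- frag_of (x, y)"] by (simp add: pure_minus_left T.minus_equality)
  qed
  obtain z where z: "z \<in> carrier free" "t = ?c z"
    using assms(1) unfolding carrier_T_cosets by auto
  \<comment> \<open>\<open>frag_induction\<close> combines elements by subtraction, so the claim is
    carried for \<open>z\<close> and \<open>- z\<close> together.\<close>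
  have "z \<in> carrier free \<and> P (?c z) \<and> P (?c (- z))"
  proof (rule frag_induction[where S="carrier M \<times> carrier N" and
        P="\<lambda>z. z \<in> carrier free \<and> P (?c z) \<and> P (?c (- z))"])
    show "0 \<in> carrier free \<and> P (?c 0) \<and> P (?c (- 0))"
      using pure[of "\<zero>\<^bsub>M\<^esub>" "\<zero>\<^bsub>N\<^esub>"] by (simp add: zero)
  next
    show "Poly_Mapping.keys z \<subseteq> carrier M \<times> carrier N" using z by simp
  next
    fix x assume "x \<in> carrier M \<times> carrier N"
    then show "frag_of x \<in> carrier free \<and> P (?c (frag_of x)) \<and> P (?c (- frag_of x))"
      using pure minus by (auto simp flip: pure_tensor_def)
  next
    fix a b :: "('m \<times> 'n) frag"
    assume ab: "a \<in> carrier free \<and> P (?c a) \<and> P (?c (- a))"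
      "b \<in> carrier free \<and> P (?c b) \<and> P (?c (- b))"
    then show "a - b \<in> carrier free \<and> P (?c (a - b)) \<and> P (?c (- (a - b)))"
      using add[of "?c a" "?c (- b)"] add[of "?c b" "?c (- a)"] c_closed
        coset_add[of a "- b"] coset_add[of b "- a"] keys_diff[of a b]
      by auto
  qed
  then show ?thesis using z by simp
qed

lemma hom_eqI:
  assumes "f \<in> hom (add_monoid T) (add_monoid W)" "g \<in> hom (add_monoid T) (add_monoid W)"
    and "\<And>x y. x \<in> carrier M \<Longrightarrow> y \<in> carrier N \<Longrightarrow> f (pure x y) = g (pure x y)"
    and "t \<in> carrier T"
  shows "f t = g t"
  using assms(4) by (induct rule: T_induct) (use assms(1-3) in \<open>auto simp: hom_def\<close>)

text \<open>The free abelian group extends \<beta> to a homomorphism \<open>k\<close>. Each relation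
  is a difference of two elements on which \<open>k\<close> agrees, by the corresponding clause of
  \<open>balanced\<close>, so \<open>k\<close> factors through the quotient.\<close>

lemma tensor_lift_exists:
  assumes W: "abelian_group W" and \<beta>: "balanced A M N W \<beta>"
  obtains F where "F \<in> hom (tensor_group A M N) (add_monoid W)"
    "\<And>x y. x \<in> carrier M \<Longrightarrow> y \<in> carrier N \<Longrightarrow> F (pure x y) = \<beta> x y"
proof -
  interpret W: abelian_group W by fact
  interpret free: group free by simp
  have "(\<lambda>(x, y). \<beta> x y) ` (carrier M \<times> carrier N) \<subseteq> carrier (add_monoid W)"
    using \<beta> by (auto simp: balanced_def)
  then obtain k where k: "k \<in> hom free (add_monoid W)"
    and k_of: "\<And>x y. x \<in> carrier M \<Longrightarrow> y \<in> carrier N \<Longrightarrow> k (frag_of (x, y)) = \<beta> x y"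
    by (rule comm_group.free_Abelian_group_universal[OF W.a_comm_group]) force
  interpret k: group_hom free "add_monoid W" k
    by unfold_locales (use k in auto)
  have k_add: "k (a + b) = k a \<oplus>\<^bsub>W\<^esub> k b" if "a \<in> carrier free" "b \<in> carrier free" for a b
    using k.hom_mult[OF that] by simp
  have k_closed: "k a \<in> carrier W" if "a \<in> carrier free" for a
    using k.hom_closed[OF that] by simp
  have in_kernel: "a - b \<in> kernel free (add_monoid W) k"
    if "a \<in> carrier free" "b \<in> carrier free" "k a = k b" for a b
  proof -
    have ab: "a - b \<in> carrier free"
      using that keys_diff[of a b] by auto
    have "k (a - b) \<oplus>\<^bsub>W\<^esub> k b = k b"
      using k_add[OF ab that(2)] that(3) by simp
    then have "k (a - b) = \<zero>\<^bsub>W\<^esub>"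
      using ab that(2) by (simp add: k_closed)
    then show ?thesis
      using ab by (simp add: kernel_def)
  qed
  have "tensor_relations A M N \<subseteq> kernel free (add_monoid W) k"
  proof
    fix z assume z: "z \<in> tensor_relations A M N"
    from z obtain a b where "z = a - b" "a \<in> carrier free" "b \<in> carrier free" "k a = k b"
    proof -
      consider
        (left) x x' y where "z = frag_of (x \<oplus>\<^bsub>M\<^esub> x', y) - (frag_of (x, y) + frag_of (x', y))"
          "x \<in> carrier M" "x' \<in> carrier M" "y \<in> carrier N"
        | (right) x y y' where "z = frag_of (x, y \<oplus>\<^bsub>N\<^esub> y') - (frag_of (x, y) + frag_of (x, y'))"
          "x \<in> carrier M" "y \<in> carrier N" "y' \<in> carrier N"
        | (smult) a x y where "z = frag_of (a \<odot>\<^bsub>M\<^esub> x, y) - frag_of (x, a \<odot>\<^bsub>N\<^esub> y)"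
          "a \<in> carrier A" "x \<in> carrier M" "y \<in> carrier N"
        using z unfolding tensor_relations_def by (force simp: algebra_simps)
      then show thesis
      proof cases
        case left
        then show thesis
          using \<beta> keys_add[of "frag_of (x, y)" "frag_of (x', y)"]
          by (intro that[OF left(1)]) (auto simp: k_add k_of balanced_def)
      next
        case right
        then show thesis
          using \<beta> keys_add[of "frag_of (x, y)" "frag_of (x, y')"]
          by (intro that[OF right(1)]) (auto simp: k_add k_of balanced_def)
      next
        case smult
        then show thesis
          using \<beta> by (intro that[OF smult(1)]) (auto simp: k_of balanced_def)
      qed
    qed
    then show "z \<in> kernel free (add_monoid W) k"
      by (simp add: in_kernel)
  qed
  then have "null \<subseteq> kernel free (add_monoid W) k"
    unfolding tensor_null_def by (rule free.generate_subgroup_incl[OF _ k.subgroup_kernel])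
  then obtain F where F: "F \<in> hom (free Mod null) (add_monoid W)"
    and F_coset: "\<And>x. x \<in> carrier free \<Longrightarrow> F (null #>\<^bsub>free\<^esub> x) = k x"
    using k.FactGroup_universal_kernel[OF null_normal] by metis
  show thesis
  proof (rule that)
    show "F \<in> hom (tensor_group A M N) (add_monoid W)"
      using F by (simp add: tensor_group_def)
  qed (simp add: pure_tensor_def F_coset k_of)
qed

end

section \<open>Universal property and functoriality of the tensor product\<close>

context tensor_product begin

text \<open>The definite description in \<open>tensor_lift\<close> has a value: existence is the
  universal property, and uniqueness follows from additivity on pure tensors together with
  extensionality. \<open>G\<close> is kept apart from \<open>W\<close> because the lifts that occur
  take values in \<open>tensor_group\<close> as well as in the additive monoid of a module.\<close>

lemma tensor_lift_properties:
  assumes W: "abelian_group W" and \<beta>: "balanced A M N W \<beta>"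
    and G: "carrier G = carrier W" "monoid.mult G = add W"
  shows tensor_lift_hom: "tensor_lift A M N G \<beta> \<in> hom (add_monoid T) (add_monoid W)"
    and tensor_lift_extensional: "tensor_lift A M N G \<beta> \<in> extensional (carrier T)"
    and tensor_lift_pure: "x \<in> carrier M \<Longrightarrow> y \<in> carrier N \<Longrightarrow> tensor_lift A M N G \<beta> (pure x y) = \<beta> x y"
proof -
  have hom_G: "hom (tensor_group A M N) G = hom (add_monoid T) (add_monoid W)"
    by (simp add: hom_def G carrier_T add_T)
  let ?P = "\<lambda>F. F \<in> extensional (carrier (tensor_group A M N)) \<and> F \<in> hom (tensor_group A M N) G \<and>
      (\<forall>x\<in>carrier M. \<forall>y\<in>carrier N. F (pure x y) = \<beta> x y)"
  obtain F where F: "F \<in> hom (tensor_group A M N) (add_monoid W)"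
    "\<And>x y. x \<in> carrier M \<Longrightarrow> y \<in> carrier N \<Longrightarrow> F (pure x y) = \<beta> x y"
    using tensor_lift_exists[OF W \<beta>] by metis
  have "?P (restrict F (carrier (tensor_group A M N)))"
    using F T.add.m_closed by (auto simp: hom_def G simp flip: carrier_T add_T)
  moreover have "F' = F''" if "?P F'" "?P F''" for F' F''
  proof (rule extensionalityI[of _ "carrier T"])
    fix t assume "t \<in> carrier T"
    then show "F' t = F'' t"
      by (rule hom_eqI[rotated 3]) (use that in \<open>auto simp: hom_G\<close>)
  qed (use that in \<open>auto simp: carrier_T\<close>)
  ultimately have "\<exists>!F. ?P F"
    by (intro ex1I[of ?P "restrict F (carrier (tensor_group A M N))"]) blast+
  then have "?P (tensor_lift A M N G \<beta>)"
    unfolding tensor_lift_def by (rule theI'[of ?P])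
  then show "tensor_lift A M N G \<beta> \<in> hom (add_monoid T) (add_monoid W)"
    and "tensor_lift A M N G \<beta> \<in> extensional (carrier T)"
    and "x \<in> carrier M \<Longrightarrow> y \<in> carrier N \<Longrightarrow> tensor_lift A M N G \<beta> (pure x y) = \<beta> x y"
    by (auto simp: hom_G carrier_T)
qed

lemma tensor_lift_closed:
  assumes "abelian_group W" "balanced A M N W \<beta>" "carrier G = carrier W" "monoid.mult G = add W"
    and "t \<in> carrier T"
  shows "tensor_lift A M N G \<beta> t \<in> carrier W"
  using tensor_lift_hom[OF assms(1-4)] assms(5) by (auto simp: hom_def)

lemma tensor_lift_add:
  assumes "abelian_group W" "balanced A M N W \<beta>" "carrier G = carrier W" "monoid.mult G = add W"
    and "t \<in> carrier T" "t' \<in> carrier T"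
  shows "tensor_lift A M N G \<beta> (t \<oplus>\<^bsub>T\<^esub> t') = tensor_lift A M N G \<beta> t \<oplus>\<^bsub>W\<^esub> tensor_lift A M N G \<beta> t'"
  using tensor_lift_hom[OF assms(1-4)] assms(5,6) by (auto simp: hom_def)

end

lemma (in module) smult_linear_map:
  "a \<in> carrier R \<Longrightarrow> (\<lambda>x. a \<odot>\<^bsub>M\<^esub> x) \<in> linear_maps R M M"
  by (auto simp: linear_maps_def hom_def smult_r_distr smult_assoc1[symmetric] R.m_comm)

lemma id_linear_map: "(\<lambda>x. x) \<in> linear_maps A M M"
  by (simp add: linear_maps_def hom_def)

context
  fixes A :: "('a, 's) ring_scheme"
    and M :: "('a, 'm) module" and N :: "('a, 'n) module"
    and T :: "(('m \<times> 'n) frag set, 'w) ring_scheme"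
    and M2 :: "('a, 'm2) module" and N2 :: "('a, 'n2) module"
    and T2 :: "(('m2 \<times> 'n2) frag set, 'w2) ring_scheme"
  assumes T: "tensor_product A M N T" and T2: "tensor_product A M2 N2 T2"
begin

interpretation T: tensor_product A M N T by (fact T)
interpretation T2: tensor_product A M2 N2 T2 by (fact T2)

lemma tensor_map_balanced:
  assumes f: "f \<in> linear_maps A M M2" and g: "g \<in> linear_maps A N N2"
  shows "balanced A M N T2 (\<lambda>x y. pure_tensor A M2 N2 (f x) (g y))"
  by (rule balancedI)
    (auto simp: linear_mapsD[OF f] linear_mapsD[OF g] T2.pure_add_left T2.pure_add_right T2.pure_smult)

lemma
  assumes f: "f \<in> linear_maps A M M2" and g: "g \<in> linear_maps A N N2"
  shows tensor_map_hom: "tensor_map A M N M2 N2 f g \<in> hom (add_monoid T) (add_monoid T2)"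
    and tensor_map_pure: "x \<in> carrier M \<Longrightarrow> y \<in> carrier N \<Longrightarrow>
       tensor_map A M N M2 N2 f g (pure_tensor A M N x y) = pure_tensor A M2 N2 (f x) (g y)"
  unfolding tensor_map_def
  using T.tensor_lift_properties[OF T2.abelian_group_T tensor_map_balanced[OF f g]
      T2.carrier_T[symmetric] T2.add_T[symmetric]] by blast+

lemma
  assumes f: "f \<in> linear_maps A M M2" and g: "g \<in> linear_maps A N N2"
  shows tensor_map_closed: "t \<in> carrier T \<Longrightarrow> tensor_map A M N M2 N2 f g t \<in> carrier T2"
    and tensor_map_add: "t \<in> carrier T \<Longrightarrow> t' \<in> carrier T \<Longrightarrow>
       tensor_map A M N M2 N2 f g (t \<oplus>\<^bsub>T\<^esub> t') =
       tensor_map A M N M2 N2 f g t \<oplus>\<^bsub>T2\<^esub> tensor_map A M N M2 N2 f g t'"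
  using tensor_map_hom[OF f g] by (auto simp: hom_def)

text \<open>Both iterated tensor lifts of the base theory, the product of \<open>tensor_algebra\<close> and
  \<open>bilinear_R\<close>, are of this shape.\<close>

lemma tensor_lift2_properties:
  fixes \<beta> :: "'m \<Rightarrow> 'n \<Rightarrow> 'm2 \<Rightarrow> 'n2 \<Rightarrow> 'x" and G :: "('x, 'y) monoid_scheme"
  defines "L \<equiv> \<lambda>t t'. tensor_lift A M N G (\<lambda>x y. tensor_lift A M2 N2 G (\<beta> x y) t') t"
  assumes W: "abelian_group W"
    and right: "\<And>x y. x \<in> carrier M \<Longrightarrow> y \<in> carrier N \<Longrightarrow> balanced A M2 N2 W (\<beta> x y)"
    and left: "\<And>x' y'. x' \<in> carrier M2 \<Longrightarrow> y' \<in> carrier N2 \<Longrightarrow> balanced A M N W (\<lambda>x y. \<beta> x y x' y')"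
    and G: "carrier G = carrier W" "monoid.mult G = add W"
  shows tensor_lift2_closed: "t \<in> carrier T \<Longrightarrow> t' \<in> carrier T2 \<Longrightarrow> L t t' \<in> carrier W"
    and tensor_lift2_add_left: "t \<in> carrier T \<Longrightarrow> s \<in> carrier T \<Longrightarrow> t' \<in> carrier T2 \<Longrightarrow>
          L (t \<oplus>\<^bsub>T\<^esub> s) t' = L t t' \<oplus>\<^bsub>W\<^esub> L s t'"
    and tensor_lift2_add_right: "t \<in> carrier T \<Longrightarrow> t' \<in> carrier T2 \<Longrightarrow> s' \<in> carrier T2 \<Longrightarrow>
          L t (t' \<oplus>\<^bsub>T2\<^esub> s') = L t t' \<oplus>\<^bsub>W\<^esub> L t s'"
    and tensor_lift2_pure: "x \<in> carrier M \<Longrightarrow> y \<in> carrier N \<Longrightarrow> x' \<in> carrier M2 \<Longrightarrow> y' \<in> carrier N2 \<Longrightarrow>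
          L (pure_tensor A M N x y) (pure_tensor A M2 N2 x' y') = \<beta> x y x' y'"
proof -
  interpret W: abelian_group W by fact
  note inner = T2.tensor_lift_properties[OF W right G]
  note inner_closed = T2.tensor_lift_closed[OF W right G]
  note inner_add = T2.tensor_lift_add[OF W right G]
  \<comment> \<open>The inner lift depends on \<open>x\<close> and \<open>y\<close> in a balanced
    way: at a pure \<open>t'\<close> this is the hypothesis \<open>left\<close>, and both sides are
    additive in \<open>t'\<close>.\<close>
  have outer_balanced: "balanced A M N W (\<lambda>x y. tensor_lift A M2 N2 G (\<beta> x y) t')"
    if t': "t' \<in> carrier T2" for t'
  proof (rule balancedI)
    fix x x' y assume xy: "x \<in> carrier M" "x' \<in> carrier M" "y \<in> carrier N"
    from t' show "tensor_lift A M2 N2 G (\<beta> (x \<oplus>\<^bsub>M\<^esub> x') y) t' =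
        tensor_lift A M2 N2 G (\<beta> x y) t' \<oplus>\<^bsub>W\<^esub> tensor_lift A M2 N2 G (\<beta> x' y) t'"
    proof (induct rule: T2.T_induct)
      case (pure a b)
      then show ?case using xy left[OF pure] by (simp add: inner balanced_def)
    next
      case (add t t')
      then show ?case using xy by (simp add: inner_add inner_closed W.a_ac)
    qed
  next
    fix x y y' assume xy: "x \<in> carrier M" "y \<in> carrier N" "y' \<in> carrier N"
    from t' show "tensor_lift A M2 N2 G (\<beta> x (y \<oplus>\<^bsub>N\<^esub> y')) t' =
        tensor_lift A M2 N2 G (\<beta> x y) t' \<oplus>\<^bsub>W\<^esub> tensor_lift A M2 N2 G (\<beta> x y') t'"
    proof (induct rule: T2.T_induct)
      case (pure a b)
      then show ?case using xy left[OF pure] by (simp add: inner balanced_def)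
    next
      case (add t t')
      then show ?case using xy by (simp add: inner_add inner_closed W.a_ac)
    qed
  next
    fix a x y assume xy: "a \<in> carrier A" "x \<in> carrier M" "y \<in> carrier N"
    from t' show "tensor_lift A M2 N2 G (\<beta> (a \<odot>\<^bsub>M\<^esub> x) y) t' =
        tensor_lift A M2 N2 G (\<beta> x (a \<odot>\<^bsub>N\<^esub> y)) t'"
    proof (induct rule: T2.T_induct)
      case (pure b c)
      then show ?case using xy left[OF pure] by (simp add: inner balanced_def)
    next
      case (add t t')
      then show ?case using xy by (simp add: inner_add inner_closed)
    qed
  qed (simp add: inner_closed t')
  note outer = T.tensor_lift_properties[OF W outer_balanced G]
  note outer_closed = T.tensor_lift_closed[OF W outer_balanced G]
  note outer_add = T.tensor_lift_add[OF W outer_balanced G]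
  show closed: "t \<in> carrier T \<Longrightarrow> t' \<in> carrier T2 \<Longrightarrow> L t t' \<in> carrier W" for t t'
    by (simp add: L_def outer_closed)
  show add_left: "t \<in> carrier T \<Longrightarrow> s \<in> carrier T \<Longrightarrow> t' \<in> carrier T2 \<Longrightarrow>
          L (t \<oplus>\<^bsub>T\<^esub> s) t' = L t t' \<oplus>\<^bsub>W\<^esub> L s t'" for t s t'
    by (simp add: L_def outer_add)
  show "t \<in> carrier T \<Longrightarrow> t' \<in> carrier T2 \<Longrightarrow> s' \<in> carrier T2 \<Longrightarrow>
          L t (t' \<oplus>\<^bsub>T2\<^esub> s') = L t t' \<oplus>\<^bsub>W\<^esub> L t s'"
  proof (induct t rule: T.T_induct)
    case (pure x y)
    then show ?case by (simp add: L_def outer inner_add)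
  next
    case (add t s)
    then show ?case by (simp add: add_left closed W.a_ac)
  qed
  show "x \<in> carrier M \<Longrightarrow> y \<in> carrier N \<Longrightarrow> x' \<in> carrier M2 \<Longrightarrow> y' \<in> carrier N2 \<Longrightarrow>
          L (pure_tensor A M N x y) (pure_tensor A M2 N2 x' y') = \<beta> x y x' y'"
    by (simp add: L_def outer inner)
qed

end

lemma tensor_product_tensor_algebra:
  "module A M \<Longrightarrow> module A N \<Longrightarrow> tensor_product A M N (tensor_algebra A M N)"
  by (simp add: tensor_product_def tensor_product_axioms_def)

lemma tensor_product_base_change:
  "module A M \<Longrightarrow> algebra A R \<Longrightarrow> tensor_product A M R (base_change A M R)"
  by (simp add: tensor_product_def tensor_product_axioms_def algebra.module)

lemma tensor_algebra_smult_pure: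
  assumes M: "module A M" and N: "module A N"
    and axy: "a \<in> carrier A" "x \<in> carrier M" "y \<in> carrier N"
  shows "a \<odot>\<^bsub>tensor_algebra A M N\<^esub> pure_tensor A M N x y = pure_tensor A M N (a \<odot>\<^bsub>M\<^esub> x) y"
proof -
  interpret M: module A M by fact
  have "module.smult (tensor_algebra A M N) a = tensor_map A M N M N (\<lambda>x. a \<odot>\<^bsub>M\<^esub> x) (\<lambda>y. y)"
    by (simp add: tensor_algebra_def tensor_map_def)
  then show ?thesis
    using tensor_map_pure[OF tensor_product_tensor_algebra tensor_product_tensor_algebra
        M.smult_linear_map id_linear_map] assms by simp
qed

lemma module_tensor_algebra:
  assumes M: "module A M" and N: "module A N"
  shows "module A (tensor_algebra A M N)" (is "module A ?T")
proof -
  interpret M: module A M by fact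
  interpret N: module A N by fact
  interpret T: tensor_product A M N ?T by (rule tensor_product_tensor_algebra[OF M N])
  have smult: "module.smult ?T a = tensor_map A M N M N (\<lambda>x. a \<odot>\<^bsub>M\<^esub> x) (\<lambda>y. y)" for a
    by (simp add: tensor_algebra_def tensor_map_def)
  note T = T.tensor_product_axioms
  have closed: "a \<odot>\<^bsub>?T\<^esub> t \<in> carrier ?T" if "a \<in> carrier A" "t \<in> carrier ?T" for a t
    unfolding smult by (rule tensor_map_closed[OF T T M.smult_linear_map[OF that(1)] id_linear_map that(2-)])
  have smult_add: "a \<odot>\<^bsub>?T\<^esub> (t \<oplus>\<^bsub>?T\<^esub> t') = a \<odot>\<^bsub>?T\<^esub> t \<oplus>\<^bsub>?T\<^esub> a \<odot>\<^bsub>?T\<^esub> t'"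
    if "a \<in> carrier A" "t \<in> carrier ?T" "t' \<in> carrier ?T" for a t t'
    unfolding smult by (rule tensor_map_add[OF T T M.smult_linear_map[OF that(1)] id_linear_map that(2-)])
  note smult_pure = tensor_algebra_smult_pure[OF M N]
  note [simp del] = tensor_algebra_simps
  show ?thesis
  proof (rule moduleI)
    fix a b t assume ab: "a \<in> carrier A" "b \<in> carrier A" and t: "t \<in> carrier ?T"
    from t show "(a \<oplus>\<^bsub>A\<^esub> b) \<odot>\<^bsub>?T\<^esub> t = a \<odot>\<^bsub>?T\<^esub> t \<oplus>\<^bsub>?T\<^esub> b \<odot>\<^bsub>?T\<^esub> t"
    proof (induct rule: T.T_induct)
      case (pure x y)
      then show ?case using ab by (simp add: smult_pure M.smult_l_distr T.pure_add_left)
    next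
      case (add t t')
      then show ?case using ab by (simp add: smult_add closed T.T.a_ac)
    qed
    from t show "(a \<otimes>\<^bsub>A\<^esub> b) \<odot>\<^bsub>?T\<^esub> t = a \<odot>\<^bsub>?T\<^esub> (b \<odot>\<^bsub>?T\<^esub> t)"
    proof (induct rule: T.T_induct)
      case (pure x y)
      then show ?case using ab by (simp add: smult_pure M.smult_assoc1)
    next
      case (add t t')
      then show ?case using ab by (simp add: smult_add closed)
    qed
  next
    fix t assume t: "t \<in> carrier ?T"
    then show "\<one>\<^bsub>A\<^esub> \<odot>\<^bsub>?T\<^esub> t = t"
    proof (induct rule: T.T_induct)
      case (pure x y)
      then show ?case by (simp add: smult_pure)
    next
      case (add t t')
      then show ?case by (simp add: smult_add)
    qed
  qed (use M.R.is_cring T.abelian_group_T in \<open>simp_all add: closed smult_add\<close>)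
qed

section \<open>Base change and tensor products of algebras\<close>

locale base_change_module = M: module A M + R: algebra A R
  for A :: "('a, 's) ring_scheme" and M :: "('a, 'm) module" and R :: "('a, 'r) module"
begin

abbreviation "B \<equiv> base_change A M R"

sublocale B: tensor_product A M R B
  by (rule tensor_product_base_change) unfold_locales

lemma mult_linear_map: "r \<in> carrier R \<Longrightarrow> (\<lambda>s. r \<otimes>\<^bsub>R\<^esub> s) \<in> linear_maps A R R"
  by (auto simp: linear_maps_def hom_def R.r_distr R.m_comm[of r] R.smult_assoc2)

lemma smult_eq: "module.smult B r = tensor_map A M R M R (\<lambda>x. x) (\<lambda>s. r \<otimes>\<^bsub>R\<^esub> s)"
  by (simp add: base_change_def tensor_map_def)

lemma smult_pure: "r \<in> carrier R \<Longrightarrow> x \<in> carrier M \<Longrightarrow> s \<in> carrier R \<Longrightarrow>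
    r \<odot>\<^bsub>B\<^esub> B.pure x s = B.pure x (r \<otimes>\<^bsub>R\<^esub> s)"
  unfolding smult_eq
  by (rule tensor_map_pure[OF B.tensor_product_axioms B.tensor_product_axioms id_linear_map mult_linear_map])

lemma module_base_change: "module R B"
proof -
  note T = B.tensor_product_axioms
  have closed: "r \<odot>\<^bsub>B\<^esub> t \<in> carrier B" if "r \<in> carrier R" "t \<in> carrier B" for r t
    unfolding smult_eq by (rule tensor_map_closed[OF T T id_linear_map mult_linear_map[OF that(1)] that(2)])
  have smult_add: "r \<odot>\<^bsub>B\<^esub> (t \<oplus>\<^bsub>B\<^esub> t') = r \<odot>\<^bsub>B\<^esub> t \<oplus>\<^bsub>B\<^esub> r \<odot>\<^bsub>B\<^esub> t'"
    if "r \<in> carrier R" "t \<in> carrier B" "t' \<in> carrier B" for r t t'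
    unfolding smult_eq by (rule tensor_map_add[OF T T id_linear_map mult_linear_map[OF that(1)] that(2,3)])
  note [simp del] = base_change_simps
  show ?thesis
  proof (rule moduleI)
    fix a b t assume ab: "a \<in> carrier R" "b \<in> carrier R" and t: "t \<in> carrier B"
    from t show "(a \<oplus>\<^bsub>R\<^esub> b) \<odot>\<^bsub>B\<^esub> t = a \<odot>\<^bsub>B\<^esub> t \<oplus>\<^bsub>B\<^esub> b \<odot>\<^bsub>B\<^esub> t"
    proof (induct rule: B.T_induct)
      case (pure x y)
      then show ?case using ab by (simp add: smult_pure R.l_distr B.pure_add_right)
    next
      case (add t t')
      then show ?case using ab by (simp add: smult_add closed B.T.a_ac)
    qed
    from t show "(a \<otimes>\<^bsub>R\<^esub> b) \<odot>\<^bsub>B\<^esub> t = a \<odot>\<^bsub>B\<^esub> (b \<odot>\<^bsub>B\<^esub> t)"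
    proof (induct rule: B.T_induct)
      case (pure x y)
      then show ?case using ab by (simp add: smult_pure R.m_assoc)
    next
      case (add t t')
      then show ?case using ab by (simp add: smult_add closed)
    qed
  next
    fix t assume t: "t \<in> carrier B"
    then show "\<one>\<^bsub>R\<^esub> \<odot>\<^bsub>B\<^esub> t = t"
    proof (induct rule: B.T_induct)
      case (pure x y)
      then show ?case by (simp add: smult_pure)
    next
      case (add t t')
      then show ?case by (simp add: smult_add)
    qed
  qed (use R.M_cring B.abelian_group_T in \<open>simp_all add: closed smult_add\<close>)
qed

end

locale tensor_algebra_pair = S: algebra A S + U: algebra A U
  for A :: "('a, 's) ring_scheme" and S :: "('a, 'm) module" and U :: "('a, 'n) module"
begin

abbreviation "T \<equiv> tensor_algebra A S U"

sublocale T: tensor_product A S U T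
  by (rule tensor_product_tensor_algebra) unfold_locales

lemmas mult_rules =
  tensor_lift2_properties[OF T.tensor_product_axioms T.tensor_product_axioms T.abelian_group_T,
    of "\<lambda>x y x' y'. T.pure (x \<otimes>\<^bsub>S\<^esub> x') (y \<otimes>\<^bsub>U\<^esub> y')" "tensor_group A S U",
    OF _ _ T.carrier_T[symmetric] T.add_T[symmetric]]

lemma mult_eq: "t \<otimes>\<^bsub>T\<^esub> t' = tensor_lift A S U (tensor_group A S U)
    (\<lambda>x y. tensor_lift A S U (tensor_group A S U) (\<lambda>x' y'. T.pure (x \<otimes>\<^bsub>S\<^esub> x') (y \<otimes>\<^bsub>U\<^esub> y')) t') t"
  by (simp add: tensor_algebra_def)

lemma mult_balanced_right:
  "x \<in> carrier S \<Longrightarrow> y \<in> carrier U \<Longrightarrow>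
   balanced A S U T (\<lambda>x' y'. T.pure (x \<otimes>\<^bsub>S\<^esub> x') (y \<otimes>\<^bsub>U\<^esub> y'))"
  by (rule balancedI)
    (simp_all add: S.r_distr U.r_distr T.pure_add_left T.pure_add_right S.m_comm[of x] U.m_comm[of y]
      S.smult_assoc2 U.smult_assoc2 T.pure_smult del: tensor_algebra_simps)

lemma mult_balanced_left:
  "x' \<in> carrier S \<Longrightarrow> y' \<in> carrier U \<Longrightarrow>
   balanced A S U T (\<lambda>x y. T.pure (x \<otimes>\<^bsub>S\<^esub> x') (y \<otimes>\<^bsub>U\<^esub> y'))"
  by (rule balancedI)
    (simp_all add: S.l_distr U.l_distr T.pure_add_left T.pure_add_right
      S.smult_assoc2 U.smult_assoc2 T.pure_smult del: tensor_algebra_simps)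

lemmas mult_properties = mult_rules[OF mult_balanced_right mult_balanced_left, folded mult_eq]

lemma mult_pure: "x \<in> carrier S \<Longrightarrow> y \<in> carrier U \<Longrightarrow> x' \<in> carrier S \<Longrightarrow> y' \<in> carrier U \<Longrightarrow>
    T.pure x y \<otimes>\<^bsub>T\<^esub> T.pure x' y' = T.pure (x \<otimes>\<^bsub>S\<^esub> x') (y \<otimes>\<^bsub>U\<^esub> y')"
  by (rule mult_properties(4))

lemma one_T: "\<one>\<^bsub>T\<^esub> = T.pure \<one>\<^bsub>S\<^esub> \<one>\<^bsub>U\<^esub>"
  by (simp add: tensor_algebra_def)

text \<open>All expressions are additive in each variable, so the axioms reduce to pure tensors,
  where they hold factor by factor.\<close>

lemma algebra_T: "algebra A T"
proof -
  interpret TM: module A T by (rule module_tensor_algebra) unfold_locales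
  note smult_pure = tensor_algebra_smult_pure[OF S.module U.module]
  note closed = mult_properties(1) and add_left = mult_properties(2) and add_right = mult_properties(3)
  note [simp del] = tensor_algebra_simps
  have comm: "t \<otimes>\<^bsub>T\<^esub> t' = t' \<otimes>\<^bsub>T\<^esub> t" if "t \<in> carrier T" "t' \<in> carrier T" for t t'
    using that
  proof (induct t rule: T.T_induct)
    case (pure x y)
    note xy = pure(1,2)
    from \<open>t' \<in> carrier T\<close> show ?case
    proof (induct t' rule: T.T_induct)
      case (pure x' y')
      then show ?case using xy by (simp add: mult_pure S.m_comm U.m_comm)
    next
      case (add t t')
      then show ?case using xy by (simp add: add_left add_right)
    qed
  next
    case (add t t')
    then show ?case by (simp add: add_left add_right)
  qed
  have assoc: "(t \<otimes>\<^bsub>T\<^esub> t') \<otimes>\<^bsub>T\<^esub> t'' = t \<otimes>\<^bsub>T\<^esub> (t' \<otimes>\<^bsub>T\<^esub> t'')"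
    if "t \<in> carrier T" "t' \<in> carrier T" "t'' \<in> carrier T" for t t' t''
    using that
  proof (induct t rule: T.T_induct)
    case (pure x y)
    note xy = pure(1,2)
    from \<open>t' \<in> carrier T\<close> \<open>t'' \<in> carrier T\<close> show ?case
    proof (induct t' rule: T.T_induct)
      case (pure x' y')
      note xy' = pure(1,2)
      from \<open>t'' \<in> carrier T\<close> show ?case
      proof (induct t'' rule: T.T_induct)
        case (pure x'' y'')
        then show ?case using xy xy' by (simp add: mult_pure S.m_assoc U.m_assoc)
      next
        case (add t t')
        then show ?case using xy xy' by (simp add: add_left add_right closed)
      qed
    next
      case (add t t')
      then show ?case using xy by (simp add: add_left add_right closed)
    qed
  next
    case (add t t')
    then show ?case by (simp add: add_left add_right closed)
  qed
  have one: "\<one>\<^bsub>T\<^esub> \<otimes>\<^bsub>T\<^esub> t = t" if "t \<in> carrier T" for t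
    using that
  proof (induct t rule: T.T_induct)
    case (pure x y)
    then show ?case by (simp add: one_T mult_pure)
  next
    case (add t t')
    then show ?case by (simp add: one_T add_right)
  qed
  have smult_mult: "(a \<odot>\<^bsub>T\<^esub> t) \<otimes>\<^bsub>T\<^esub> t' = a \<odot>\<^bsub>T\<^esub> (t \<otimes>\<^bsub>T\<^esub> t')"
    if "a \<in> carrier A" "t \<in> carrier T" "t' \<in> carrier T" for a t t'
    using that(2,3)
  proof (induct t rule: T.T_induct)
    case (pure x y)
    note xy = pure(1,2)
    from \<open>t' \<in> carrier T\<close> show ?case
    proof (induct t' rule: T.T_induct)
      case (pure x' y')
      then show ?case using xy that(1) by (simp add: mult_pure smult_pure S.smult_assoc2)
    next
      case (add t t')
      then show ?case using xy that(1) by (simp add: add_right closed TM.smult_r_distr)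
    qed
  next
    case (add t s)
    then show ?case using that(1) by (simp add: TM.smult_r_distr add_left closed)
  qed
  have one_closed: "\<one>\<^bsub>T\<^esub> \<in> carrier T"
    by (simp add: one_T)
  show ?thesis
  proof (rule algebraI)
    show "cring T"
      by (rule cringI[OF T.abelian_group_T comm_monoidI])
        (rule closed one_closed assoc one comm add_left; assumption)+
  qed (simp_all add: S.R_cring TM.smult_l_distr TM.smult_r_distr TM.smult_assoc1 smult_mult)
qed

end

section \<open>Algebra homomorphisms and points of a fibre product\<close>

lemma alg_homsD:
  assumes "y \<in> alg_homs A S R"
  shows "s \<in> carrier S \<Longrightarrow> y s \<in> carrier R"
    and "s \<in> carrier S \<Longrightarrow> s' \<in> carrier S \<Longrightarrow> y (s \<otimes>\<^bsub>S\<^esub> s') = y s \<otimes>\<^bsub>R\<^esub> y s'"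
    and "s \<in> carrier S \<Longrightarrow> s' \<in> carrier S \<Longrightarrow> y (s \<oplus>\<^bsub>S\<^esub> s') = y s \<oplus>\<^bsub>R\<^esub> y s'"
    and "y \<one>\<^bsub>S\<^esub> = \<one>\<^bsub>R\<^esub>"
    and "a \<in> carrier A \<Longrightarrow> s \<in> carrier S \<Longrightarrow> y (a \<odot>\<^bsub>S\<^esub> s) = a \<odot>\<^bsub>R\<^esub> y s"
  using assms by (auto simp: alg_homs_def ring_hom_def)

lemma alg_homsI:
  assumes "\<And>s. s \<in> carrier S \<Longrightarrow> y s \<in> carrier R"
    and "\<And>s s'. s \<in> carrier S \<Longrightarrow> s' \<in> carrier S \<Longrightarrow> y (s \<otimes>\<^bsub>S\<^esub> s') = y s \<otimes>\<^bsub>R\<^esub> y s'"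
    and "\<And>s s'. s \<in> carrier S \<Longrightarrow> s' \<in> carrier S \<Longrightarrow> y (s \<oplus>\<^bsub>S\<^esub> s') = y s \<oplus>\<^bsub>R\<^esub> y s'"
    and "y \<one>\<^bsub>S\<^esub> = \<one>\<^bsub>R\<^esub>"
    and "\<And>a s. a \<in> carrier A \<Longrightarrow> s \<in> carrier S \<Longrightarrow> y (a \<odot>\<^bsub>S\<^esub> s) = a \<odot>\<^bsub>R\<^esub> y s"
    and "y \<in> extensional (carrier S)"
  shows "y \<in> alg_homs A S R"
  using assms by (auto simp: alg_homs_def ring_hom_def)

lemma alg_homs_linear: "y \<in> alg_homs A S R \<Longrightarrow> y \<in> linear_maps A S R"
  by (auto simp: linear_maps_def hom_def alg_homsD)

lemma alg_homs_compose:
  assumes "algebra A S" "y \<in> alg_homs A S R" "z \<in> alg_homs A R Q"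
  shows "compose (carrier S) z y \<in> alg_homs A S Q"
proof -
  interpret S: algebra A S by fact
  show ?thesis
    by (rule alg_homsI) (simp_all add: compose_def alg_homsD[OF assms(2)] alg_homsD[OF assms(3)])
qed

context tensor_algebra_pair
begin

text \<open>This map and the next are the comorphisms of the two projections of the fibre
  product.\<close>

lemma inclusion_left: "(\<lambda>s\<in>carrier S. T.pure s \<one>\<^bsub>U\<^esub>) \<in> alg_homs A S T"
  by (rule alg_homsI)
    (simp_all add: mult_pure one_T T.pure_add_left tensor_algebra_smult_pure[OF S.module U.module]
      del: tensor_algebra_simps)

lemma inclusion_right: "(\<lambda>u\<in>carrier U. T.pure \<one>\<^bsub>S\<^esub> u) \<in> alg_homs A U T"
  by (rule alg_homsI)
    (simp_all add: mult_pure one_T T.pure_add_right T.pure_smult[symmetric]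
      tensor_algebra_smult_pure[OF S.module U.module] del: tensor_algebra_simps)

text \<open>On pure tensors multiplicativity amounts to interchanging \<open>x u\<close> with
  \<open>y s'\<close>, which is possible because \<open>R\<close> is commutative.\<close>

lemma
  assumes R: "algebra A R" and y: "y \<in> alg_homs A S R" and x: "x \<in> alg_homs A U R"
  shows point_pair_pure: "s \<in> carrier S \<Longrightarrow> u \<in> carrier U \<Longrightarrow>
      point_pair A S U R y x (T.pure s u) = y s \<otimes>\<^bsub>R\<^esub> x u"
    and point_pair_alg_homs: "point_pair A S U R y x \<in> alg_homs A T R"
proof -
  interpret R: algebra A R by fact
  interpret TA: algebra A T by (rule algebra_T)
  note [simp del] = tensor_algebra_simps
  have bal: "balanced A S U R (\<lambda>s t. y s \<otimes>\<^bsub>R\<^esub> x t)"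
    by (rule balancedI) (simp_all add: alg_homsD[OF y] alg_homsD[OF x] R.l_distr R.r_distr
      R.smult_assoc2, metis R.m_comm R.smult_assoc2 R.smult_closed alg_homsD(1)[OF y] alg_homsD(1)[OF x])
  let ?p = "point_pair A S U R y x"
  have G: "carrier (add_monoid R) = carrier R" "monoid.mult (add_monoid R) = add R" by simp_all
  note lift = T.tensor_lift_properties[OF R.abelian_group_axioms bal G, folded point_pair_def]
  show pure: "s \<in> carrier S \<Longrightarrow> u \<in> carrier U \<Longrightarrow> ?p (T.pure s u) = y s \<otimes>\<^bsub>R\<^esub> x u" for s u
    by (rule lift)
  have closed: "?p t \<in> carrier R" if "t \<in> carrier T" for t
    using that lift(1) by (auto simp: hom_def)
  have p_add: "?p (t \<oplus>\<^bsub>T\<^esub> t') = ?p t \<oplus>\<^bsub>R\<^esub> ?p t'" if "t \<in> carrier T" "t' \<in> carrier T" for t t'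
    using that lift(1) by (auto simp: hom_def)
  show "?p \<in> alg_homs A T R"
  proof (rule alg_homsI)
    fix t t' assume "t \<in> carrier T" "t' \<in> carrier T"
    then show "?p (t \<otimes>\<^bsub>T\<^esub> t') = ?p t \<otimes>\<^bsub>R\<^esub> ?p t'"
    proof (induct t rule: T.T_induct)
      case (pure s u)
      note su = pure(1,2)
      from \<open>t' \<in> carrier T\<close> show ?case
      proof (induct t' rule: T.T_induct)
        case (pure s' u')
        then show ?case using su
          by (simp add: mult_pure lift(3) alg_homsD[OF y] alg_homsD[OF x] R.m_ac)
      next
        case (add t t')
        then show ?case using su
          by (simp add: TA.r_distr TA.m_closed p_add closed R.r_distr)
      qed
    next
      case (add t s)
      then show ?case
        by (simp add: TA.l_distr TA.m_closed p_add closed R.l_distr)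
    qed
  next
    fix a t assume a: "a \<in> carrier A" and "t \<in> carrier T"
    from this(2) show "?p (a \<odot>\<^bsub>T\<^esub> t) = a \<odot>\<^bsub>R\<^esub> ?p t"
    proof (induct t rule: T.T_induct)
      case (pure s u)
      then show ?case using a
        by (simp add: tensor_algebra_smult_pure[OF S.module U.module] lift(3) alg_homsD[OF y]
            alg_homsD[OF x] R.smult_assoc2)
    next
      case (add t s)
      then show ?case using a by (simp add: TA.smult_r_distr p_add closed R.smult_r_distr)
    qed
  qed (simp_all add: closed p_add lift one_T alg_homsD[OF y] alg_homsD[OF x])
qed

end

section \<open>Flatness over a valuation ring\<close>

definition torsion_free :: "('a, 's) ring_scheme \<Rightarrow> ('a, 'm, 't) module_scheme \<Rightarrow> bool" where
  "torsion_free A N \<longleftrightarrow> (\<forall>a\<in>carrier A. \<forall>n\<in>carrier N.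
     a \<odot>\<^bsub>N\<^esub> n = \<zero>\<^bsub>N\<^esub> \<longrightarrow> a = \<zero>\<^bsub>A\<^esub> \<or> n = \<zero>\<^bsub>N\<^esub>)"

text \<open>Total divisibility is the form in which the valuation enters: among finitely many
  coefficients of a relation one divides all the others, so the relation can be divided by
  it.\<close>

locale valuation_domain = A: domain A for A :: "('a, 's) ring_scheme" +
  assumes divides_total: "a \<in> carrier A \<Longrightarrow> b \<in> carrier A \<Longrightarrow>
    (\<exists>c\<in>carrier A. b = a \<otimes>\<^bsub>A\<^esub> c) \<or> (\<exists>c\<in>carrier A. a = b \<otimes>\<^bsub>A\<^esub> c)"
begin

text \<open>A new element is compared with the common divisor found so far; whichever of the two
  divides the other divides everything.\<close>

lemma divides_all:
  assumes "finite J" "J \<noteq> {}" "c \<in> J \<rightarrow> carrier A"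
  shows "\<exists>j\<in>J. \<forall>i\<in>J. \<exists>d\<in>carrier A. c i = c j \<otimes>\<^bsub>A\<^esub> d"
  using assms
proof (induct rule: finite_ne_induct)
  case (singleton x)
  then show ?case by (auto intro!: bexI[of _ "\<one>\<^bsub>A\<^esub>"])
next
  case (insert x J)
  then obtain j where j: "j \<in> J" "\<And>i. i \<in> J \<Longrightarrow> \<exists>d\<in>carrier A. c i = c j \<otimes>\<^bsub>A\<^esub> d"
    by auto
  have cx: "c x \<in> carrier A" and cj: "c j \<in> carrier A"
    using insert.prems j(1) by auto
  from divides_total[OF cx cj] show ?case
  proof
    assume "\<exists>d\<in>carrier A. c j = c x \<otimes>\<^bsub>A\<^esub> d"
    then obtain d where d: "d \<in> carrier A" "c j = c x \<otimes>\<^bsub>A\<^esub> d" by auto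
    show ?thesis
    proof (intro bexI[of _ x] ballI)
      fix i assume "i \<in> insert x J"
      then show "\<exists>d\<in>carrier A. c i = c x \<otimes>\<^bsub>A\<^esub> d"
      proof
        assume "i = x"
        then show ?thesis using cx by (auto intro!: bexI[of _ "\<one>\<^bsub>A\<^esub>"])
      next
        assume "i \<in> J"
        then obtain e where "e \<in> carrier A" "c i = c j \<otimes>\<^bsub>A\<^esub> e" using j(2) by auto
        then show ?thesis using d cx by (auto simp: A.m_assoc intro!: bexI[of _ "d \<otimes>\<^bsub>A\<^esub> e"])
      qed
    qed simp
  next
    assume "\<exists>d\<in>carrier A. c x = c j \<otimes>\<^bsub>A\<^esub> d"
    then show ?thesis using j by (auto intro!: bexI[of _ j])
  qed
qed

end

section \<open>Spans and independence in torsion-free modules\<close>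

context module
begin

definition lin_comb :: "('c \<Rightarrow> 'a) \<Rightarrow> 'c set \<Rightarrow> 'c" where
  "lin_comb c Z = (\<Oplus>\<^bsub>M\<^esub>z\<in>Z. c z \<odot>\<^bsub>M\<^esub> z)"

definition span_of :: "'c set \<Rightarrow> 'c set" where
  "span_of Z = {lin_comb c Z | c. c \<in> Z \<rightarrow> carrier R}"

lemma lin_comb_closed:
  "Z \<subseteq> carrier M \<Longrightarrow> c \<in> Z \<rightarrow> carrier R \<Longrightarrow> lin_comb c Z \<in> carrier M"
  unfolding lin_comb_def by (rule finsum_closed) auto

lemma lin_comb_add:
  "Z \<subseteq> carrier M \<Longrightarrow> c \<in> Z \<rightarrow> carrier R \<Longrightarrow> d \<in> Z \<rightarrow> carrier R \<Longrightarrow>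
   lin_comb (\<lambda>z. c z \<oplus> d z) Z = lin_comb c Z \<oplus>\<^bsub>M\<^esub> lin_comb d Z"
proof -
  assume *: "Z \<subseteq> carrier M" "c \<in> Z \<rightarrow> carrier R" "d \<in> Z \<rightarrow> carrier R"
  then have "lin_comb (\<lambda>z. c z \<oplus> d z) Z = (\<Oplus>\<^bsub>M\<^esub>z\<in>Z. c z \<odot>\<^bsub>M\<^esub> z \<oplus>\<^bsub>M\<^esub> d z \<odot>\<^bsub>M\<^esub> z)"
    unfolding lin_comb_def by (intro finsum_cong') (auto simp: Pi_iff subset_iff smult_l_distr)
  then show ?thesis
    using * by (simp add: lin_comb_def finsum_addf Pi_iff subset_iff)
qed

lemma lin_comb_smult:
  "finite Z \<Longrightarrow> Z \<subseteq> carrier M \<Longrightarrow> c \<in> Z \<rightarrow> carrier R \<Longrightarrow> a \<in> carrier R \<Longrightarrow>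
   lin_comb (\<lambda>z. a \<otimes> c z) Z = a \<odot>\<^bsub>M\<^esub> lin_comb c Z"
  unfolding lin_comb_def
  by (subst finsum_smult_ldistr) (auto intro!: finsum_cong' smult_assoc1)

lemma lin_comb_remove:
  assumes "finite Z" "Z \<subseteq> carrier M" "c \<in> Z \<rightarrow> carrier R" "j \<in> Z"
  shows "lin_comb c Z = c j \<odot>\<^bsub>M\<^esub> j \<oplus>\<^bsub>M\<^esub> lin_comb c (Z - {j})"
proof -
  have "lin_comb c (insert j (Z - {j})) = c j \<odot>\<^bsub>M\<^esub> j \<oplus>\<^bsub>M\<^esub> lin_comb c (Z - {j})"
    unfolding lin_comb_def using assms by (subst finsum_insert) auto
  then show ?thesis using assms(4) by (simp add: insert_absorb)
qed

lemma lin_comb_zero: "Z \<subseteq> carrier M \<Longrightarrow> lin_comb (\<lambda>z. \<zero>) Z = \<zero>\<^bsub>M\<^esub>"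
  unfolding lin_comb_def by (rule add.finprod_one_eqI) auto

lemma span_of_superset:
  assumes "finite Z" "Z \<subseteq> carrier M"
  shows "Z \<subseteq> span_of Z"
proof
  fix z assume z: "z \<in> Z"
  let ?c = "\<lambda>x. if x = z then \<one> else \<zero>"
  have "lin_comb ?c Z = \<one> \<odot>\<^bsub>M\<^esub> z \<oplus>\<^bsub>M\<^esub> lin_comb ?c (Z - {z})"
    using assms z by (subst lin_comb_remove[OF assms _ z]) auto
  also have "lin_comb ?c (Z - {z}) = lin_comb (\<lambda>z. \<zero>) (Z - {z})"
    unfolding lin_comb_def using assms by (intro finsum_cong') auto
  finally have "lin_comb ?c Z = z"
    using assms z lin_comb_zero[of "Z - {z}"] by (auto simp: subset_iff)
  moreover have "?c \<in> Z \<rightarrow> carrier R" by auto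
  ultimately show "z \<in> span_of Z"
    unfolding span_of_def by (auto intro!: exI[of _ ?c])
qed

lemma submodule_span_of:
  assumes "finite Z" "Z \<subseteq> carrier M"
  shows "submodule (span_of Z) R M"
proof (rule submoduleI)
  show "span_of Z \<subseteq> carrier M"
    using lin_comb_closed[OF assms(2)] by (auto simp: span_of_def)
  show "\<zero>\<^bsub>M\<^esub> \<in> span_of Z"
    unfolding span_of_def using lin_comb_zero[OF assms(2)] by (auto intro!: exI[of _ "\<lambda>z. \<zero>"])
  show "a \<odot>\<^bsub>M\<^esub> x \<in> span_of Z" if a: "a \<in> carrier R" and x: "x \<in> span_of Z" for a x
  proof -
    obtain c where c: "c \<in> Z \<rightarrow> carrier R" "x = lin_comb c Z"
      using x by (auto simp: span_of_def)
    have "a \<odot>\<^bsub>M\<^esub> x = lin_comb (\<lambda>z. a \<otimes> c z) Z"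
      unfolding c(2) by (rule lin_comb_smult[OF assms c(1) a, symmetric])
    then show ?thesis using a c(1) by (auto simp: span_of_def)
  qed
  then show "\<ominus>\<^bsub>M\<^esub> x \<in> span_of Z" if "x \<in> span_of Z" for x
    using that \<open>span_of Z \<subseteq> carrier M\<close> smult_l_minus[of \<one> x] R.a_inv_closed[OF R.one_closed]
    by (metis R.one_closed smult_one subsetD)
  show "a \<oplus>\<^bsub>M\<^esub> b \<in> span_of Z" if ab: "a \<in> span_of Z" "b \<in> span_of Z" for a b
  proof -
    obtain c d where cd: "c \<in> Z \<rightarrow> carrier R" "a = lin_comb c Z" "d \<in> Z \<rightarrow> carrier R" "b = lin_comb d Z"
      using ab by (auto simp: span_of_def)
    then have "a \<oplus>\<^bsub>M\<^esub> b = lin_comb (\<lambda>z. c z \<oplus> d z) Z"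
      by (simp add: lin_comb_add[OF assms(2)])
    then show ?thesis using cd by (auto simp: span_of_def)
  qed
qed

lemma independent_generators:
  assumes vd: "valuation_domain R" and tf: "torsion_free R M"
    and S: "finite S" "S \<subseteq> carrier M"
  obtains Z where "finite Z" "Z \<subseteq> carrier M" "S \<subseteq> span_of Z"
    "\<And>c. c \<in> Z \<rightarrow> carrier R \<Longrightarrow> lin_comb c Z = \<zero>\<^bsub>M\<^esub> \<Longrightarrow> \<forall>z\<in>Z. c z = \<zero>"
proof -
  interpret vd: valuation_domain R by fact
  let ?P = "\<lambda>Z. finite Z \<and> Z \<subseteq> carrier M \<and> S \<subseteq> span_of Z"
  obtain Z where Z: "?P Z" and min: "\<And>Z'. ?P Z' \<Longrightarrow> card Z \<le> card Z'"
    using ex_has_least_nat[of ?P S card] S span_of_superset[OF S] by auto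
  have "\<forall>z\<in>Z. c z = \<zero>" if c: "c \<in> Z \<rightarrow> carrier R" and c0: "lin_comb c Z = \<zero>\<^bsub>M\<^esub>" for c
  proof (rule ccontr)
    assume "\<not> (\<forall>z\<in>Z. c z = \<zero>)"
    define J where "J = {z \<in> Z. c z \<noteq> \<zero>}"
    have "\<exists>j\<in>J. \<forall>i\<in>J. \<exists>d\<in>carrier R. c i = c j \<otimes> d"
      by (rule vd.divides_all) (use Z c \<open>\<not> (\<forall>z\<in>Z. c z = \<zero>)\<close> in \<open>auto simp: J_def\<close>)
    then obtain j where j: "j \<in> J" and div: "\<forall>i\<in>J. \<exists>d\<in>carrier R. c i = c j \<otimes> d" by auto
    have jZ: "j \<in> Z" and cj: "c j \<in> carrier R" "c j \<noteq> \<zero>" and jM: "j \<in> carrier M"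
      using j c Z by (auto simp: J_def)
    \<comment> \<open>Indices outside \<open>J\<close> have coefficient zero, which is a multiple of
      \<open>c j\<close> as well.\<close>
    have "\<forall>i\<in>Z. \<exists>d\<in>carrier R. c i = c j \<otimes> d"
    proof
      fix i assume "i \<in> Z"
      then show "\<exists>d\<in>carrier R. c i = c j \<otimes> d"
        using div cj by (cases "c i = \<zero>") (auto simp: J_def intro!: bexI[of _ \<zero>])
    qed
    then obtain d where d: "d \<in> Z \<rightarrow> carrier R" "\<And>i. i \<in> Z \<Longrightarrow> c i = c j \<otimes> d i"
      by (metis Pi_I)
    have dj: "d j = \<one>"
      using d(2)[OF jZ] cj d(1) jZ vd.A.m_lcancel[of "c j" "d j" \<one>] by auto
    have "c j \<odot>\<^bsub>M\<^esub> lin_comb d Z = lin_comb (\<lambda>z. c j \<otimes> d z) Z"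
      using lin_comb_smult[of Z d "c j"] Z d cj by simp
    also have "\<dots> = lin_comb c Z"
      unfolding lin_comb_def using Z d c by (intro finsum_cong') (auto simp: Pi_iff subset_iff)
    finally have "c j \<odot>\<^bsub>M\<^esub> lin_comb d Z = lin_comb c Z" .
    then have "lin_comb d Z = \<zero>\<^bsub>M\<^esub>"
      using tf cj c0 lin_comb_closed[of Z d] Z d(1) unfolding torsion_free_def by auto
    moreover define W where "W = Z - {j}"
    moreover have W: "finite W" "W \<subseteq> carrier M" "d \<in> W \<rightarrow> carrier R"
      using Z d(1) by (auto simp: W_def)
    ultimately have "j \<oplus>\<^bsub>M\<^esub> lin_comb d W = \<zero>\<^bsub>M\<^esub>"
      using lin_comb_remove[of Z d j] Z d(1) jZ dj jM by auto
    then have j_eq: "j = \<ominus>\<^bsub>M\<^esub> lin_comb d W"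
      using jM lin_comb_closed[OF W(2,3)] by (simp add: M.minus_equality)
    have sub: "submodule (span_of W) R M" by (rule submodule_span_of[OF W(1,2)])
    have j_span: "j \<in> span_of W"
      unfolding j_eq by (rule submoduleE(3)[OF sub]) (use W(3) in \<open>auto simp: span_of_def\<close>)
    have "span_of Z \<subseteq> span_of W"
    proof
      fix x assume "x \<in> span_of Z"
      then obtain e where e: "e \<in> Z \<rightarrow> carrier R" "x = lin_comb e Z" by (auto simp: span_of_def)
      have "x = e j \<odot>\<^bsub>M\<^esub> j \<oplus>\<^bsub>M\<^esub> lin_comb e W"
        unfolding e(2) W_def using Z e(1) jZ by (intro lin_comb_remove) auto
      moreover have "lin_comb e W \<in> span_of W"
        using e(1) by (auto simp: span_of_def W_def)
      ultimately show "x \<in> span_of W"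
        using submoduleE(4,5)[OF sub] j_span e(1) jZ by (simp add: Pi_iff)
    qed
    then have "?P W" using Z W by auto
    then have "card Z \<le> card W" by (rule min)
    moreover have "card W < card Z"
      unfolding W_def using Z jZ by (intro card_Diff1_less) auto
    ultimately show False by simp
  qed
  with Z show thesis by (intro that) auto
qed

end

section \<open>Tensoring an injective map with a torsion-free module\<close>

lemma (in tensor_product) pure_finsum:
  assumes "finite Z" "x \<in> carrier M" "f \<in> Z \<rightarrow> carrier N"
  shows "pure x (\<Oplus>\<^bsub>N\<^esub>z\<in>Z. f z) = (\<Oplus>\<^bsub>T\<^esub>z\<in>Z. pure x (f z))"
  using assms
  by (induct set: finite) (simp_all add: pure_add_right Pi_iff)

text \<open>If \<open>N\<close> has finitely many coordinate functions \<open>\<psi> z\<close>, an element \<open>t\<close> of \<open>M \<otimes> N\<close> is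
  recovered from its contractions in \<open>M\<close>; and contractions commute with maps of \<open>M\<close>.\<close>

lemma inj_tensor_map_coordinates:
  fixes M :: "('a, 'm) module" and M' :: "('a, 'm2) module" and N :: "('a, 'n) module"
  assumes M: "module A M" and M': "module A M'" and N: "module A N"
    and g: "g \<in> linear_maps A M M'" "inj_on g (carrier M)"
    and Z: "finite Z" "Z \<subseteq> carrier N"
    and \<psi>_closed: "\<And>z n. z \<in> Z \<Longrightarrow> n \<in> carrier N \<Longrightarrow> \<psi> z n \<in> carrier A"
    and \<psi>_add: "\<And>z n n'. z \<in> Z \<Longrightarrow> n \<in> carrier N \<Longrightarrow> n' \<in> carrier N \<Longrightarrow>
      \<psi> z (n \<oplus>\<^bsub>N\<^esub> n') = \<psi> z n \<oplus>\<^bsub>A\<^esub> \<psi> z n'"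
    and \<psi>_smult: "\<And>z a n. z \<in> Z \<Longrightarrow> a \<in> carrier A \<Longrightarrow> n \<in> carrier N \<Longrightarrow>
      \<psi> z (a \<odot>\<^bsub>N\<^esub> n) = a \<otimes>\<^bsub>A\<^esub> \<psi> z n"
    and \<psi>: "\<And>n. n \<in> carrier N \<Longrightarrow> n = (\<Oplus>\<^bsub>N\<^esub>z\<in>Z. \<psi> z n \<odot>\<^bsub>N\<^esub> z)"
    and t: "t \<in> carrier (tensor_algebra A M N)"
    and t0: "tensor_map A M N M' N g (\<lambda>y. y) t = \<zero>\<^bsub>tensor_algebra A M' N\<^esub>"
  shows "t = \<zero>\<^bsub>tensor_algebra A M N\<^esub>"
proof -
  let ?T = "tensor_algebra A M N" and ?T' = "tensor_algebra A M' N"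
  interpret M: module A M by fact
  interpret M': module A M' by fact
  interpret N: module A N by fact
  interpret T: tensor_product A M N ?T by (rule tensor_product_tensor_algebra[OF M N])
  interpret T': tensor_product A M' N ?T' by (rule tensor_product_tensor_algebra[OF M' N])
  note [simp del] = tensor_algebra_simps
  define P where "P z = tensor_lift A M N (add_monoid M) (\<lambda>x n. \<psi> z n \<odot>\<^bsub>M\<^esub> x)" for z
  define P' where "P' z = tensor_lift A M' N (add_monoid M') (\<lambda>x n. \<psi> z n \<odot>\<^bsub>M'\<^esub> x)" for z
  have bal: "balanced A M N M (\<lambda>x n. \<psi> z n \<odot>\<^bsub>M\<^esub> x)" if "z \<in> Z" for z
    by (rule balancedI)
      (use that in \<open>simp_all add: \<psi>_closed \<psi>_add \<psi>_smult M.smult_l_distr M.smult_r_distr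
         M.smult_assoc1[symmetric] M.R.m_comm\<close>)
  have bal': "balanced A M' N M' (\<lambda>x n. \<psi> z n \<odot>\<^bsub>M'\<^esub> x)" if "z \<in> Z" for z
    by (rule balancedI)
      (use that in \<open>simp_all add: \<psi>_closed \<psi>_add \<psi>_smult M'.smult_l_distr M'.smult_r_distr
         M'.smult_assoc1[symmetric] M.R.m_comm\<close>)
  have G: "carrier (add_monoid M) = carrier M" "monoid.mult (add_monoid M) = add M"
    and G': "carrier (add_monoid M') = carrier M'" "monoid.mult (add_monoid M') = add M'" by simp_all
  note P = T.tensor_lift_properties[OF M.M.abelian_group_axioms bal G, folded P_def]
  note P' = T'.tensor_lift_properties[OF M'.M.abelian_group_axioms bal' G', folded P'_def]
  have P_closed: "P z s \<in> carrier M" if "z \<in> Z" "s \<in> carrier ?T" for z s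
    using P(1)[OF that(1)] that(2) by (auto simp: hom_def)
  have P_add: "P z (s \<oplus>\<^bsub>?T\<^esub> s') = P z s \<oplus>\<^bsub>M\<^esub> P z s'"
    if "z \<in> Z" "s \<in> carrier ?T" "s' \<in> carrier ?T" for z s s'
    using P(1)[OF that(1)] that(2,3) by (auto simp: hom_def)
  have P'_add: "P' z (s \<oplus>\<^bsub>?T'\<^esub> s') = P' z s \<oplus>\<^bsub>M'\<^esub> P' z s'"
    if "z \<in> Z" "s \<in> carrier ?T'" "s' \<in> carrier ?T'" for z s s'
    using P'(1)[OF that(1)] that(2,3) by (auto simp: hom_def)
  have P'_zero: "P' z \<zero>\<^bsub>?T'\<^esub> = \<zero>\<^bsub>M'\<^esub>" if "z \<in> Z" for z
    using additive_zero[OF P'(1)[OF that]] T'.abelian_group_T M'.M.abelian_group_axioms by simp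
  let ?G = "tensor_map A M N M' N g (\<lambda>y. y)"
  note map = tensor_map_pure[OF T.tensor_product_axioms T'.tensor_product_axioms g(1) id_linear_map]
    tensor_map_closed[OF T.tensor_product_axioms T'.tensor_product_axioms g(1) id_linear_map]
    tensor_map_add[OF T.tensor_product_axioms T'.tensor_product_axioms g(1) id_linear_map]
  have contraction: "g (P z s) = P' z (?G s)" if z: "z \<in> Z" and s: "s \<in> carrier ?T" for z s
    using s
  proof (induct rule: T.T_induct)
    case (pure x n)
    then show ?case
      using z by (simp add: P(3) P'(3) map linear_mapsD[OF g(1)] \<psi>_closed)
  next
    case (add s s')
    then show ?case
      using z by (simp add: P_add P_closed P'_add map linear_mapsD[OF g(1)])
  qed
  \<comment> \<open>For a pure tensor this is the expansion of its second factor in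
    \<open>Z\<close>, with the coefficients moved to the first factor.\<close>
  have recover: "s = (\<Oplus>\<^bsub>?T\<^esub>z\<in>Z. T.pure (P z s) z)" if s: "s \<in> carrier ?T" for s
    using s
  proof (induct rule: T.T_induct)
    case (pure x n)
    have "(\<Oplus>\<^bsub>?T\<^esub>z\<in>Z. T.pure (P z (T.pure x n)) z) = (\<Oplus>\<^bsub>?T\<^esub>z\<in>Z. T.pure x (\<psi> z n \<odot>\<^bsub>N\<^esub> z))"
      using pure Z by (intro T.T.finsum_cong') (auto simp: P(3) T.pure_smult \<psi>_closed subset_iff)
    also have "\<dots> = T.pure x (\<Oplus>\<^bsub>N\<^esub>z\<in>Z. \<psi> z n \<odot>\<^bsub>N\<^esub> z)"
      using pure Z by (intro T.pure_finsum[symmetric]) (auto simp: \<psi>_closed subset_iff)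
    finally show ?case using \<psi>[OF pure(2)] by simp
  next
    case (add s s')
    have "(\<Oplus>\<^bsub>?T\<^esub>z\<in>Z. T.pure (P z (s \<oplus>\<^bsub>?T\<^esub> s')) z) =
        (\<Oplus>\<^bsub>?T\<^esub>z\<in>Z. T.pure (P z s) z \<oplus>\<^bsub>?T\<^esub> T.pure (P z s') z)"
      using add(1,2) Z by (intro T.T.finsum_cong') (auto simp: P_add P_closed T.pure_add_left subset_iff)
    also have "\<dots> = s \<oplus>\<^bsub>?T\<^esub> s'"
      using add Z by (subst T.T.finsum_addf) (auto simp: P_closed subset_iff)
    finally show ?case by simp
  qed
  have "P z t = \<zero>\<^bsub>M\<^esub>" if "z \<in> Z" for z
  proof -
    have "g (P z t) = g \<zero>\<^bsub>M\<^esub>"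
      using contraction[OF that t] t0 P'_zero[OF that] linear_mapsD(2)[OF g(1), of "\<zero>\<^bsub>M\<^esub>" "\<zero>\<^bsub>M\<^esub>"]
        linear_mapsD(1)[OF g(1), of "\<zero>\<^bsub>M\<^esub>"] by simp
    then show ?thesis
      using g(2) P_closed[OF that t] by (simp add: inj_on_def)
  qed
  then have "(\<Oplus>\<^bsub>?T\<^esub>z\<in>Z. T.pure (P z t) z) = \<zero>\<^bsub>?T\<^esub>"
    using Z by (intro T.T.add.finprod_one_eqI) auto
  then show ?thesis using recover[OF t] by simp
qed

text \<open>On representatives the map substitutes generators. This translates the vanishing of an
  image into membership in \<open>tensor_null\<close>, where the finiteness of the relations can be
  exploited.\<close>

lemma tensor_map_coset:
  assumes T: "tensor_product A M N T" and T2: "tensor_product A M2 N2 T2"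
    and f: "f \<in> linear_maps A M M2" and g: "g \<in> linear_maps A N N2"
    and z: "z \<in> carrier (free_Abelian_group (carrier M \<times> carrier N))"
  shows "tensor_map A M N M2 N2 f g (tensor_null A M N #>\<^bsub>free_Abelian_group (carrier M \<times> carrier N)\<^esub> z) =
    tensor_null A M2 N2 #>\<^bsub>free_Abelian_group (carrier M2 \<times> carrier N2)\<^esub>
      frag_extend (\<lambda>(x, y). frag_of (f x, g y)) z"
proof -
  interpret T: tensor_product A M N T by (fact T)
  interpret T2: tensor_product A M2 N2 T2 by (fact T2)
  let ?e = "frag_extend (\<lambda>(x, y). frag_of (f x, g y))"
  let ?c = "\<lambda>z. T.null #>\<^bsub>T.free\<^esub> z" and ?c2 = "\<lambda>z. T2.null #>\<^bsub>T2.free\<^esub> z"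
  let ?F = "tensor_map A M N M2 N2 f g"
  note F = tensor_map_pure[OF T T2 f g] tensor_map_closed[OF T T2 f g] tensor_map_add[OF T T2 f g]
  have closed: "?c a \<in> carrier T" if "a \<in> carrier T.free" for a
    using that unfolding T.carrier_T_cosets by (rule imageI)
  have closed2: "?c2 a \<in> carrier T2" if "a \<in> carrier T2.free" for a
    using that unfolding T2.carrier_T_cosets by (rule imageI)
  have "z \<in> carrier T.free \<and> ?e z \<in> carrier T2.free \<and> ?F (?c z) = ?c2 (?e z)"
  proof (rule frag_induction[where S="carrier M \<times> carrier N" and
        P="\<lambda>z. z \<in> carrier T.free \<and> ?e z \<in> carrier T2.free \<and> ?F (?c z) = ?c2 (?e z)"])
    show "Poly_Mapping.keys z \<subseteq> carrier M \<times> carrier N" using z by simp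
  next
    have "?c 0 = \<zero>\<^bsub>T\<^esub>" "?c2 0 = \<zero>\<^bsub>T2\<^esub>"
      using T.coset_add[of 0 0] closed[of 0] T2.coset_add[of 0 0] closed2[of 0] by simp_all
    then show "0 \<in> carrier T.free \<and> ?e 0 \<in> carrier T2.free \<and> ?F (?c 0) = ?c2 (?e 0)"
      using additive_zero[OF tensor_map_hom[OF T T2 f g] T.abelian_group_T T2.abelian_group_T]
      by simp
  next
    fix x assume "x \<in> carrier M \<times> carrier N"
    then show "frag_of x \<in> carrier T.free \<and> ?e (frag_of x) \<in> carrier T2.free \<and>
        ?F (?c (frag_of x)) = ?c2 (?e (frag_of x))"
      using F(1) by (auto simp: linear_mapsD[OF f] linear_mapsD[OF g] simp flip: pure_tensor_def)
  next
    fix a b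
    assume a: "a \<in> carrier T.free \<and> ?e a \<in> carrier T2.free \<and> ?F (?c a) = ?c2 (?e a)"
      and b: "b \<in> carrier T.free \<and> ?e b \<in> carrier T2.free \<and> ?F (?c b) = ?c2 (?e b)"
    have ab: "a - b \<in> carrier T.free" "?e (a - b) \<in> carrier T2.free"
      using a b keys_diff[of a b] keys_diff[of "?e a" "?e b"] by (auto simp: frag_extend_diff)
    have "?F (?c (a - b)) \<oplus>\<^bsub>T2\<^esub> ?c2 (?e b) = ?F (?c (a - b) \<oplus>\<^bsub>T\<^esub> ?c b)"
      using F(3)[OF closed[OF ab(1)] closed[of b]] b by simp
    also have "\<dots> = ?c2 (?e (a - b)) \<oplus>\<^bsub>T2\<^esub> ?c2 (?e b)"
      using T.coset_add[OF ab(1), of b] T2.coset_add[OF ab(2), of "?e b"] a b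
      by (simp add: frag_extend_diff)
    finally have "?F (?c (a - b)) = ?c2 (?e (a - b))"
      using closed2[OF ab(2)] closed2[of "?e b"] F(2)[OF closed[OF ab(1)]] b by simp
    then show "a - b \<in> carrier T.free \<and> ?e (a - b) \<in> carrier T2.free \<and> ?F (?c (a - b)) = ?c2 (?e (a - b))"
      using ab by simp
  qed
  then show ?thesis by simp
qed

text \<open>A tensor vanishes because of finitely many relations, which involve only finitely many
  elements of \<open>N\<close>.\<close>

lemma tensor_null_finite_support:
  assumes "tensor_product A M N T" and "z \<in> tensor_null A M N"
  shows "\<exists>S. finite S \<and> S \<subseteq> carrier N \<and>
    (\<forall>N'. S \<subseteq> N' \<and> submodule N' A N \<longrightarrow> z \<in> tensor_null A M (N\<lparr>carrier := N'\<rparr>))"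
proof -
  interpret T: tensor_product A M N T by fact
  have sub: "tensor_product A M (N\<lparr>carrier := N'\<rparr>) (tensor_algebra A M (N\<lparr>carrier := N'\<rparr>))"
    if "submodule N' A N" for N'
    using submodule.submodule_is_module[OF that T.N.module_axioms]
    by (intro tensor_product_tensor_algebra) (simp_all add: T.M.module_axioms)
  have rel: "\<exists>S. finite S \<and> S \<subseteq> carrier N \<and>
     (\<forall>N'. S \<subseteq> N' \<and> submodule N' A N \<longrightarrow> h \<in> tensor_relations A M (N\<lparr>carrier := N'\<rparr>))"
    if "h \<in> tensor_relations A M N" for h
    using that[unfolded tensor_relations_def]
  proof (elim UnE CollectE exE conjE)
    fix x x' y
    assume "h = frag_of (x \<oplus>\<^bsub>M\<^esub> x', y) - frag_of (x, y) - frag_of (x', y)"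
      "x \<in> carrier M" "x' \<in> carrier M" "y \<in> carrier N"
    then show ?thesis
      by (intro exI[of _ "{y}"]) (force simp: tensor_relations_def)
  next
    fix x y y'
    assume "h = frag_of (x, y \<oplus>\<^bsub>N\<^esub> y') - frag_of (x, y) - frag_of (x, y')"
      "x \<in> carrier M" "y \<in> carrier N" "y' \<in> carrier N"
    then show ?thesis
      by (intro exI[of _ "{y, y'}"]) (force simp: tensor_relations_def)
  next
    fix a x y
    assume "h = frag_of (a \<odot>\<^bsub>M\<^esub> x, y) - frag_of (x, a \<odot>\<^bsub>N\<^esub> y)"
      "a \<in> carrier A" "x \<in> carrier M" "y \<in> carrier N"
    then show ?thesis
      by (intro exI[of _ "{y}"]) (force simp: tensor_relations_def)
  qed
  show ?thesis
    using assms(2) unfolding tensor_null_def[of A M N]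
  proof (induct z rule: generate.induct)
    case one
    then show ?case
      using subgroup.one_closed[OF tensor_product.null_subgroup[OF sub]]
      by (intro exI[of _ "{}"]) auto
  next
    case (incl h)
    then show ?case
      using rel[OF incl] unfolding tensor_null_def by (meson generate.incl)
  next
    case (inv h)
    obtain S where S: "finite S" "S \<subseteq> carrier N" and S_rel: "\<And>N'. S \<subseteq> N' \<Longrightarrow> submodule N' A N \<Longrightarrow>
        h \<in> tensor_relations A M (N\<lparr>carrier := N'\<rparr>)"
      using rel[OF inv] by auto
    have "inv\<^bsub>T.free\<^esub> h \<in> tensor_null A M (N\<lparr>carrier := N'\<rparr>)"
      if N': "S \<subseteq> N'" "submodule N' A N" for N'
    proof -
      interpret N': tensor_product A M "N\<lparr>carrier := N'\<rparr>" "tensor_algebra A M (N\<lparr>carrier := N'\<rparr>)"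
        by (rule sub[OF N'(2)])
      have "inv\<^bsub>N'.free\<^esub> h \<in> N'.null"
        unfolding tensor_null_def by (rule generate.inv[OF S_rel[OF N']])
      \<comment> \<open>The inverse is negation in both free groups, so the two inverses of
        \<open>h\<close> agree once \<open>h\<close> is known to lie in both carriers.\<close>
      moreover have "h \<in> carrier T.free" "h \<in> carrier N'.free"
        using subsetD[OF T.relations_subset inv] subsetD[OF N'.relations_subset S_rel[OF N']] .
      ultimately show ?thesis by simp
    qed
    with S show ?case by auto
  next
    case (eng h1 h2)
    then obtain S1 S2 where "finite S1 \<and> S1 \<subseteq> carrier N \<and>
        (\<forall>N'. S1 \<subseteq> N' \<and> submodule N' A N \<longrightarrow> h1 \<in> tensor_null A M (N\<lparr>carrier := N'\<rparr>))"
      "finite S2 \<and> S2 \<subseteq> carrier N \<and>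
        (\<forall>N'. S2 \<subseteq> N' \<and> submodule N' A N \<longrightarrow> h2 \<in> tensor_null A M (N\<lparr>carrier := N'\<rparr>))"
      by auto
    then show ?case
      using subgroup.m_closed[OF tensor_product.null_subgroup[OF sub]]
      by (intro exI[of _ "S1 \<union> S2"]) auto
  qed
qed

lemma (in abelian_group) minus_eq_zeroD:
  "x \<ominus> y = \<zero> \<Longrightarrow> x \<in> carrier G \<Longrightarrow> y \<in> carrier G \<Longrightarrow> x = y"
  by (metis add.inv_closed minus_eq minus_equality minus_minus)

text \<open>Coordinates are needed in the submodule as a module of its own, whereas
  \<open>lin_comb\<close> sums in the ambient module; this reconciles the two.\<close>

lemma (in module) finsum_submodule:
  assumes H: "submodule H R M" and Z: "finite Z" "f \<in> Z \<rightarrow> H"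
  shows "finsum (M\<lparr>carrier := H\<rparr>) f Z = finsum M f Z"
proof -
  interpret H: module R "M\<lparr>carrier := H\<rparr>"
    by (rule submodule.submodule_is_module[OF H module_axioms])
  have "H \<subseteq> carrier M" by (rule submoduleE(1)[OF H])
  from Z show ?thesis
  proof (induct set: finite)
    case (insert z Z)
    then have "f z \<in> H" "f \<in> Z \<rightarrow> H" by auto
    moreover from this have "f z \<in> carrier M" "f \<in> Z \<rightarrow> carrier M"
      using \<open>H \<subseteq> carrier M\<close> by auto
    ultimately show ?case
      using insert H.M.finsum_insert[of Z z f] finsum_insert[of Z z f] by simp
  qed simp
qed

lemma (in tensor_product) coset_zero_iff:
  assumes "z \<in> carrier free"
  shows "null #>\<^bsub>free\<^esub> z = \<zero>\<^bsub>T\<^esub> \<longleftrightarrow> z \<in> null"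
proof -
  interpret free: group free by simp
  interpret null: subgroup null free by (rule null_subgroup)
  have "\<zero>\<^bsub>T\<^esub> = null" by (simp add: zero_T tensor_group_def)
  then show ?thesis
    using free.rcos_self[OF assms null_subgroup] null.rcos_const[OF free.is_group] by auto
qed

text \<open>Finitely many elements of a torsion-free module over a valuation ring lie in a free
  submodule, where coordinates are available.\<close>

lemma torsion_free_inj_tensor_map:
  fixes M :: "('a, 'm) module" and M' :: "('a, 'm2) module" and N :: "('a, 'n) module"
  assumes vd: "valuation_domain A"
    and M: "module A M" and M': "module A M'" and N: "module A N" and tf: "torsion_free A N"
    and g: "g \<in> linear_maps A M M'" "inj_on g (carrier M)"
  shows "inj_on (tensor_map A M N M' N g (\<lambda>y. y)) (carrier (tensor_group A M N))"
proof -
  let ?T = "tensor_algebra A M N" and ?T' = "tensor_algebra A M' N"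
  interpret M: module A M by fact
  interpret M': module A M' by fact
  interpret N: module A N by fact
  interpret T: tensor_product A M N ?T by (rule tensor_product_tensor_algebra[OF M N])
  interpret T': tensor_product A M' N ?T' by (rule tensor_product_tensor_algebra[OF M' N])
  let ?G = "tensor_map A M N M' N g (\<lambda>y. y)"
  note G_hom = tensor_map_hom[OF T.tensor_product_axioms T'.tensor_product_axioms g(1) id_linear_map]
  note [simp del] = tensor_algebra_simps
  have kernel: "t = \<zero>\<^bsub>?T\<^esub>" if t: "t \<in> carrier ?T" and t0: "?G t = \<zero>\<^bsub>?T'\<^esub>" for t
  proof -
    let ?e = "frag_extend (\<lambda>(x, y). frag_of (g x, y))"
    obtain z where z: "z \<in> carrier T.free" "t = T.null #>\<^bsub>T.free\<^esub> z"
      using t unfolding T.carrier_T_cosets by auto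
    have ez: "?e z \<in> carrier (free_Abelian_group (carrier M' \<times> N'))"
      if "z \<in> carrier (free_Abelian_group (carrier M \<times> N'))" for N'
    proof -
      have "Poly_Mapping.keys (?e z) \<subseteq> (\<Union>x\<in>Poly_Mapping.keys z. {(g (fst x), snd x)})"
        by (rule subset_trans[OF keys_frag_extend]) (auto split: prod.splits)
      also have "\<dots> \<subseteq> carrier M' \<times> N'"
      proof (rule UN_least)
        fix x assume "x \<in> Poly_Mapping.keys z"
        then have "x \<in> carrier M \<times> N'" using that by auto
        then show "{(g (fst x), snd x)} \<subseteq> carrier M' \<times> N'"
          by (auto simp: linear_mapsD(1)[OF g(1)])
      qed
      finally show ?thesis by simp
    qed
    have "?e z \<in> T'.null"
      using t0 tensor_map_coset[OF T.tensor_product_axioms T'.tensor_product_axioms g(1) id_linear_map z(1)]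
        T'.coset_zero_iff[OF ez[OF z(1)]] z(2) by simp
    from tensor_null_finite_support[OF T'.tensor_product_axioms this]
    obtain S where S: "finite S" "S \<subseteq> carrier N"
      and S_null: "\<And>N'. S \<subseteq> N' \<Longrightarrow> submodule N' A N \<Longrightarrow> ?e z \<in> tensor_null A M' (N\<lparr>carrier := N'\<rparr>)"
      by auto
    \<comment> \<open>Besides the elements \<open>S\<close> that witness the relation, the submodule
      must contain the second components of \<open>z\<close>, so that \<open>z\<close> itself
      represents a tensor over it.\<close>
    have "finite (S \<union> snd ` Poly_Mapping.keys z)" "S \<union> snd ` Poly_Mapping.keys z \<subseteq> carrier N"
      using S z by auto
    from N.independent_generators[OF vd tf this]
    obtain Z where Z: "finite Z" "Z \<subseteq> carrier N"
      and Z_span: "S \<union> snd ` Poly_Mapping.keys z \<subseteq> N.span_of Z"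
      and ind: "\<And>c. c \<in> Z \<rightarrow> carrier A \<Longrightarrow> N.lin_comb c Z = \<zero>\<^bsub>N\<^esub> \<Longrightarrow> \<forall>z\<in>Z. c z = \<zero>\<^bsub>A\<^esub>"
      by metis
    define H where "H = N.span_of Z"
    have H: "submodule H A N"
      unfolding H_def by (rule N.submodule_span_of[OF Z])
    let ?N = "N\<lparr>carrier := H\<rparr>"
    have modH: "module A ?N" by (rule submodule.submodule_is_module[OF H N])
    interpret S: tensor_product A M ?N "tensor_algebra A M ?N"
      by (rule tensor_product_tensor_algebra[OF M modH])
    interpret S': tensor_product A M' ?N "tensor_algebra A M' ?N"
      by (rule tensor_product_tensor_algebra[OF M' modH])
    \<comment> \<open>Coordinates with respect to \<open>Z\<close> are chosen; independence makes
      them unique, hence additive and compatible with scalars, as the contraction argument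
      requires.\<close>
    define \<psi> where "\<psi> z n = (SOME c. c \<in> Z \<rightarrow> carrier A \<and> n = N.lin_comb c Z) z" for z n
    have \<psi>: "(\<lambda>z. \<psi> z n) \<in> Z \<rightarrow> carrier A \<and> n = N.lin_comb (\<lambda>z. \<psi> z n) Z" if "n \<in> H" for n
    proof -
      have "\<exists>c. c \<in> Z \<rightarrow> carrier A \<and> n = N.lin_comb c Z"
        using that by (auto simp: H_def N.span_of_def)
      from someI_ex[OF this] show ?thesis unfolding \<psi>_def .
    qed
    have \<psi>_closed: "\<psi> z n \<in> carrier A" if "z \<in> Z" "n \<in> H" for z n
      using \<psi>[OF that(2)] that(1) by auto
    have unique: "c z = d z" if cd: "c \<in> Z \<rightarrow> carrier A" "d \<in> Z \<rightarrow> carrier A"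
      "N.lin_comb c Z = N.lin_comb d Z" and z: "z \<in> Z" for c d z
    proof -
      let ?m = "\<lambda>z. \<ominus>\<^bsub>A\<^esub> \<one>\<^bsub>A\<^esub> \<otimes>\<^bsub>A\<^esub> d z"
      have m: "?m \<in> Z \<rightarrow> carrier A" using cd by (auto simp: Pi_iff)
      have d_closed: "N.lin_comb d Z \<in> carrier N" by (rule N.lin_comb_closed[OF Z(2) cd(2)])
      have "N.lin_comb (\<lambda>z. c z \<oplus>\<^bsub>A\<^esub> ?m z) Z = N.lin_comb c Z \<oplus>\<^bsub>N\<^esub> (\<ominus>\<^bsub>A\<^esub> \<one>\<^bsub>A\<^esub>) \<odot>\<^bsub>N\<^esub> N.lin_comb d Z"
        using N.lin_comb_add[OF Z(2) cd(1) m] N.lin_comb_smult[OF Z cd(2)] by simp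
      also have "\<dots> = \<zero>\<^bsub>N\<^esub>"
        using cd(3) d_closed by (simp add: N.smult_l_minus N.r_neg)
      finally have sum: "N.lin_comb (\<lambda>z. c z \<oplus>\<^bsub>A\<^esub> ?m z) Z = \<zero>\<^bsub>N\<^esub>" .
      have "(\<lambda>z. c z \<oplus>\<^bsub>A\<^esub> ?m z) \<in> Z \<rightarrow> carrier A"
        using m cd(1) by auto
      from ind[OF this sum] z have "c z \<oplus>\<^bsub>A\<^esub> ?m z = \<zero>\<^bsub>A\<^esub>" by blast
      moreover have czdz: "c z \<in> carrier A" "d z \<in> carrier A"
        using cd z by auto
      ultimately have "c z \<ominus>\<^bsub>A\<^esub> d z = \<zero>\<^bsub>A\<^esub>"
        by (simp add: M.R.minus_eq M.R.l_minus)
      then show ?thesis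
        using czdz by (rule M.R.minus_eq_zeroD)
    qed
    have keys_H: "z \<in> carrier (free_Abelian_group (carrier M \<times> H))"
      using z(1) Z_span by (force simp: H_def)
    let ?t = "S.null #>\<^bsub>S.free\<^esub> z"
    have t_closed: "?t \<in> carrier (tensor_algebra A M ?N)"
      unfolding S.carrier_T_cosets using keys_H by (intro imageI) simp
    have "tensor_map A M ?N M' ?N g (\<lambda>y. y) ?t = S'.null #>\<^bsub>S'.free\<^esub> ?e z"
      using tensor_map_coset[OF S.tensor_product_axioms S'.tensor_product_axioms g(1) id_linear_map]
        keys_H by simp
    also have "\<dots> = \<zero>\<^bsub>tensor_algebra A M' ?N\<^esub>"
      using S'.coset_zero_iff[of "?e z"] S_null[OF _ H] ez[OF keys_H] Z_span by (simp add: H_def)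
    finally have "?t = \<zero>\<^bsub>tensor_algebra A M ?N\<^esub>"
    proof (rule inj_tensor_map_coordinates[OF M M' modH g, of Z \<psi>, rotated -1])
      show "Z \<subseteq> carrier ?N"
        using N.span_of_superset[OF Z] by (simp add: H_def)
      fix z n assume z: "z \<in> Z" and n: "n \<in> carrier ?N"
      show "\<psi> z n \<in> carrier A" using \<psi>_closed z n by simp
      show "\<psi> z (a \<odot>\<^bsub>?N\<^esub> n) = a \<otimes>\<^bsub>A\<^esub> \<psi> z n" if a: "a \<in> carrier A" for a
      proof (rule unique[of "\<lambda>z. \<psi> z (a \<odot>\<^bsub>?N\<^esub> n)" "\<lambda>z. a \<otimes>\<^bsub>A\<^esub> \<psi> z n", OF _ _ _ z])
        have an: "a \<odot>\<^bsub>N\<^esub> n \<in> H" using N.submoduleE(4)[OF H a] n by simp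
        then show "(\<lambda>z. \<psi> z (a \<odot>\<^bsub>?N\<^esub> n)) \<in> Z \<rightarrow> carrier A" using \<psi> by simp
        show "(\<lambda>z. a \<otimes>\<^bsub>A\<^esub> \<psi> z n) \<in> Z \<rightarrow> carrier A" using \<psi>_closed a n by auto
        show "N.lin_comb (\<lambda>z. \<psi> z (a \<odot>\<^bsub>?N\<^esub> n)) Z = N.lin_comb (\<lambda>z. a \<otimes>\<^bsub>A\<^esub> \<psi> z n) Z"
          using \<psi>[OF an] \<psi>[of n] n N.lin_comb_smult[OF Z _ a, of "\<lambda>z. \<psi> z n"] by simp
      qed
      show "\<psi> z (n \<oplus>\<^bsub>?N\<^esub> n') = \<psi> z n \<oplus>\<^bsub>A\<^esub> \<psi> z n'" if n': "n' \<in> carrier ?N" for n'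
      proof (rule unique[of "\<lambda>z. \<psi> z (n \<oplus>\<^bsub>?N\<^esub> n')" "\<lambda>z. \<psi> z n \<oplus>\<^bsub>A\<^esub> \<psi> z n'", OF _ _ _ z])
        have nn: "n \<oplus>\<^bsub>N\<^esub> n' \<in> H" using N.submoduleE(5)[OF H] n n' by simp
        then show "(\<lambda>z. \<psi> z (n \<oplus>\<^bsub>?N\<^esub> n')) \<in> Z \<rightarrow> carrier A" using \<psi> by simp
        show "(\<lambda>z. \<psi> z n \<oplus>\<^bsub>A\<^esub> \<psi> z n') \<in> Z \<rightarrow> carrier A" using \<psi>_closed n n' by auto
        show "N.lin_comb (\<lambda>z. \<psi> z (n \<oplus>\<^bsub>?N\<^esub> n')) Z = N.lin_comb (\<lambda>z. \<psi> z n \<oplus>\<^bsub>A\<^esub> \<psi> z n') Z"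
          using \<psi>[OF nn] \<psi>[of n] \<psi>[of n'] n n'
            N.lin_comb_add[OF Z(2), of "\<lambda>z. \<psi> z n" "\<lambda>z. \<psi> z n'"] by simp
      qed
    next
      fix n assume n: "n \<in> carrier ?N"
      have "Z \<subseteq> H" using N.span_of_superset[OF Z] by (simp add: H_def)
      then have "(\<Oplus>\<^bsub>?N\<^esub>z\<in>Z. \<psi> z n \<odot>\<^bsub>N\<^esub> z) = N.lin_comb (\<lambda>z. \<psi> z n) Z"
        unfolding N.lin_comb_def using n
        by (intro N.finsum_submodule[OF H Z(1)]) (auto simp: \<psi>_closed intro!: N.submoduleE(4)[OF H])
      then show "n = (\<Oplus>\<^bsub>?N\<^esub>z\<in>Z. \<psi> z n \<odot>\<^bsub>?N\<^esub> z)"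
        using \<psi>[of n] n by simp
    qed (use Z(1) t_closed in auto)
    \<comment> \<open>The tensor vanishes over the submodule \<open>H\<close>; the additive map
      induced by the inclusion of \<open>H\<close> in \<open>N\<close> sends it to \<open>t\<close>,
      so \<open>t\<close> vanishes too.\<close>
    moreover have "(\<lambda>y. y) \<in> linear_maps A ?N N"
      using N.submoduleE(1)[OF H] by (auto simp: linear_maps_def hom_def)
    note incl = tensor_map_coset[OF S.tensor_product_axioms T.tensor_product_axioms id_linear_map this, of z]
      tensor_map_hom[OF S.tensor_product_axioms T.tensor_product_axioms id_linear_map this]
    have "t = tensor_map A M ?N M N (\<lambda>x. x) (\<lambda>y. y) ?t"
      using incl(1) keys_H z(2) by (simp flip: frag_expansion add: case_prod_beta')
    ultimately show ?thesis
      using additive_zero[OF incl(2) S.abelian_group_T T.abelian_group_T] by simp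
  qed
  interpret G: group_hom "add_monoid ?T" "add_monoid ?T'" ?G
    by unfold_locales (rule G_hom)
  have "kernel (add_monoid ?T) (add_monoid ?T') ?G = {\<zero>\<^bsub>?T\<^esub>}"
    using kernel additive_zero[OF G_hom T.abelian_group_T T'.abelian_group_T]
    by (auto simp: kernel_def)
  then show ?thesis
    using G.inj_iff_trivial_ker by (simp add: T.carrier_T)
qed

text \<open>Multiplication by a nonzero \<open>a\<close> is injective on \<open>A\<close>, and after
  tensoring with \<open>N\<close> it sends 1 \<otimes> n to 1 \<otimes> a n. If a n = 0, flatness
  gives 1 \<otimes> n = 0, and the action of \<open>A\<close> on \<open>N\<close> carries this to n
  = 0.\<close>

lemma flat_imp_torsion_free:
  fixes N :: "('a, 'n) module"
  assumes dom: "domain A" and N: "module A N" and flat: "flat A N"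
  shows "torsion_free A N"
  unfolding torsion_free_def
proof (intro ballI impI)
  fix a n assume a: "a \<in> carrier A" and n: "n \<in> carrier N" and an: "a \<odot>\<^bsub>N\<^esub> n = \<zero>\<^bsub>N\<^esub>"
  interpret A: domain A by fact
  interpret N: module A N by fact
  \<comment> \<open>\<open>A\<close> as a module over itself. Its carrier consists of scalars, as
    demanded of the test modules in \<open>flat\<close>.\<close>
  define R where "R = \<lparr>carrier = carrier A, monoid.mult = monoid.mult A, one = one A, zero = zero A,
    add = add A, module.smult = monoid.mult A\<rparr>"
  have R_simps [simp]: "carrier R = carrier A" "zero R = zero A" "add R = add A"
    "module.smult R = monoid.mult A" by (simp_all add: R_def)
  have R: "module A R"
    by (rule moduleI)
      (auto simp: A.l_distr A.r_distr A.m_assoc A.a_assoc A.is_cring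
         intro!: abelian_groupI bexI[of _ "\<ominus>\<^bsub>A\<^esub> _"] intro: A.a_comm A.l_neg)
  interpret T: tensor_product A R N "tensor_algebra A R N"
    by (rule tensor_product_tensor_algebra[OF R N])
  show "a = \<zero>\<^bsub>A\<^esub> \<or> n = \<zero>\<^bsub>N\<^esub>"
  proof (rule disjCI, rule ccontr)
    assume n0: "n \<noteq> \<zero>\<^bsub>N\<^esub>" and a0: "a \<noteq> \<zero>\<^bsub>A\<^esub>"
    let ?g = "\<lambda>x. a \<otimes>\<^bsub>A\<^esub> x"
    have g: "?g \<in> linear_maps A R R"
      using a by (auto simp: linear_maps_def hom_def A.r_distr A.m_lcomm)
    have "inj_on ?g (carrier R)"
      using a a0 by (auto simp: inj_on_def A.m_lcancel)
    then have inj: "inj_on (tensor_map A R N R N ?g (\<lambda>y. y)) (carrier (tensor_group A R N))"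
      using flat[unfolded flat_def, rule_format, of R R ?g] R g by simp
    note map = tensor_map_pure[OF T.tensor_product_axioms T.tensor_product_axioms g id_linear_map]
    have "tensor_map A R N R N ?g (\<lambda>y. y) (T.pure \<one>\<^bsub>A\<^esub> n) = T.pure (a \<odot>\<^bsub>R\<^esub> \<one>\<^bsub>A\<^esub>) n"
      using n by (simp add: map)
    also have "\<dots> = T.pure \<one>\<^bsub>A\<^esub> \<zero>\<^bsub>N\<^esub>"
      using T.pure_smult[of a "\<one>\<^bsub>A\<^esub>" n] a n an by (simp del: tensor_algebra_simps)
    also have "\<dots> = tensor_map A R N R N ?g (\<lambda>y. y) (T.pure \<one>\<^bsub>A\<^esub> \<zero>\<^bsub>N\<^esub>)"
      using a T.pure_smult[of a "\<one>\<^bsub>A\<^esub>" "\<zero>\<^bsub>N\<^esub>"] by (subst map) (simp_all del: tensor_algebra_simps)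
    finally have eq: "T.pure \<one>\<^bsub>A\<^esub> n = T.pure \<one>\<^bsub>A\<^esub> \<zero>\<^bsub>N\<^esub>"
      by (rule inj_onD[OF inj]) (use n in \<open>simp_all flip: T.carrier_T del: T.pure_zero_right tensor_algebra_simps\<close>)
    \<comment> \<open>The action map from A \<otimes> N to \<open>N\<close> recovers
      \<open>n\<close> from its pure tensor with 1.\<close>
    have bal: "balanced A R N N (\<lambda>x y. x \<odot>\<^bsub>N\<^esub> y)"
      by (rule balancedI)
        (simp_all add: N.smult_l_distr N.smult_r_distr N.smult_assoc1[symmetric] A.m_comm)
    have G: "carrier (add_monoid N) = carrier N" "monoid.mult (add_monoid N) = add N" by simp_all
    have "n = \<zero>\<^bsub>N\<^esub>"
      using arg_cong[OF eq, of "tensor_lift A R N (add_monoid N) (\<lambda>x y. x \<odot>\<^bsub>N\<^esub> y)"] n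
        T.tensor_lift_pure[OF N.M.abelian_group_axioms bal G, of "\<one>\<^bsub>A\<^esub>"]
      by (simp del: T.pure_zero_right)
    with n0 show False ..
  qed
qed

text \<open>Multiplication by \<open>a\<close> on the product is induced by multiplication by
  \<open>a\<close> on \<open>S\<close>. The latter is injective for nonzero \<open>a\<close>, as
  \<open>S\<close> is torsion-free, and stays so after tensoring with the torsion-free
  \<open>U\<close>. Hence the product is torsion-free, and over a valuation ring this gives
  flatness.\<close>

lemma flat_tensor_algebra:
  assumes vd: "valuation_domain A" and S: "algebra A S" and U: "algebra A U"
    and flat: "flat A S" "flat A U"
  shows "flat A (tensor_algebra A S U)"
proof -
  interpret vd: valuation_domain A by fact
  interpret S: algebra A S by fact
  interpret U: algebra A U by fact
  interpret TA: module A "tensor_algebra A S U" by (rule module_tensor_algebra[OF S.module U.module])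
  note tf = flat_imp_torsion_free[OF vd.A.domain_axioms S.module flat(1)]
    flat_imp_torsion_free[OF vd.A.domain_axioms U.module flat(2)]
  have "torsion_free A (tensor_algebra A S U)"
    unfolding torsion_free_def
  proof (intro ballI impI)
    fix a t assume a: "a \<in> carrier A" and t: "t \<in> carrier (tensor_algebra A S U)"
      and at: "a \<odot>\<^bsub>tensor_algebra A S U\<^esub> t = \<zero>\<^bsub>tensor_algebra A S U\<^esub>"
    show "a = \<zero>\<^bsub>A\<^esub> \<or> t = \<zero>\<^bsub>tensor_algebra A S U\<^esub>"
    proof (cases "a = \<zero>\<^bsub>A\<^esub>")
      case a0: False
    let ?g = "\<lambda>x. a \<odot>\<^bsub>S\<^esub> x"
    have "inj_on ?g (carrier S)"
    proof (rule inj_onI)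
      fix x y assume xy: "x \<in> carrier S" "y \<in> carrier S" "a \<odot>\<^bsub>S\<^esub> x = a \<odot>\<^bsub>S\<^esub> y"
      then have "a \<odot>\<^bsub>S\<^esub> (x \<ominus>\<^bsub>S\<^esub> y) = \<zero>\<^bsub>S\<^esub>"
        using a by (simp add: S.minus_eq S.smult_r_distr S.smult_r_minus S.r_neg)
      then have "x \<ominus>\<^bsub>S\<^esub> y = \<zero>\<^bsub>S\<^esub>"
        using tf(1) a a0 xy unfolding torsion_free_def by auto
      then show "x = y" using xy(1,2) by (rule S.minus_eq_zeroD)
    qed
    then have "inj_on (tensor_map A S U S U ?g (\<lambda>y. y)) (carrier (tensor_group A S U))"
      by (rule torsion_free_inj_tensor_map[OF vd.valuation_domain_axioms S.module S.module U.module
            tf(2) S.smult_linear_map[OF a]])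
    moreover have "module.smult (tensor_algebra A S U) a = tensor_map A S U S U ?g (\<lambda>y. y)"
      by (simp add: tensor_algebra_def tensor_map_def)
    moreover have "a \<odot>\<^bsub>tensor_algebra A S U\<^esub> \<zero>\<^bsub>tensor_algebra A S U\<^esub> = \<zero>\<^bsub>tensor_algebra A S U\<^esub>"
      using a by (rule TA.smult_r_null)
    ultimately have "t = \<zero>\<^bsub>tensor_algebra A S U\<^esub>"
      using t at TA.M.zero_closed by (auto dest: inj_onD)
    then show ?thesis ..
    qed simp
  qed
  then show ?thesis
    unfolding flat_def
    using torsion_free_inj_tensor_map[OF vd.valuation_domain_axioms _ _ TA.module_axioms] by blast
qed

section \<open>Hermitian lattices over the base ring\<close>

locale hermitian_space =
  fixes D :: "('f::field, 'k::ring_1, 'v::ab_group_add) lattice_data" and n :: nat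
  assumes hermitian_lattice: "hermitian_lattice D n"
begin

abbreviation "h \<equiv> assoc_bilinear D (herm D)"
abbreviation "A \<equiv> base_ring D"

lemma discrete_valuation: "discrete_valuation (val D)"
  using hermitian_lattice by (simp add: hermitian_lattice_def nonarch_local_field_def)

lemma emb [simp]:
  "emb D 1 = 1" "emb D (a + b) = emb D a + emb D b" "emb D (a * b) = emb D a * emb D b"
  using hermitian_lattice unfolding hermitian_lattice_def central_embedding_def by blast+

lemma emb_central: "emb D a * x = x * emb D a"
  using hermitian_lattice unfolding hermitian_lattice_def central_embedding_def by blast

lemma emb_0 [simp]: "emb D 0 = 0"
  using emb(2)[of 0 0] by simp

lemma emb_minus: "emb D (- a) = - emb D a"
  using emb(2)[of a "- a"] by (simp add: minus_unique del: emb)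

text \<open>In the split case scalars are the diagonal pairs, which the swap fixes; the other cases
  are immediate from their definitions.\<close>

lemma invol_emb [simp]: "invol D (emb D a) = emb D a"
proof -
  have "case_base D \<or> case_quadratic_ext D \<or> case_split D \<or> case_quaternion D"
    using hermitian_lattice by (simp add: hermitian_lattice_def)
  then consider "case_base D" | "case_quadratic_ext D" | "case_split D" | "case_quaternion D"
    by blast
  then show ?thesis
  proof cases
    case 3
    then obtain g :: "'k \<Rightarrow> 'f \<times> 'f" where g: "bij g" "\<And>a. g (emb D a) = (a, a)"
      "\<And>x. g (invol D x) = prod.swap (g x)"
      unfolding case_split_def by blast
    have "g (invol D (emb D a)) = g (emb D a)" by (simp add: g)
    then show ?thesis by (rule injD[OF bij_is_inj[OF g(1)]])
  qed (auto simp: case_base_def case_quadratic_ext_def case_quaternion_def)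
qed

lemma invol_0 [simp]: "invol D 0 = 0" and invol_1 [simp]: "invol D 1 = 1"
  using invol_emb[of 0] invol_emb[of 1] by simp_all

lemma right_module: "right_module D"
  using hermitian_lattice by (simp add: hermitian_lattice_def)

lemma act [simp]:
  "act D (v + w) c = act D v c + act D w c" "act D v (c + d) = act D v c + act D v d" "act D v 1 = v"
  using right_module unfolding right_module_def by blast+

lemma act_mult: "act D v (c * d) = act D (act D v c) d"
  using right_module unfolding right_module_def by blast

lemma act_0 [simp]: "act D 0 c = 0" "act D v 0 = 0"
  using act(1)[of 0 0 c] act(2)[of v 0 0] by simp_all

lemma act_minus: "act D v (- c) = - act D v c"
  using act(2)[of v c "- c"] by (simp add: minus_unique del: act)

lemma act_sum: "act D (\<Sum>i\<in>I. f i) c = (\<Sum>i\<in>I. act D (f i) c)"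
  by (induct I rule: infinite_finite_induct) simp_all

lemma act_sum_right: "act D v (\<Sum>i\<in>I. f i) = (\<Sum>i\<in>I. act D v (f i))"
  by (induct I rule: infinite_finite_induct) simp_all

lemma quadratic_case_facts:
  assumes "quadratic_case D"
  shows "invol D x = x" "x * y = y * x" "(2::'f) \<noteq> 0" "eps D = 1"
proof -
  have cb: "bij (emb D)" "(2::'f) \<noteq> 0" "invol D = id" "eps D = 1"
    using assms by (auto simp: quadratic_case_def case_base_def)
  obtain a where "x = emb D a" using bij_is_surj[OF cb(1)] by (metis surjE)
  with cb show "invol D x = x" "x * y = y * x" "(2::'f) \<noteq> 0" "eps D = 1"
    by (simp_all add: emb_central)
qed

text \<open>The residue characteristic is 2 here while the characteristic of F is not, so 1/2 exists
  in F and acts on K.\<close>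

lemma emb_half: "quadratic_case D \<Longrightarrow> emb D (1 / 2) * x + emb D (1 / 2) * x = x"
proof -
  assume "quadratic_case D"
  then have "(2::'f) \<noteq> 0" by (rule quadratic_case_facts)
  then have "(1 / 2 + 1 / 2 :: 'f) = 1" by (simp add: field_simps)
  then show ?thesis by (metis distrib_right emb(1,2) mult_1)
qed

lemma hermitian_form_on_lat: "hermitian_form_on_lat D (herm D)"
  using hermitian_lattice by (simp add: hermitian_lattice_def)

lemma herm_quadratic:
  assumes "quadratic_case D"
  obtains q where "herm D = Quadratic q" "quadratic_form D q"
  using hermitian_form_on_lat assms by (auto simp: hermitian_form_on_lat_def)

lemma herm_hermitian:
  assumes "\<not> quadratic_case D"
  shows "herm D = Hermitian h" "sesquilinear_hermitian D h"
  using hermitian_form_on_lat assms by (auto simp: hermitian_form_on_lat_def)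

text \<open>From q(2v) = 4 q(v) the polar form takes the value 2 q(v) at (v, v), and the factor 1/2
  in the associated bilinear form cancels the 2.\<close>

lemma quadratic_value:
  assumes "quadratic_case D" "herm D = Quadratic q" "quadratic_form D q"
  shows "q v = h v v"
proof -
  have "q (act D v (1 + 1)) = q v * (1 + 1)^2"
    using assms(3) unfolding quadratic_form_def by blast
  then have "q (v + v) = q v + q v + (q v + q v)"
    by (simp only: act power2_eq_square distrib_left distrib_right mult_1_right)
  then have "h v v = emb D (1 / 2) * (q v + q v)"
    using assms(2) by (simp add: algebra_simps)
  then show ?thesis
    using emb_half[OF assms(1), of "q v"] by (simp add: distrib_left)
qed

lemma h_properties:
  shows h_add_left: "h (v + v') w = h v w + h v' w"
    and h_add_right: "h v (w + w') = h v w + h v w'"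
    and h_act: "h (act D v c) (act D w d) = invol D c * h v w * d"
    and h_sym: "h w v = of_int (eps D) * invol D (h v w)"
proof -
  have "h (v + v') w = h v w + h v' w \<and> h v (w + w') = h v w + h v w' \<and>
    h (act D v c) (act D w d) = invol D c * h v w * d \<and> h w v = of_int (eps D) * invol D (h v w)"
  proof (cases "quadratic_case D")
    case True
    then obtain q where q: "herm D = Quadratic q" "quadratic_form D q" by (rule herm_quadratic)
    note comm = quadratic_case_facts(2)[OF True]
    define b where "b v w = q (v + w) - q v - q w" for v w
    have b: "b (v + v') w = b v w + b v' w" "b v (w + w') = b v w + b v w'"
      "b (act D v c) w = b v w * c" "b v (act D w c) = b v w * c" for v v' w w' c
      using q(2) unfolding quadratic_form_def Let_def b_def by blast+
    have h: "h = (\<lambda>v w. emb D (1 / 2) * b v w)" by (simp add: q b_def)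
    have "b (act D v c) (act D w d) = c * b v w * d"
      by (simp only: b comm[of c "b v w"])
    then have "h (act D v c) (act D w d) = invol D c * h v w * d"
      by (simp add: h quadratic_case_facts(1)[OF True] flip: mult.assoc) (simp add: emb_central)
    moreover have "b w v = b v w" by (simp add: b_def add.commute)
    then have "h w v = h v w" by (simp add: h)
    ultimately show ?thesis
      by (simp add: h b quadratic_case_facts[OF True] distrib_left)
  next
    case False
    from herm_hermitian(2)[OF this] show ?thesis
      unfolding sesquilinear_hermitian_def by blast
  qed
  then show "h (v + v') w = h v w + h v' w" "h v (w + w') = h v w + h v w'"
    "h (act D v c) (act D w d) = invol D c * h v w * d" "h w v = of_int (eps D) * invol D (h v w)"
    by blast+
qed

lemma h_act_right: "h v (act D w c) = h v w * c"
  using h_act[of v 1 w c] by simp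

lemma h_act_left: "h (act D v c) w = invol D c * h v w"
  using h_act[of v c w 1] by simp

lemma h_0 [simp]: "h 0 w = 0" "h v 0 = 0"
  using h_add_left[of 0 0 w] h_add_right[of v 0 0] by simp_all

lemma h_minus: "h (- v) w = - h v w" "h v (- w) = - h v w"
  using h_add_left[of v "- v" w] h_add_right[of v w "- w"]
  by (simp_all add: eq_neg_iff_add_eq_0 add.commute)

lemma h_diff: "h v (w - w') = h v w - h v w'"
  using h_add_right[of v w "- w'"] by (simp add: h_minus)

lemma h_sum_left: "h (\<Sum>i\<in>I. f i) w = (\<Sum>i\<in>I. h (f i) w)"
  by (induct I rule: infinite_finite_induct) (simp_all add: h_add_left)

lemma nondegenerate_left: "(\<And>w. h v w = 0) \<Longrightarrow> v = 0"
  using hermitian_lattice by (auto simp: hermitian_lattice_def)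

lemma nondegenerate_right: "(\<And>v. h v w = 0) \<Longrightarrow> w = 0"
  by (rule nondegenerate_left) (subst h_sym, simp)

lemma eq_rightI: "(\<And>v. h v w = h v w') \<Longrightarrow> w = w'"
  using nondegenerate_right[of "w - w'"] by (simp add: h_diff)

lemma End_K_D:
  assumes "X \<in> End_K D"
  shows "X (v + w) = X v + X w" "X (act D v c) = act D (X v) c"
  using assms by (auto simp: End_K_def)

lemma End_K_sum: "X \<in> End_K D \<Longrightarrow> X (\<Sum>i\<in>I. f i) = (\<Sum>i\<in>I. X (f i))"
proof -
  assume X: "X \<in> End_K D"
  have "X 0 = 0" using End_K_D(1)[OF X, of 0 0] by simp
  then show ?thesis
    by (induct I rule: infinite_finite_induct) (simp_all add: End_K_D[OF X])
qed

lemma max_order: "is_order D (max_order D)"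
  using hermitian_lattice by (simp add: hermitian_lattice_def is_maximal_order_def)

lemma max_order_closed:
  shows max_order_diff: "x \<in> max_order D \<Longrightarrow> y \<in> max_order D \<Longrightarrow> x - y \<in> max_order D"
    and max_order_one: "1 \<in> max_order D"
  using max_order by (auto simp: is_order_def)

lemma max_order_zero: "0 \<in> max_order D"
  using max_order_diff[OF max_order_one max_order_one] by simp

lemma max_order_add: "x \<in> max_order D \<Longrightarrow> y \<in> max_order D \<Longrightarrow> x + y \<in> max_order D"
  using max_order_diff[of x "0 - y"] max_order_diff[OF max_order_zero, of y] by simp

lemma val_ring_closed:
  shows "0 \<in> val_ring_set (val D)" "1 \<in> val_ring_set (val D)"
    and "a \<in> val_ring_set (val D) \<Longrightarrow> b \<in> val_ring_set (val D) \<Longrightarrow> a + b \<in> val_ring_set (val D)"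
    and "a \<in> val_ring_set (val D) \<Longrightarrow> b \<in> val_ring_set (val D) \<Longrightarrow> a * b \<in> val_ring_set (val D)"
    and "a \<in> val_ring_set (val D) \<Longrightarrow> - a \<in> val_ring_set (val D)"
proof -
  have mult: "val D (x * y) = val D x + val D y" if "x \<noteq> 0" "y \<noteq> 0" for x y
    using discrete_valuation that by (simp add: discrete_valuation_def)
  have add: "min (val D x) (val D y) \<le> val D (x + y)" if "x \<noteq> 0" "y \<noteq> 0" "x + y \<noteq> 0" for x y
    using discrete_valuation that by (simp add: discrete_valuation_def)
  have one: "val D 1 = 0" using mult[of 1 1] by simp
  have m1: "val D (- 1) = 0" using mult[of "- 1" "- 1"] one by simp
  show "0 \<in> val_ring_set (val D)" "1 \<in> val_ring_set (val D)"
    by (simp_all add: val_ring_set_def one)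
  show "a \<in> val_ring_set (val D) \<Longrightarrow> b \<in> val_ring_set (val D) \<Longrightarrow> a + b \<in> val_ring_set (val D)"
    using add[of a b] by (fastforce simp: val_ring_set_def)
  show mult_closed: "a \<in> val_ring_set (val D) \<Longrightarrow> b \<in> val_ring_set (val D) \<Longrightarrow> a * b \<in> val_ring_set (val D)" for a b
    using mult[of a b] by (cases "a = 0 \<or> b = 0") (auto simp: val_ring_set_def)
  show "a \<in> val_ring_set (val D) \<Longrightarrow> - a \<in> val_ring_set (val D)"
    using mult_closed[of a "- 1"] m1 by (simp add: val_ring_set_def)
qed

lemma carrier_A: "carrier A = val_ring_set (val D)"
  by (simp add: base_ring_def val_ring_def)

lemma A_simps [simp]: "monoid.mult A = (*)" "one A = 1" "zero A = 0" "add A = (+)"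
  by (simp_all add: base_ring_def val_ring_def)

lemma A_cring: "cring A"
proof (rule cringI)
  show "abelian_group A"
    by (rule abelian_groupI) (auto simp: carrier_A val_ring_closed intro!: bexI[of _ "- _"])
  show "comm_monoid A"
    by (rule comm_monoidI) (auto simp: carrier_A val_ring_closed)
qed (auto simp: distrib_right)

text \<open>Of two nonzero elements, the quotient of the one with larger valuation by the other has
  nonnegative valuation.\<close>

lemma A_valuation_domain: "valuation_domain A"
proof -
  interpret cring A by (rule A_cring)
  have "domain A"
    by unfold_locales auto
  moreover have "(\<exists>c\<in>carrier A. b = a * c) \<or> (\<exists>c\<in>carrier A. a = b * c)"
    if "a \<in> carrier A" "b \<in> carrier A" for a b
  proof (cases "a = 0 \<or> b = 0")
    case True
    then show ?thesis by (auto intro!: bexI[of _ 0] simp: carrier_A val_ring_closed)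
  next
    case False
    have *: "\<exists>c\<in>carrier A. y = x * c" if "x \<noteq> 0" "y \<noteq> 0" "val D x \<le> val D y" for x y
    proof -
      have "val D (x * (y / x)) = val D x + val D (y / x)"
        using discrete_valuation that unfolding discrete_valuation_def by (metis divide_eq_0_iff)
      then have "y / x \<in> carrier A" using that by (simp add: carrier_A val_ring_set_def)
      then show ?thesis using that by (intro bexI[of _ "y / x"]) simp_all
    qed
    show ?thesis using False *[of a b] *[of b a] by linarith
  qed
  ultimately show ?thesis
    by (simp add: valuation_domain_def valuation_domain_axioms_def)
qed

text \<open>Read off from the finite generating set over \<open>A\<close> that
  \<open>is_order\<close> provides.\<close>

lemma max_order_emb:
  assumes "a \<in> carrier A" "x \<in> max_order D"
  shows "emb D a * x \<in> max_order D"
proof -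
  obtain G where G: "max_order D = {\<Sum>g\<in>G. emb D (c g) * g | c. \<forall>g\<in>G. c g \<in> val_ring_set (val D)}"
    using max_order unfolding is_order_def by blast
  obtain c where c: "x = (\<Sum>g\<in>G. emb D (c g) * g)" "\<forall>g\<in>G. c g \<in> val_ring_set (val D)"
    using assms(2) unfolding G by blast
  have "emb D a * x = (\<Sum>g\<in>G. emb D (a * c g) * g)"
    by (simp add: c(1) sum_distrib_left mult.assoc)
  then show ?thesis
    unfolding G using assms(1) c(2) by (auto simp: carrier_A val_ring_closed intro!: exI[of _ "\<lambda>g. a * c g"])
qed

lemma lattice_basis: obtains e where "is_lattice_basis D n e"
  using hermitian_lattice by (auto simp: hermitian_lattice_def)

lemma lat_closed:
  shows lat_zero: "0 \<in> lat D"
    and lat_add: "v \<in> lat D \<Longrightarrow> w \<in> lat D \<Longrightarrow> v + w \<in> lat D"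
    and lat_smult: "a \<in> carrier A \<Longrightarrow> v \<in> lat D \<Longrightarrow> act D v (emb D a) \<in> lat D"
proof -
  obtain e where "is_lattice_basis D n e" by (rule lattice_basis)
  then have lat: "lat D = {\<Sum>i<n. act D (e i) (c i) | c. \<forall>i<n. c i \<in> max_order D}"
    by (simp add: is_lattice_basis_def)
  show "0 \<in> lat D"
    unfolding lat by (auto intro!: exI[of _ "\<lambda>_. 0"] simp: max_order_zero)
  show "v \<in> lat D \<Longrightarrow> w \<in> lat D \<Longrightarrow> v + w \<in> lat D"
    unfolding lat
  proof clarsimp
    fix c d assume "\<forall>i<n. c i \<in> max_order D" "\<forall>i<n. d i \<in> max_order D"
    then show "\<exists>f. (\<Sum>i<n. act D (e i) (c i)) + (\<Sum>i<n. act D (e i) (d i)) = (\<Sum>i<n. act D (e i) (f i)) \<and>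
        (\<forall>i<n. f i \<in> max_order D)"
      by (intro exI[of _ "\<lambda>i. c i + d i"]) (simp add: sum.distrib max_order_add)
  qed
  show "a \<in> carrier A \<Longrightarrow> v \<in> lat D \<Longrightarrow> act D v (emb D a) \<in> lat D"
    unfolding lat
  proof clarsimp
    fix c assume "a \<in> carrier A" "\<forall>i<n. c i \<in> max_order D"
    then show "\<exists>f. act D (\<Sum>i<n. act D (e i) (c i)) (emb D a) = (\<Sum>i<n. act D (e i) (f i)) \<and>
        (\<forall>i<n. f i \<in> max_order D)"
      by (intro exI[of _ "\<lambda>i. c i * emb D a"] conjI)
        (simp add: act_sum act_mult, metis emb_central max_order_emb)
  qed
qed

lemma lat_minus: "v \<in> lat D \<Longrightarrow> - v \<in> lat D"
  using lat_smult[of "- 1" v] by (simp add: carrier_A val_ring_closed emb_minus act_minus)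

lemma lat_module_simps [simp]:
  "carrier (lat_module D) = lat D" "zero (lat_module D) = 0" "add (lat_module D) = (+)"
  "module.smult (lat_module D) = (\<lambda>a v. act D v (emb D a))"
  by (simp_all add: lat_module_def)

lemma alg_module_simps [simp]:
  "carrier (alg_module D) = UNIV" "zero (alg_module D) = 0" "add (alg_module D) = (+)"
  "module.smult (alg_module D) = (\<lambda>a x. emb D a * x)"
  by (simp_all add: alg_module_def)

lemma module_lat: "module A (lat_module D)"
proof (rule moduleI[OF A_cring])
  show "abelian_group (lat_module D)"
  proof (rule abelian_groupI)
    fix v assume "v \<in> carrier (lat_module D)"
    then show "\<exists>w\<in>carrier (lat_module D). w \<oplus>\<^bsub>lat_module D\<^esub> v = \<zero>\<^bsub>lat_module D\<^esub>"
      by (intro bexI[of _ "- v"]) (simp_all add: lat_minus)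
  qed (simp_all add: lat_closed ac_simps)
  show "(a \<otimes>\<^bsub>A\<^esub> b) \<odot>\<^bsub>lat_module D\<^esub> v = a \<odot>\<^bsub>lat_module D\<^esub> (b \<odot>\<^bsub>lat_module D\<^esub> v)" for a b v
    by (simp add: act_mult[symmetric] mult.commute flip: emb(3) del: emb(3))
qed (simp_all add: lat_closed)

lemma module_alg: "module A (alg_module D)"
proof (rule moduleI[OF A_cring])
  show "abelian_group (alg_module D)"
  proof (rule abelian_groupI)
    fix v :: 'k
    show "\<exists>w\<in>carrier (alg_module D). w \<oplus>\<^bsub>alg_module D\<^esub> v = \<zero>\<^bsub>alg_module D\<^esub>"
      by (intro bexI[of _ "- v"]) simp_all
  qed (simp_all add: ac_simps)
qed (simp_all add: distrib_left distrib_right mult.assoc)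

end

section \<open>The modules \<open>T\<^sup>m(A)\<close>\<close>

context hermitian_space begin

text \<open>Scalars act from the right, which is harmless because F is commutative.\<close>

lemma vector_space_V: "vector_space (\<lambda>a v. act D v (emb D a))"
  by unfold_locales (simp_all add: act_mult[symmetric] mult.commute flip: emb(3) del: emb(3))

text \<open>The maximal order has finitely many generators over \<open>A\<close> and its F-multiples
  fill K, so the basis vectors of L multiplied by these generators span V over F. This treats all
  choices of K at once.\<close>

lemma finite_spanning_set:
  obtains S where "finite S" "\<And>v. v \<in> module.span (\<lambda>a v. act D v (emb D a)) S"
proof -
  interpret V: vector_space "\<lambda>a v. act D v (emb D a)" by (rule vector_space_V)
  obtain e where e: "is_lattice_basis D n e" by (rule lattice_basis)
  obtain G where G: "finite G"
    "max_order D = {\<Sum>g\<in>G. emb D (c g) * g | c. \<forall>g\<in>G. c g \<in> val_ring_set (val D)}"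
    using max_order unfolding is_order_def by blast
  let ?S = "(\<lambda>(i, g). act D (e i) g) ` ({..<n} \<times> G)"
  have gen: "act D (e i) x \<in> V.span ?S" if i: "i < n" for i x
  proof -
    have "\<exists>c. \<exists>s\<in>max_order D. x = emb D c * s"
      using max_order unfolding is_order_def by blast
    then obtain c s where s: "s \<in> max_order D" "x = emb D c * s" by blast
    obtain d where d: "s = (\<Sum>g\<in>G. emb D (d g) * g)"
      using s(1) unfolding G(2) by blast
    have "x = (\<Sum>g\<in>G. emb D (c * d g) * g)"
      by (simp add: s(2) d sum_distrib_left mult.assoc)
    also have "\<dots> = (\<Sum>g\<in>G. g * emb D (c * d g))"
      by (intro sum.cong refl emb_central)
    finally have "x = (\<Sum>g\<in>G. g * emb D (c * d g))" .
    then have "act D (e i) x = (\<Sum>g\<in>G. act D (act D (e i) g) (emb D (c * d g)))"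
      by (simp add: act_sum_right act_mult del: emb)
    also have "\<dots> \<in> V.span ?S"
      using i by (intro V.span_sum V.span_scale V.span_base) auto
    finally show ?thesis .
  qed
  have "v \<in> V.span ?S" for v
  proof -
    have "\<exists>!c. c \<in> extensional {..<n} \<and> v = (\<Sum>i<n. act D (e i) (c i))"
      using e unfolding is_lattice_basis_def by blast
    then obtain c where "v = (\<Sum>i<n. act D (e i) (c i))" by blast
    then show ?thesis
      using gen by (auto intro!: V.span_sum)
  qed
  with G(1) show thesis by (intro that[of ?S]) auto
qed

text \<open>The map sending \<open>w\<close> to the vector with coordinates \<open>h(e\<^sub>i, w)\<close> is injective by
  nondegeneracy, hence surjective because \<open>V\<close> is finite-dimensional over \<open>F\<close>.\<close>

lemma adjoint_exists:
  assumes X: "X \<in> End_K D"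
  shows "\<exists>Y\<in>End_K D. \<forall>v w. h (X v) w = h v (Y w)"
proof -
  interpret V: vector_space "\<lambda>a v. act D v (emb D a)" by (rule vector_space_V)
  obtain e where e: "is_lattice_basis D n e" by (rule lattice_basis)
  have coord: "\<exists>!c. c \<in> extensional {..<n} \<and> v = (\<Sum>i<n. act D (e i) (c i))" for v
    using e unfolding is_lattice_basis_def by blast
  \<comment> \<open>Coordinates are unique among functions that are extensional on the index range,
    hence the restriction.\<close>
  have coord_eq: "c i = d i" if "(\<Sum>i<n. act D (e i) (c i)) = (\<Sum>i<n. act D (e i) (d i))" "i < n" for c d i
  proof -
    have "restrict c {..<n} = restrict d {..<n}"
    proof -
      let ?P = "\<lambda>b. b \<in> extensional {..<n} \<and> (\<Sum>i<n. act D (e i) (c i)) = (\<Sum>i<n. act D (e i) (b i))"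
      have "?P (restrict c {..<n})" "?P (restrict d {..<n})"
        using that(1) by simp_all
      moreover have "\<exists>u. \<forall>b. ?P b \<longrightarrow> b = u"
        using coord[of "\<Sum>i<n. act D (e i) (c i)"] by (elim ex1E) blast
      ultimately show ?thesis by metis
    qed
    then show ?thesis using that(2) by (metis lessThan_iff restrict_apply)
  qed
  \<comment> \<open>By K-linearity of \<open>X\<close> and sesquilinearity of \<open>h\<close>, a
    candidate \<open>y\<close> has to be tested against the basis only.\<close>
  have eq_on_basis: "h (X v) w = h v y" if "\<And>i. i < n \<Longrightarrow> h (X (e i)) w = h (e i) y" for v w y
  proof -
    obtain c where c: "v = (\<Sum>i<n. act D (e i) (c i))" using coord by blast
    show ?thesis
      unfolding c End_K_sum[OF X] h_sum_left
      by (intro sum.cong) (simp_all add: End_K_D[OF X] h_act_left that)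
  qed
  define \<Phi> where "\<Phi> w = (\<Sum>i<n. act D (e i) (h (e i) w))" for w
  obtain S where S: "finite S" "\<And>v. v \<in> V.span S" using finite_spanning_set by blast
  obtain B where B: "B \<subseteq> S" "V.independent B" "S \<subseteq> V.span B"
    using V.maximal_independent_subset by metis
  have "V.span B = UNIV"
    using S(2) B(3) V.span_mono[OF B(3)] by (auto simp: V.span_span)
  then interpret FV: finite_dimensional_vector_space "\<lambda>a v. act D v (emb D a)" B
    using B S(1) by unfold_locales (auto intro: finite_subset)
  have lin: "Vector_Spaces.linear (\<lambda>a v. act D v (emb D a)) (\<lambda>a v. act D v (emb D a)) \<Phi>"
    by unfold_locales
      (simp_all add: \<Phi>_def h_add_right h_act_right sum.distrib act_sum act_mult)
  have "inj \<Phi>"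
  proof (rule injI)
    fix w w' assume "\<Phi> w = \<Phi> w'"
    then have *: "h (e i) w = h (e i) w'" if "i < n" for i
      using coord_eq[of "\<lambda>i. h (e i) w" "\<lambda>i. h (e i) w'"] that unfolding \<Phi>_def by blast
    have "h v w = h v w'" for v
    proof -
      obtain c where c: "v = (\<Sum>i<n. act D (e i) (c i))" using coord by blast
      show ?thesis
        unfolding c h_sum_left by (intro sum.cong) (simp_all add: h_act_left *)
    qed
    then show "w = w'" by (rule eq_rightI)
  qed
  then have "surj \<Phi>" by (rule FV.linear_inj_imp_surj[OF lin])
  then have "\<exists>y. \<forall>v. h (X v) w = h v y" for w
  proof -
    obtain y where "\<Phi> y = (\<Sum>i<n. act D (e i) (h (X (e i)) w))"
      using \<open>surj \<Phi>\<close> by (metis surjE)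
    then have "h (e i) y = h (X (e i)) w" if "i < n" for i
      using coord_eq[of "\<lambda>i. h (e i) y" "\<lambda>i. h (X (e i)) w"] that unfolding \<Phi>_def by blast
    then show ?thesis using eq_on_basis by metis
  qed
  then obtain Y where Y: "h (X v) w = h v (Y w)" for v w by metis
  \<comment> \<open>The values of \<open>Y\<close> were chosen one by one; nondegeneracy determines
    each of them and thereby forces linearity.\<close>
  have "Y \<in> End_K D"
    unfolding End_K_def
    by (auto intro!: eq_rightI simp: h_add_right h_act_right Y[symmetric])
  with Y show ?thesis by blast
qed

lemma adjoint_unique:
  assumes X: "X \<in> End_K D" and Y: "Y \<in> End_K D" "\<And>v w. h (X v) w = h v (Y w)"
  shows "adjoint D X = Y"
  unfolding adjoint_def
proof (rule the_equality)
  fix Z assume "Z \<in> End_K D \<and> (\<forall>v w. h (X v) w = h v (Z w))"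
  then show "Z = Y" using Y(2) by (intro ext eq_rightI) metis
qed (use Y in blast)

lemma
  assumes X: "X \<in> End_K D"
  shows adjoint_End_K: "adjoint D X \<in> End_K D"
    and adjoint_left: "h (X v) w = h v (adjoint D X w)"
    and adjoint_right: "h v (X w) = h (adjoint D X v) w"
proof -
  obtain Y where Y: "Y \<in> End_K D" "\<And>v w. h (X v) w = h v (Y w)"
    using adjoint_exists[OF X] by blast
  have "adjoint D X = Y" by (rule adjoint_unique[OF X Y])
  with Y show "adjoint D X \<in> End_K D" "h (X v) w = h v (adjoint D X w)" by simp_all
  show "h v (X w) = h (adjoint D X v) w"
    unfolding \<open>adjoint D X = Y\<close> using h_sym[of v "X w"] h_sym[of "Y v" w] Y(2)[of w v] by simp
qed

lemma adjoint_adjoint: "X \<in> End_K D \<Longrightarrow> adjoint D (adjoint D X) = X"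
  by (rule adjoint_unique) (simp_all add: adjoint_End_K adjoint_right)

lemma End_K_add: "X \<in> End_K D \<Longrightarrow> Y \<in> End_K D \<Longrightarrow> (\<lambda>v. X v + Y v) \<in> End_K D"
  unfolding End_K_def by (auto simp: ac_simps)

text \<open>Scalars from F are central in K, which is what keeps the scaled map linear over
  K.\<close>

lemma End_K_scale: "X \<in> End_K D \<Longrightarrow> (\<lambda>v. act D (X v) (emb D a)) \<in> End_K D"
  unfolding End_K_def by (auto simp: emb_central simp flip: act_mult)

lemma End_K_comp: "X \<in> End_K D \<Longrightarrow> Y \<in> End_K D \<Longrightarrow> (\<lambda>v. X (Y v)) \<in> End_K D"
  unfolding End_K_def by auto

lemma End_K_zero: "(\<lambda>v. 0) \<in> End_K D"
  unfolding End_K_def by auto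

lemma adjoint_add: "X \<in> End_K D \<Longrightarrow> Y \<in> End_K D \<Longrightarrow>
    adjoint D (\<lambda>v. X v + Y v) = (\<lambda>v. adjoint D X v + adjoint D Y v)"
  by (rule adjoint_unique)
    (simp_all add: End_K_add adjoint_End_K h_add_left h_add_right adjoint_left)

lemma adjoint_scale: "X \<in> End_K D \<Longrightarrow>
    adjoint D (\<lambda>v. act D (X v) (emb D a)) = (\<lambda>v. act D (adjoint D X v) (emb D a))"
  by (rule adjoint_unique)
    (simp_all add: End_K_scale adjoint_End_K h_act_left h_act_right adjoint_left emb_central)

lemma adjoint_comp: "X \<in> End_K D \<Longrightarrow> Y \<in> End_K D \<Longrightarrow>
    adjoint D (\<lambda>v. X (Y v)) = (\<lambda>v. adjoint D Y (adjoint D X v))"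
  by (rule adjoint_unique)
    (simp_all add: End_K_comp adjoint_End_K adjoint_left)

lemma adjoint_zero: "adjoint D (\<lambda>v. 0) = (\<lambda>v. 0)"
  by (rule adjoint_unique) (simp_all add: End_K_zero)

text \<open>The closure properties that survive one step of the recursion: an algebra over
  \<open>A\<close>, possibly without identity, that is stable under the adjoint. For the identity, h
  = \<psi>_0(Z) would have to be solved, and the obvious solution Z = 1/2 need not preserve
  L.\<close>

definition star_order :: "('v \<Rightarrow> 'v) set \<Rightarrow> bool" where
  "star_order T \<longleftrightarrow> T \<subseteq> T0 D \<and> (\<lambda>v. 0) \<in> T \<and>
     (\<forall>X\<in>T. \<forall>Y\<in>T. (\<lambda>v. X v + Y v) \<in> T \<and> (\<lambda>v. X (Y v)) \<in> T) \<and>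
     (\<forall>X\<in>T. \<forall>a\<in>carrier A. (\<lambda>v. act D (X v) (emb D a)) \<in> T) \<and>
     (\<forall>X\<in>T. adjoint D X \<in> T)"

lemma star_orderD:
  assumes "star_order T"
  shows "X \<in> T \<Longrightarrow> X \<in> End_K D" "X \<in> T \<Longrightarrow> v \<in> lat D \<Longrightarrow> X v \<in> lat D" "(\<lambda>v. 0) \<in> T"
    "X \<in> T \<Longrightarrow> Y \<in> T \<Longrightarrow> (\<lambda>v. X v + Y v) \<in> T" "X \<in> T \<Longrightarrow> Y \<in> T \<Longrightarrow> (\<lambda>v. X (Y v)) \<in> T"
    "X \<in> T \<Longrightarrow> a \<in> carrier A \<Longrightarrow> (\<lambda>v. act D (X v) (emb D a)) \<in> T"
    "X \<in> T \<Longrightarrow> adjoint D X \<in> T"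
  using assms unfolding star_order_def T0_def by blast+

lemma dual_lattice_D: "x \<in> dual_lattice D S \<Longrightarrow> l \<in> S \<Longrightarrow> h x l \<in> max_order D"
  by (simp add: dual_lattice_def)

lemma bidual: "dual_lattice D (dual_lattice D (lat D)) = lat D"
  using hermitian_lattice by (simp add: hermitian_lattice_def)

text \<open>Duality exchanges the two conditions on \<open>X\<close>: if \<open>X\<close> preserves
  L, its adjoint preserves the dual lattice, and if \<open>X\<close> preserves the dual lattice, its
  adjoint preserves the bidual, which is L by assumption.\<close>

lemma star_order_T0: "star_order (T0 D)"
proof -
  let ?L = "lat D" and ?M = "dual_lattice D (lat D)"
  have M_add: "v + w \<in> ?M" if "v \<in> ?M" "w \<in> ?M" for v w
    using that by (simp add: dual_lattice_def h_add_left max_order_add)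
  have M_scale: "act D v (emb D a) \<in> ?M" if "v \<in> ?M" "a \<in> carrier A" for v a
    using that by (simp add: dual_lattice_def h_act_left max_order_emb)
  have M_zero: "0 \<in> ?M"
    by (simp add: dual_lattice_def max_order_zero)
  have adj: "adjoint D X \<in> T0 D" if X: "X \<in> T0 D" for X
  proof -
    have XE: "X \<in> End_K D" and XL: "\<And>v. v \<in> ?L \<Longrightarrow> X v \<in> ?L" and XM: "\<And>v. v \<in> ?M \<Longrightarrow> X v \<in> ?M"
      using X by (auto simp: T0_def)
    have "adjoint D X v \<in> ?M" if "v \<in> ?M" for v
      using that XL by (auto simp: dual_lattice_def adjoint_right[OF XE, symmetric])
    moreover have "adjoint D X v \<in> dual_lattice D ?M" if "v \<in> dual_lattice D ?M" for v
      unfolding dual_lattice_def[of D ?M]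
      using dual_lattice_D[OF that] XM by (auto simp: adjoint_right[OF XE, symmetric])
    ultimately show ?thesis
      unfolding T0_def bidual using adjoint_End_K[OF XE] by blast
  qed
  show ?thesis
    unfolding star_order_def
    by (auto simp: adj)
      (auto simp: T0_def End_K_add End_K_comp End_K_scale End_K_zero lat_closed M_add M_scale M_zero
        image_subset_iff)
qed

text \<open>The equation h o X = \<psi>_0(Z) between bilinear forms. In the quadratic case the forms
  themselves record only its diagonal.\<close>

definition quad_rel :: "('v \<Rightarrow> 'v) \<Rightarrow> ('v \<Rightarrow> 'v) \<Rightarrow> bool" where
  "quad_rel X Z \<longleftrightarrow> (\<forall>v w. h (X v) (X w) = h v (Z w) + h (Z v) w)"

text \<open>In the quadratic case this is polarization, \<open>2\<close> being invertible in \<open>F\<close>.\<close>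

lemma form_of_UNIV_eqD:
  assumes eq: "form_of D UNIV b = form_of D UNIV b'"
    and add: "\<And>v v' w. b (v + v') w = b v w + b v' w" "\<And>v w w'. b v (w + w') = b v w + b v w'"
      "\<And>v v' w. b' (v + v') w = b' v w + b' v' w" "\<And>v w w'. b' v (w + w') = b' v w + b' v w'"
    and sym: "\<And>v w. quadratic_case D \<Longrightarrow> b w v = b v w" "\<And>v w. quadratic_case D \<Longrightarrow> b' w v = b' v w"
  shows "b v w = (b' v w :: 'k)"
proof (cases "quadratic_case D")
  case True
  then have diag: "b v v = b' v v" for v
    using eq by (auto simp: form_of_def fun_eq_iff)
  have "b v w + b v w = b' v w + b' v w"
    using diag[of "v + w"] diag[of v] diag[of w] sym(1)[OF True, of v w] sym(2)[OF True, of v w]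
    by (simp add: add)
  then show ?thesis
    using emb_half[OF True, of "b v w"] emb_half[OF True, of "b' v w"] by (metis distrib_left)
next
  case False
  then show ?thesis using eq by (simp add: form_of_def fun_eq_iff)
qed

lemma form_add_form_of:
  "form_add W C (form_of D C b) (form_of D C b') = form_of D C (\<lambda>v w. b v w \<oplus>\<^bsub>W\<^esub> b' v w)"
  by (auto simp: form_of_def fun_eq_iff)

lemma phi0_form_of: "phi0 D X = form_of D UNIV (\<lambda>v w. h (X v) (X w))"
proof (cases "quadratic_case D")
  case True
  then obtain q where q: "herm D = Quadratic q" "quadratic_form D q" by (rule herm_quadratic)
  show ?thesis
    using True quadratic_value[OF True q] unfolding phi0_def form_of_def q(1) by simp
next
  case False
  show ?thesis
    unfolding phi0_def form_of_def using False by (subst herm_hermitian(1)[OF False]) simp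
qed

lemma h_sym_quadratic: "quadratic_case D \<Longrightarrow> h w v = h v w"
  by (subst h_sym) (simp add: quadratic_case_facts)

lemma phi0_eq_psi0_iff:
  assumes "X \<in> End_K D" "Z \<in> End_K D"
  shows "phi0 D X = psi0 D Z \<longleftrightarrow> quad_rel X Z"
proof
  assume "phi0 D X = psi0 D Z"
  then have eq: "form_of D UNIV (\<lambda>v w. h (X v) (X w)) = form_of D UNIV (\<lambda>v w. h v (Z w) + h (Z v) w)"
    by (simp add: phi0_form_of psi0_def)
  show "quad_rel X Z"
    unfolding quad_rel_def
    by (intro allI form_of_UNIV_eqD[OF eq])
      (simp_all add: End_K_D[OF assms(1)] End_K_D[OF assms(2)] h_add_left h_add_right
        h_sym_quadratic add.commute ac_simps)
next
  assume "quad_rel X Z"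
  then show "phi0 D X = psi0 D Z"
    by (simp add: phi0_form_of psi0_def quad_rel_def)
qed

lemma psi0_add:
  assumes "X \<in> End_K D" "Y \<in> End_K D"
  shows "form_add (alg_module D) UNIV (psi0 D X) (psi0 D Y) = psi0 D (\<lambda>v. X v + Y v)"
  unfolding psi0_def form_add_form_of
  by (simp add: h_add_left h_add_right ac_simps)

text \<open>\<psi>_0(T) is closed under sums and, as -1 lies in \<open>A\<close>, under negation; so
  its coset through h o X is \<psi>_0(T) itself exactly when h o X belongs to it.\<close>

lemma phibar_trivial_iff:
  assumes T: "star_order T" and X: "X \<in> End_K D"
  shows "phibar D T X = \<one>\<^bsub>H0_group D Mod (psi0 D ` T)\<^esub> \<longleftrightarrow> (\<exists>Z\<in>T. quad_rel X Z)"
proof -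
  note TE = star_orderD(1)[OF T]
  have coset: "phibar D T X = (\<lambda>Z. form_add (alg_module D) UNIV (psi0 D Z) (phi0 D X)) ` T"
    by (auto simp: phibar_def r_coset_def H0_group_def)
  have minus: "(\<lambda>v. - Z v) \<in> T" if "Z \<in> T" for Z
    using star_orderD(6)[OF T that, of "- 1"]
    by (simp add: emb_minus act_minus carrier_A val_ring_closed)
  have "phibar D T X = psi0 D ` T \<longleftrightarrow> (\<exists>Z\<in>T. phi0 D X = psi0 D Z)"
  proof
    assume eq: "phibar D T X = psi0 D ` T"
    have "form_add (alg_module D) UNIV (psi0 D (\<lambda>v. 0)) (phi0 D X) = phi0 D X"
      by (simp add: psi0_def phi0_form_of form_add_form_of)
    then have "phi0 D X \<in> psi0 D ` T"
      unfolding eq[symmetric] coset using star_orderD(3)[OF T] by force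
    then show "\<exists>Z\<in>T. phi0 D X = psi0 D Z" by blast
  next
    assume "\<exists>Z\<in>T. phi0 D X = psi0 D Z"
    then obtain Z where Z: "Z \<in> T" "phi0 D X = psi0 D Z" by blast
    have "phibar D T X = (\<lambda>W. psi0 D (\<lambda>v. W v + Z v)) ` T"
      unfolding coset Z(2) using psi0_add TE Z(1) by (intro image_cong) simp_all
    also have "\<dots> = psi0 D ` T"
    proof (intro equalityI subsetI)
      fix f assume "f \<in> psi0 D ` T"
      then obtain W where W: "W \<in> T" "f = psi0 D W" by blast
      have "(\<lambda>v. W v + - Z v) \<in> T"
        using star_orderD(4)[OF T W(1) minus[OF Z(1)]] .
      then show "f \<in> (\<lambda>W. psi0 D (\<lambda>v. W v + Z v)) ` T"
        using W(2) by (intro image_eqI[of _ _ "\<lambda>v. W v + - Z v"]) simp_all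
    qed (use star_orderD(4)[OF T _ Z(1)] in auto)
    finally show "phibar D T X = psi0 D ` T" .
  qed
  then show ?thesis
    using phi0_eq_psi0_iff[OF X] TE by auto
qed

text \<open>The witnesses are sought in \<open>T\<close> and not in the smaller set, so they may be
  built freely from products and adjoints. The defining condition is symmetric in \<open>X\<close>
  and its adjoint, whence stability under the adjoint.\<close>

lemma star_order_step:
  assumes T: "star_order T"
  shows "star_order {X \<in> T. (\<exists>Z\<in>T. quad_rel X Z) \<and> (\<exists>Z\<in>T. quad_rel (adjoint D X) Z)}"
proof -
  note TE = star_orderD(1)[OF T] and T_rules = star_orderD(3-)[OF T]
  let ?Q = "\<lambda>X. \<exists>Z\<in>T. quad_rel X Z"
  have add: "?Q (\<lambda>v. X v + Y v)" if X: "X \<in> T" "?Q X" and Y: "Y \<in> T" "?Q Y" for X Y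
  proof -
    obtain Z W where ZW: "Z \<in> T" "quad_rel X Z" "W \<in> T" "quad_rel Y W" using X Y by blast
    let ?V = "\<lambda>v. (Z v + W v) + adjoint D X (Y v)"
    have "?V \<in> T" by (rule T_rules(2)[OF T_rules(2)[OF ZW(1,3)] T_rules(3)[OF T_rules(5)[OF X(1)] Y(1)]])
    moreover have "h (X v) (Y w) = h v (adjoint D X (Y w))" "h (Y v) (X w) = h (adjoint D X (Y v)) w" for v w
      by (rule adjoint_left[OF TE[OF X(1)]], rule adjoint_right[OF TE[OF X(1)]])
    then have "quad_rel (\<lambda>v. X v + Y v) ?V"
      using ZW(2,4) by (simp add: quad_rel_def h_add_left h_add_right ac_simps)
    ultimately show ?thesis by blast
  qed
  \<comment> \<open>Only the left factor needs a witness, since h o (X Y) is the pullback of h o X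
    along \<open>Y\<close>.\<close>
  have comp: "?Q (\<lambda>v. X (Y v))" if XY: "X \<in> T" "Y \<in> T" "?Q X" for X Y
  proof -
    obtain Z where Z: "Z \<in> T" "quad_rel X Z" using XY by blast
    let ?V = "\<lambda>v. adjoint D Y (Z (Y v))"
    have "?V \<in> T" by (rule T_rules(3)[OF T_rules(5)[OF XY(2)] T_rules(3)[OF Z(1) XY(2)]])
    moreover have "quad_rel (\<lambda>v. X (Y v)) ?V"
      using Z(2) TE[OF XY(2)] by (simp add: quad_rel_def adjoint_left[symmetric] adjoint_right[symmetric])
    ultimately show ?thesis by blast
  qed
  have scale: "?Q (\<lambda>v. act D (X v) (emb D a))" if Xa: "X \<in> T" "?Q X" "a \<in> carrier A" for X a
  proof -
    obtain Z where Z: "Z \<in> T" "quad_rel X Z" using Xa by blast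
    \<comment> \<open>h o X is quadratic in \<open>X\<close>, so its witness is scaled by the square
      of \<open>a\<close>.\<close>
    let ?V = "\<lambda>v. act D (act D (Z v) (emb D a)) (emb D a)"
    have "?V \<in> T" by (rule T_rules(4)[OF T_rules(4)[OF Z(1) Xa(3)] Xa(3)])
    moreover have "quad_rel (\<lambda>v. act D (X v) (emb D a)) ?V"
      using Z(2) by (simp add: quad_rel_def h_act_left h_act_right distrib_left distrib_right emb_central)
    ultimately show ?thesis by blast
  qed
  have zero: "?Q (\<lambda>v. 0)"
    using T_rules(1) by (intro bexI[of _ "\<lambda>v. 0"]) (simp_all add: quad_rel_def)
  show ?thesis
    unfolding star_order_def
  proof (intro conjI ballI CollectI)
    show "{X \<in> T. ?Q X \<and> ?Q (adjoint D X)} \<subseteq> T0 D"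
      using T by (auto simp: star_order_def)
    show "(\<lambda>v. 0) \<in> T" "?Q (\<lambda>v. 0)" "?Q (adjoint D (\<lambda>v. 0))"
      using zero T_rules(1) by (simp_all add: adjoint_zero)
  next
    fix X assume X: "X \<in> {X \<in> T. ?Q X \<and> ?Q (adjoint D X)}"
    show "adjoint D X \<in> T" "?Q (adjoint D X)" "?Q (adjoint D (adjoint D X))"
      using X T_rules(5) by (simp_all add: adjoint_adjoint TE)
    show "(\<lambda>v. act D (X v) (emb D a)) \<in> T" "?Q (\<lambda>v. act D (X v) (emb D a))"
      "?Q (adjoint D (\<lambda>v. act D (X v) (emb D a)))" if "a \<in> carrier A" for a
      using X that scale[of X a] scale[of "adjoint D X" a] T_rules(4)[of X a] T_rules(5)[of X]
      by (simp_all add: adjoint_scale TE)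
    fix Y assume Y: "Y \<in> {X \<in> T. ?Q X \<and> ?Q (adjoint D X)}"
    show "(\<lambda>v. X v + Y v) \<in> T" "?Q (\<lambda>v. X v + Y v)" "?Q (adjoint D (\<lambda>v. X v + Y v))"
      using X Y add[of X Y] add[of "adjoint D X" "adjoint D Y"] T_rules(2)[of X Y] T_rules(5)
      by (simp_all add: adjoint_add TE)
    \<comment> \<open>The adjoint reverses products, so for the adjoint of X Y the left factor,
      whose witness is used, is the adjoint of \<open>Y\<close>.\<close>
    show "(\<lambda>v. X (Y v)) \<in> T" "?Q (\<lambda>v. X (Y v))" "?Q (adjoint D (\<lambda>v. X (Y v)))"
      using X Y comp[of X Y] comp[of "adjoint D Y" "adjoint D X"] T_rules(3)[of X Y] T_rules(5)
      by (simp_all add: adjoint_comp TE)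
  qed
qed

lemma Tm_Suc_eq:
  assumes "star_order (Tm D m)"
  shows "Tm D (Suc m) = {X \<in> Tm D m. (\<exists>Z\<in>Tm D m. quad_rel X Z) \<and> (\<exists>Z\<in>Tm D m. quad_rel (adjoint D X) Z)}"
  using phibar_trivial_iff[OF assms] star_orderD(1)[OF assms] adjoint_End_K by auto

lemma star_order_Tm: "star_order (Tm D m)"
proof (induct m)
  case 0
  then show ?case by (simp add: star_order_T0)
next
  case (Suc m)
  then show ?case
    using star_order_step[OF Suc] Tm_Suc_eq[OF Suc] by simp
qed

text \<open>At a stable index the next step of the recursion removes nothing, so its defining
  condition holds throughout. All later appeals to stability go through this fact.\<close>

lemma stable_quad_rel:
  assumes "is_stabilization_index D \<alpha>" "X \<in> Tm D \<alpha>"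
  shows "\<exists>Z\<in>Tm D \<alpha>. quad_rel X Z"
proof -
  have "Tm D (Suc \<alpha>) = Tm D \<alpha>"
    using assms(1) unfolding is_stabilization_index_def by (meson le_Suc_eq order_refl)
  with assms(2) show ?thesis
    using Tm_Suc_eq[OF star_order_Tm, of \<alpha>] by auto
qed

end

section \<open>Extension of scalars\<close>

declare base_change_simps [simp del] tensor_algebra_simps [simp del]

locale hermitian_space_over = hermitian_space D n + R: algebra "base_ring D" R
  for D :: "('f::field, 'k::ring_1, 'v::ab_group_add) lattice_data" and n :: nat
    and R :: "('f, 'r) module"
begin

sublocale L: base_change_module "base_ring D" "lat_module D" R
  by (intro base_change_module.intro module_lat R.algebra_axioms)

sublocale K: base_change_module "base_ring D" "alg_module D" R
  by (intro base_change_module.intro module_alg R.algebra_axioms)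

sublocale LR: module R "base_change (base_ring D) (lat_module D) R"
  by (rule L.module_base_change)

sublocale KR: module R "base_change (base_ring D) (alg_module D) R"
  by (rule K.module_base_change)

abbreviation "C \<equiv> carrier (lat_R D R)"
abbreviation "E \<equiv> endo_R D R"
abbreviation "H \<equiv> bilinear_R D R"

lemma lat_R_eq: "lat_R D R = L.B" and alg_R_eq: "alg_R D R = K.B"
  by (simp_all add: lat_R_def alg_R_def)

definition biadditive :: "(('v \<times> 'r) frag set \<Rightarrow> ('v \<times> 'r) frag set \<Rightarrow> ('k \<times> 'r) frag set) \<Rightarrow> bool" where
  "biadditive f \<longleftrightarrow>
     (\<forall>t\<in>carrier L.B. \<forall>t'\<in>carrier L.B. f t t' \<in> carrier K.B) \<and>
     (\<forall>t\<in>carrier L.B. \<forall>s\<in>carrier L.B. \<forall>t'\<in>carrier L.B. f (t \<oplus>\<^bsub>L.B\<^esub> s) t' = f t t' \<oplus>\<^bsub>K.B\<^esub> f s t') \<and>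
     (\<forall>t\<in>carrier L.B. \<forall>s\<in>carrier L.B. \<forall>t'\<in>carrier L.B. f t' (t \<oplus>\<^bsub>L.B\<^esub> s) = f t' t \<oplus>\<^bsub>K.B\<^esub> f t' s)"

text \<open>Identities for \<open>h\<close> on L pass to L \<otimes> R by this rule: both sides are
  biadditive, and on pure tensors they reduce to the identity over \<open>A\<close>.\<close>

lemma biadditive_eqI:
  assumes "biadditive f" "biadditive g"
    and pure: "\<And>x r y s. x \<in> lat D \<Longrightarrow> r \<in> carrier R \<Longrightarrow> y \<in> lat D \<Longrightarrow> s \<in> carrier R \<Longrightarrow>
      f (L.B.pure x r) (L.B.pure y s) = g (L.B.pure x r) (L.B.pure y s)"
    and "t \<in> carrier L.B" "t' \<in> carrier L.B"
  shows "f t t' = g t t'"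
  using assms(4)
proof (induct rule: L.B.T_induct)
  case (pure x r)
  note xr = pure(1,2)
  from assms(5) show ?case
  proof (induct rule: L.B.T_induct)
    case (pure y s)
    then show ?case using assms(3) xr by simp
  next
    case (add t s)
    then show ?case using assms(1,2) L.B.pure_closed[OF xr] by (simp add: biadditive_def)
  qed
next
  case (add t s)
  then show ?case using assms(1,2,5) by (simp add: biadditive_def)
qed

lemma
  assumes "f \<in> linear_maps R L.B L.B" "g \<in> linear_maps R L.B L.B"
  shows biadditive_compose: "biadditive b \<Longrightarrow> biadditive (\<lambda>t t'. b (f t) (g t'))"
  using linear_mapsD[OF assms(1)] linear_mapsD[OF assms(2)] by (simp add: biadditive_def)

lemma biadditive_add: "biadditive b \<Longrightarrow> biadditive b' \<Longrightarrow> biadditive (\<lambda>t t'. b t t' \<oplus>\<^bsub>K.B\<^esub> b' t t')"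
  by (simp add: biadditive_def K.B.T.a_ac)

text \<open>The iterated lift computes the values because \<open>h\<close> is balanced over
  \<open>A\<close> in each argument; in the first argument this rests on \<sigma> fixing F.\<close>

lemma H_rules:
  shows H_closed: "t \<in> carrier L.B \<Longrightarrow> t' \<in> carrier L.B \<Longrightarrow> H t t' \<in> carrier K.B"
    and H_add_left: "t \<in> carrier L.B \<Longrightarrow> s \<in> carrier L.B \<Longrightarrow> t' \<in> carrier L.B \<Longrightarrow>
          H (t \<oplus>\<^bsub>L.B\<^esub> s) t' = H t t' \<oplus>\<^bsub>K.B\<^esub> H s t'"
    and H_add_right: "t \<in> carrier L.B \<Longrightarrow> t' \<in> carrier L.B \<Longrightarrow> s' \<in> carrier L.B \<Longrightarrow>
          H t (t' \<oplus>\<^bsub>L.B\<^esub> s') = H t t' \<oplus>\<^bsub>K.B\<^esub> H t s'"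
    and H_pure: "x \<in> lat D \<Longrightarrow> r \<in> carrier R \<Longrightarrow> y \<in> lat D \<Longrightarrow> r' \<in> carrier R \<Longrightarrow>
          H (L.B.pure x r) (L.B.pure y r') = K.B.pure (h x y) (r \<otimes>\<^bsub>R\<^esub> r')"
proof -
  have right: "balanced A (lat_module D) R K.B (\<lambda>y s. K.B.pure (h x y) (r \<otimes>\<^bsub>R\<^esub> s))"
    if "x \<in> carrier (lat_module D)" "r \<in> carrier R" for x r
  proof (rule balancedI)
    fix a y s assume "a \<in> carrier A" "y \<in> carrier (lat_module D)" "s \<in> carrier R"
    then show "K.B.pure (h x (a \<odot>\<^bsub>lat_module D\<^esub> y)) (r \<otimes>\<^bsub>R\<^esub> s) = K.B.pure (h x y) (r \<otimes>\<^bsub>R\<^esub> (a \<odot>\<^bsub>R\<^esub> s))"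
      using that K.B.pure_smult[of a "h x y" "r \<otimes>\<^bsub>R\<^esub> s"]
      by (simp add: h_act_right emb_central[symmetric] R.m_comm[of r] R.smult_assoc2 del: emb)
  qed (use that K.B.pure_add_left[of "h x _" "h x _"] in
      \<open>simp_all add: h_add_right R.r_distr K.B.pure_add_right\<close>)
  have left: "balanced A (lat_module D) R K.B (\<lambda>x r. K.B.pure (h x y) (r \<otimes>\<^bsub>R\<^esub> s))"
    if "y \<in> carrier (lat_module D)" "s \<in> carrier R" for y s
  proof (rule balancedI)
    fix a x r assume "a \<in> carrier A" "x \<in> carrier (lat_module D)" "r \<in> carrier R"
    then show "K.B.pure (h (a \<odot>\<^bsub>lat_module D\<^esub> x) y) (r \<otimes>\<^bsub>R\<^esub> s) = K.B.pure (h x y) ((a \<odot>\<^bsub>R\<^esub> r) \<otimes>\<^bsub>R\<^esub> s)"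
      using that K.B.pure_smult[of a "h x y" "r \<otimes>\<^bsub>R\<^esub> s"]
      by (simp add: h_act_left R.smult_assoc2 del: emb)
  qed (use that K.B.pure_add_left[of "h _ y" "h _ y"] in
      \<open>simp_all add: h_add_left R.l_distr K.B.pure_add_right\<close>)
  have G: "carrier (add_monoid (alg_R D R)) = carrier K.B" "monoid.mult (add_monoid (alg_R D R)) = add K.B"
    by (simp_all add: alg_R_eq)
  note rules = tensor_lift2_properties[OF L.B.tensor_product_axioms L.B.tensor_product_axioms
      K.B.abelian_group_T right left G, folded bilinear_R_def]
  show "t \<in> carrier L.B \<Longrightarrow> t' \<in> carrier L.B \<Longrightarrow> H t t' \<in> carrier K.B"
    "t \<in> carrier L.B \<Longrightarrow> s \<in> carrier L.B \<Longrightarrow> t' \<in> carrier L.B \<Longrightarrow>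
          H (t \<oplus>\<^bsub>L.B\<^esub> s) t' = H t t' \<oplus>\<^bsub>K.B\<^esub> H s t'"
    "t \<in> carrier L.B \<Longrightarrow> t' \<in> carrier L.B \<Longrightarrow> s' \<in> carrier L.B \<Longrightarrow>
          H t (t' \<oplus>\<^bsub>L.B\<^esub> s') = H t t' \<oplus>\<^bsub>K.B\<^esub> H t s'"
    by (rule rules; assumption)+
  show "x \<in> lat D \<Longrightarrow> r \<in> carrier R \<Longrightarrow> y \<in> lat D \<Longrightarrow> r' \<in> carrier R \<Longrightarrow>
          H (L.B.pure x r) (L.B.pure y r') = K.B.pure (h x y) (r \<otimes>\<^bsub>R\<^esub> r')"
    by (rule rules(4)) simp_all
qed

lemma biadditive_H: "biadditive H"
  by (simp add: biadditive_def H_rules)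

lemma smult_linear_map_R: "r \<in> carrier R \<Longrightarrow> (\<lambda>t. r \<odot>\<^bsub>L.B\<^esub> t) \<in> linear_maps R L.B L.B"
  by (rule LR.smult_linear_map)

text \<open>\<open>H\<close> is bilinear over \<open>R\<close> and not sesquilinear, because the
  involution acts on K alone and \<open>R\<close> is commutative.\<close>

lemma
  assumes r: "r \<in> carrier R" and t: "t \<in> carrier L.B" "t' \<in> carrier L.B"
  shows H_smult_left: "H (r \<odot>\<^bsub>L.B\<^esub> t) t' = r \<odot>\<^bsub>K.B\<^esub> H t t'"
    and H_smult_right: "H t (r \<odot>\<^bsub>L.B\<^esub> t') = r \<odot>\<^bsub>K.B\<^esub> H t t'"
proof -
  have smult: "biadditive (\<lambda>t t'. r \<odot>\<^bsub>K.B\<^esub> H t t')"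
    using biadditive_H r by (simp add: biadditive_def KR.smult_r_distr)
  show "H (r \<odot>\<^bsub>L.B\<^esub> t) t' = r \<odot>\<^bsub>K.B\<^esub> H t t'"
    by (rule biadditive_eqI[OF biadditive_compose[OF smult_linear_map_R[OF r] id_linear_map biadditive_H] smult _ t])
      (use r in \<open>simp add: L.smult_pure K.smult_pure H_pure R.m_assoc\<close>)
  show "H t (r \<odot>\<^bsub>L.B\<^esub> t') = r \<odot>\<^bsub>K.B\<^esub> H t t'"
    by (rule biadditive_eqI[OF biadditive_compose[OF id_linear_map smult_linear_map_R[OF r] biadditive_H] smult _ t])
      (use r in \<open>simp add: L.smult_pure K.smult_pure H_pure R.m_lcomm\<close>)
qed

lemma H_sym:
  assumes "quadratic_case D" "t \<in> carrier L.B" "t' \<in> carrier L.B"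
  shows "H t' t = H t t'"
proof -
  have "biadditive (\<lambda>t t'. H t' t)"
    using biadditive_H by (simp add: biadditive_def)
  from biadditive_eqI[OF this biadditive_H _ assms(2,3)] show ?thesis
    by (simp add: H_pure h_sym_quadratic[OF assms(1)] R.m_comm)
qed

lemma Tm_linear_maps: "X \<in> Tm D m \<Longrightarrow> X \<in> linear_maps A (lat_module D) (lat_module D)"
  using star_orderD(1,2)[OF star_order_Tm, of X m]
  by (auto simp: linear_maps_def hom_def End_K_D)

lemma
  assumes X: "X \<in> Tm D m"
  shows E_pure: "x \<in> lat D \<Longrightarrow> r \<in> carrier R \<Longrightarrow> E X (L.B.pure x r) = L.B.pure (X x) r"
    and E_linear: "E X \<in> linear_maps R L.B L.B"
proof -
  note X' = Tm_linear_maps[OF X]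
  note T = L.B.tensor_product_axioms
  note E = tensor_map_pure[OF T T X' id_linear_map, folded endo_R_def]
    tensor_map_closed[OF T T X' id_linear_map, folded endo_R_def]
    tensor_map_add[OF T T X' id_linear_map, folded endo_R_def]
  show pure: "x \<in> lat D \<Longrightarrow> r \<in> carrier R \<Longrightarrow> E X (L.B.pure x r) = L.B.pure (X x) r" for x r
    by (simp add: E)
  have "E X (r \<odot>\<^bsub>L.B\<^esub> t) = r \<odot>\<^bsub>L.B\<^esub> E X t" if r: "r \<in> carrier R" and t: "t \<in> carrier L.B" for r t
    using t
  proof (induct rule: L.B.T_induct)
    case (pure x s)
    then show ?case
      using r linear_mapsD(1)[OF X', of x] by (simp add: L.smult_pure E)
  next
    case (add t t')
    then show ?case using r by (simp add: LR.smult_r_distr E)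
  qed
  then show "E X \<in> linear_maps R L.B L.B"
    by (simp add: linear_maps_def hom_def E)
qed

lemma L_hom_eqI:
  assumes "f \<in> linear_maps R L.B L.B" "g \<in> linear_maps R L.B L.B"
    and "\<And>x r. x \<in> lat D \<Longrightarrow> r \<in> carrier R \<Longrightarrow> f (L.B.pure x r) = g (L.B.pure x r)"
    and "t \<in> carrier L.B"
  shows "f t = g t"
  using assms(4)
  by (induct rule: L.B.T_induct) (use assms(1-3) in \<open>simp_all add: linear_mapsD\<close>)

lemma linear_maps_comp:
  assumes "f \<in> linear_maps R L.B L.B" "g \<in> linear_maps R L.B L.B"
  shows "(\<lambda>t. f (g t)) \<in> linear_maps R L.B L.B"
  using linear_mapsD[OF assms(1)] linear_mapsD[OF assms(2)] by (simp add: linear_maps_def hom_def)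

lemma linear_maps_add:
  assumes "f \<in> linear_maps R L.B L.B" "g \<in> linear_maps R L.B L.B"
  shows "(\<lambda>t. f t \<oplus>\<^bsub>L.B\<^esub> g t) \<in> linear_maps R L.B L.B"
  using linear_mapsD[OF assms(1)] linear_mapsD[OF assms(2)]
  by (simp add: linear_maps_def hom_def L.B.T.a_ac LR.smult_r_distr)

lemma linear_maps_restrict:
  "f \<in> linear_maps R L.B L.B \<Longrightarrow> (\<lambda>t\<in>carrier L.B. f t) \<in> linear_maps R L.B L.B"
  by (auto simp: linear_maps_def hom_def)

lemma E_comp:
  assumes "X \<in> Tm D m" "Y \<in> Tm D m" "t \<in> carrier L.B"
  shows "E (\<lambda>v. X (Y v)) t = E X (E Y t)"
proof -
  have XY: "(\<lambda>v. X (Y v)) \<in> Tm D m" using star_orderD(5)[OF star_order_Tm assms(1,2)] .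
  show ?thesis
    by (rule L_hom_eqI[OF E_linear[OF XY] linear_maps_comp[OF E_linear[OF assms(1)] E_linear[OF assms(2)]] _ assms(3)])
      (simp add: E_pure[OF XY] E_pure[OF assms(1)] E_pure[OF assms(2)] star_orderD(2)[OF star_order_Tm assms(2)])
qed

lemma
  assumes X: "X \<in> Tm D m" and t: "t \<in> carrier L.B" "t' \<in> carrier L.B"
  shows H_E_adjoint_left: "H (E X t) t' = H t (E (adjoint D X) t')"
    and H_E_adjoint_right: "H t (E X t') = H (E (adjoint D X) t) t'"
proof -
  have X': "adjoint D X \<in> Tm D m" by (rule star_orderD(7)[OF star_order_Tm X])
  have XE: "X \<in> End_K D" by (rule star_orderD(1)[OF star_order_Tm X])
  note lat = star_orderD(2)[OF star_order_Tm X] star_orderD(2)[OF star_order_Tm X']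
  note bi = biadditive_compose[OF E_linear[OF X] id_linear_map biadditive_H]
    biadditive_compose[OF id_linear_map E_linear[OF X] biadditive_H]
    biadditive_compose[OF E_linear[OF X'] id_linear_map biadditive_H]
    biadditive_compose[OF id_linear_map E_linear[OF X'] biadditive_H]
  show "H (E X t) t' = H t (E (adjoint D X) t')"
    by (rule biadditive_eqI[OF bi(1) bi(4) _ t])
      (simp add: E_pure[OF X] E_pure[OF X'] lat H_pure adjoint_left[OF XE])
  show "H t (E X t') = H (E (adjoint D X) t) t'"
    by (rule biadditive_eqI[OF bi(2) bi(3) _ t])
      (simp add: E_pure[OF X] E_pure[OF X'] lat H_pure adjoint_right[OF XE])
qed

lemma H_E_quad:
  assumes X: "X \<in> Tm D m" and Z: "Z \<in> Tm D m" and XZ: "quad_rel X Z"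
    and t: "t \<in> carrier L.B" "t' \<in> carrier L.B"
  shows "H (E X t) (E X t') = H t (E Z t') \<oplus>\<^bsub>K.B\<^esub> H (E Z t) t'"
proof -
  note lat = star_orderD(2)[OF star_order_Tm X] star_orderD(2)[OF star_order_Tm Z]
  note bi = biadditive_compose[OF E_linear[OF X] E_linear[OF X] biadditive_H]
    biadditive_add[OF biadditive_compose[OF id_linear_map E_linear[OF Z] biadditive_H]
      biadditive_compose[OF E_linear[OF Z] id_linear_map biadditive_H]]
  have "K.B.pure (c + d) r = K.B.pure c r \<oplus>\<^bsub>K.B\<^esub> K.B.pure d r" if "r \<in> carrier R" for c d r
    using K.B.pure_add_left[of c d r] that by simp
  then show ?thesis
    by (intro biadditive_eqI[OF bi _ t])
      (use XZ in \<open>simp add: E_pure[OF X] E_pure[OF Z] lat H_pure quad_rel_def\<close>)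
qed

end

section \<open>The R-span of T^m(A): sums, products, adjoints and the relation h o U =
  \<psi>(Z)\<close>

context hermitian_space_over begin

lemma Tm_R_zero: "(\<lambda>t\<in>carrier L.B. \<zero>\<^bsub>L.B\<^esub>) \<in> Tm_R D m R"
  unfolding Tm_R_def lat_R_eq
  by (rule CollectI, rule exI[of _ 0]) (simp add: L.B.T.finsum_empty)

lemma Tm_R_step:
  assumes U: "U \<in> Tm_R D m R" and r: "r \<in> carrier R" and X: "X \<in> Tm D m"
  shows "(\<lambda>t\<in>carrier L.B. U t \<oplus>\<^bsub>L.B\<^esub> r \<odot>\<^bsub>L.B\<^esub> E X t) \<in> Tm_R D m R"
proof -
  obtain k c Y where U_eq: "U = (\<lambda>t\<in>carrier L.B. \<Oplus>\<^bsub>L.B\<^esub>i\<in>{..<k::nat}. c i \<odot>\<^bsub>L.B\<^esub> E (Y i) t)"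
    and cY: "\<forall>i<k. c i \<in> carrier R \<and> Y i \<in> Tm D m"
    using U unfolding Tm_R_def lat_R_eq by blast
  let ?c = "c(k := r)" and ?Y = "Y(k := X)"
  have cY': "\<forall>i<Suc k. ?c i \<in> carrier R \<and> ?Y i \<in> Tm D m"
    using cY r X by (auto simp: less_Suc_eq)
  have closed: "c \<odot>\<^bsub>L.B\<^esub> E Y t \<in> carrier L.B"
    if "c \<in> carrier R" "Y \<in> Tm D m" "t \<in> carrier L.B" for c Y t
    using that linear_mapsD(1)[OF E_linear] by auto
  have "(\<lambda>t\<in>carrier L.B. U t \<oplus>\<^bsub>L.B\<^esub> r \<odot>\<^bsub>L.B\<^esub> E X t) =
      (\<lambda>t\<in>carrier L.B. \<Oplus>\<^bsub>L.B\<^esub>i\<in>{..<Suc k}. ?c i \<odot>\<^bsub>L.B\<^esub> E (?Y i) t)"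
  proof (rule restrict_ext)
    fix t assume t: "t \<in> carrier L.B"
    have "(\<Oplus>\<^bsub>L.B\<^esub>i\<in>insert k {..<k}. ?c i \<odot>\<^bsub>L.B\<^esub> E (?Y i) t) =
        ?c k \<odot>\<^bsub>L.B\<^esub> E (?Y k) t \<oplus>\<^bsub>L.B\<^esub> (\<Oplus>\<^bsub>L.B\<^esub>i\<in>{..<k}. ?c i \<odot>\<^bsub>L.B\<^esub> E (?Y i) t)"
      using cY r X t by (intro L.B.T.finsum_insert) (auto intro!: closed)
    also have "(\<Oplus>\<^bsub>L.B\<^esub>i\<in>{..<k}. ?c i \<odot>\<^bsub>L.B\<^esub> E (?Y i) t) = U t"
      unfolding U_eq using cY t by (simp, intro L.B.T.finsum_cong') (auto intro!: closed)
    finally show "U t \<oplus>\<^bsub>L.B\<^esub> r \<odot>\<^bsub>L.B\<^esub> E X t =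
        (\<Oplus>\<^bsub>L.B\<^esub>i\<in>{..<Suc k}. ?c i \<odot>\<^bsub>L.B\<^esub> E (?Y i) t)"
      using closed[OF r X t] cY t
      by (simp add: lessThan_Suc U_eq L.B.T.a_comm L.B.T.finsum_closed closed Pi_iff)
  qed
  then show ?thesis
    unfolding Tm_R_def lat_R_eq using cY' by (intro CollectI exI[of _ "Suc k"] exI[of _ ?c] exI[of _ ?Y]) simp
qed

text \<open>Finite sums are built up one term at a time; linearity of the partial sum is proved
  alongside and handed to the step.\<close>

lemma Tm_R_induct [consumes 1, case_names zero step]:
  assumes "U \<in> Tm_R D m R"
    and zero: "P (\<lambda>t\<in>carrier L.B. \<zero>\<^bsub>L.B\<^esub>)"
    and step: "\<And>U r X. U \<in> Tm_R D m R \<Longrightarrow> U \<in> linear_maps R L.B L.B \<Longrightarrow> P U \<Longrightarrow> r \<in> carrier R \<Longrightarrow>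
      X \<in> Tm D m \<Longrightarrow> P (\<lambda>t\<in>carrier L.B. U t \<oplus>\<^bsub>L.B\<^esub> r \<odot>\<^bsub>L.B\<^esub> E X t)"
  shows "P U"
proof -
  let ?S = "\<lambda>k c Y. (\<lambda>t\<in>carrier L.B. \<Oplus>\<^bsub>L.B\<^esub>i\<in>{..<k::nat}. c i \<odot>\<^bsub>L.B\<^esub> E (Y i) t)"
  obtain k c Y where U_eq: "U = ?S k c Y"
    and cY: "\<forall>i<k. c i \<in> carrier R \<and> Y i \<in> Tm D m"
    using assms(1) unfolding Tm_R_def lat_R_eq by blast
  have closed: "c \<odot>\<^bsub>L.B\<^esub> E Y t \<in> carrier L.B"
    if "c \<in> carrier R" "Y \<in> Tm D m" "t \<in> carrier L.B" for c Y t
    using that linear_mapsD(1)[OF E_linear] by auto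
  have "P (?S k c Y) \<and> ?S k c Y \<in> linear_maps R L.B L.B"
    using cY
  proof (induct k)
    case 0
    have "(\<lambda>t\<in>carrier L.B. \<zero>\<^bsub>L.B\<^esub>) \<in> linear_maps R L.B L.B"
      by (auto simp: linear_maps_def hom_def)
    then show ?case
      using zero by (simp only: lessThan_0 L.B.T.finsum_empty simp_thms)
  next
    case (Suc k)
    have mem: "?S k c Y \<in> Tm_R D m R"
      unfolding Tm_R_def lat_R_eq using Suc.prems by (intro CollectI exI[of _ k] exI[of _ c] exI[of _ Y]) simp
    have eq: "?S (Suc k) c Y = (\<lambda>t\<in>carrier L.B. ?S k c Y t \<oplus>\<^bsub>L.B\<^esub> c k \<odot>\<^bsub>L.B\<^esub> E (Y k) t)"
    proof (rule restrict_ext)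
      fix t assume t: "t \<in> carrier L.B"
      have "(\<Oplus>\<^bsub>L.B\<^esub>i\<in>insert k {..<k}. c i \<odot>\<^bsub>L.B\<^esub> E (Y i) t) =
          c k \<odot>\<^bsub>L.B\<^esub> E (Y k) t \<oplus>\<^bsub>L.B\<^esub> (\<Oplus>\<^bsub>L.B\<^esub>i\<in>{..<k}. c i \<odot>\<^bsub>L.B\<^esub> E (Y i) t)"
        using Suc.prems t by (intro L.B.T.finsum_insert) (auto intro!: closed)
      then show "(\<Oplus>\<^bsub>L.B\<^esub>i\<in>{..<Suc k}. c i \<odot>\<^bsub>L.B\<^esub> E (Y i) t) = ?S k c Y t \<oplus>\<^bsub>L.B\<^esub> c k \<odot>\<^bsub>L.B\<^esub> E (Y k) t"
        using Suc.prems t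
        by (simp add: lessThan_Suc L.B.T.a_comm L.B.T.finsum_closed closed Pi_iff)
    qed
    have "\<forall>i<k. c i \<in> carrier R \<and> Y i \<in> Tm D m" and ck: "c k \<in> carrier R" "Y k \<in> Tm D m"
      using Suc.prems by simp_all
    note IH = conjunct1[OF Suc.hyps[OF this(1)]] conjunct2[OF Suc.hyps[OF this(1)]]
    show ?case
      unfolding eq
      using step[OF mem IH(2,1) ck]
        linear_maps_restrict[OF linear_maps_add[OF IH(2)
          linear_maps_comp[OF smult_linear_map_R[OF ck(1)] E_linear[OF ck(2)]]]]
      by blast
  qed
  then show ?thesis unfolding U_eq ..
qed

lemma Tm_R_linear: "U \<in> Tm_R D m R \<Longrightarrow> U \<in> linear_maps R L.B L.B"
proof (induct rule: Tm_R_induct)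
  case zero
  show ?case by (auto simp: linear_maps_def hom_def)
next
  case (step U r X)
  then show ?case
    by (intro linear_maps_restrict linear_maps_add linear_maps_comp[OF smult_linear_map_R E_linear])
qed

lemma Tm_R_closed: "U \<in> Tm_R D m R \<Longrightarrow> t \<in> carrier L.B \<Longrightarrow> U t \<in> carrier L.B"
  using linear_mapsD(1)[OF Tm_R_linear] .

lemma E_closed: "X \<in> Tm D m \<Longrightarrow> t \<in> carrier L.B \<Longrightarrow> E X t \<in> carrier L.B"
  using linear_mapsD(1)[OF E_linear] .

lemma Tm_R_extensional: "U \<in> Tm_R D m R \<Longrightarrow> U \<in> extensional (carrier L.B)"
  unfolding Tm_R_def lat_R_eq by auto

lemma Tm_R_add:
  assumes U: "U \<in> Tm_R D m R" and V: "V \<in> Tm_R D m R"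
  shows "(\<lambda>t\<in>carrier L.B. U t \<oplus>\<^bsub>L.B\<^esub> V t) \<in> Tm_R D m R"
  using V
proof (induct rule: Tm_R_induct)
  case zero
  have "(\<lambda>t\<in>carrier L.B. U t \<oplus>\<^bsub>L.B\<^esub> (\<lambda>t\<in>carrier L.B. \<zero>\<^bsub>L.B\<^esub>) t) = U"
    using Tm_R_extensional[OF U] by (intro extensionalityI[of _ "carrier L.B"]) (simp_all add: Tm_R_closed[OF U])
  then show ?case using U by (simp only:)
next
  case (step V r X)
  have "(\<lambda>t\<in>carrier L.B. U t \<oplus>\<^bsub>L.B\<^esub> (\<lambda>t\<in>carrier L.B. V t \<oplus>\<^bsub>L.B\<^esub> r \<odot>\<^bsub>L.B\<^esub> E X t) t) =
      (\<lambda>t\<in>carrier L.B. (\<lambda>t\<in>carrier L.B. U t \<oplus>\<^bsub>L.B\<^esub> V t) t \<oplus>\<^bsub>L.B\<^esub> r \<odot>\<^bsub>L.B\<^esub> E X t)"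
    using step U by (intro restrict_ext) (simp add: Tm_R_closed E_closed L.B.T.a_assoc)
  then show ?case
    using Tm_R_step[OF step(3,4,5)] by (simp only:)
qed

lemma Tm_R_single:
  assumes "r \<in> carrier R" "X \<in> Tm D m"
  shows "(\<lambda>t\<in>carrier L.B. r \<odot>\<^bsub>L.B\<^esub> E X t) \<in> Tm_R D m R"
proof -
  have "(\<lambda>t\<in>carrier L.B. (\<lambda>t\<in>carrier L.B. \<zero>\<^bsub>L.B\<^esub>) t \<oplus>\<^bsub>L.B\<^esub> r \<odot>\<^bsub>L.B\<^esub> E X t) = (\<lambda>t\<in>carrier L.B. r \<odot>\<^bsub>L.B\<^esub> E X t)"
    using assms by (intro restrict_ext) (simp add: E_closed)
  then show ?thesis
    using Tm_R_step[OF Tm_R_zero assms] by (simp only:)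
qed

lemma Tm_R_E_comp:
  assumes r: "r \<in> carrier R" and X: "X \<in> Tm D m" and V: "V \<in> Tm_R D m R"
  shows "(\<lambda>t\<in>carrier L.B. r \<odot>\<^bsub>L.B\<^esub> E X (V t)) \<in> Tm_R D m R"
  using V
proof (induct rule: Tm_R_induct)
  case zero
  have "E X \<zero>\<^bsub>L.B\<^esub> = \<zero>\<^bsub>L.B\<^esub>"
    using linear_mapsD(2)[OF E_linear[OF X], of "\<zero>\<^bsub>L.B\<^esub>" "\<zero>\<^bsub>L.B\<^esub>"] E_closed[OF X, of "\<zero>\<^bsub>L.B\<^esub>"] by simp
  then have "(\<lambda>t\<in>carrier L.B. r \<odot>\<^bsub>L.B\<^esub> E X ((\<lambda>t\<in>carrier L.B. \<zero>\<^bsub>L.B\<^esub>) t)) = (\<lambda>t\<in>carrier L.B. \<zero>\<^bsub>L.B\<^esub>)"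
    using r by (intro restrict_ext) simp
  then show ?case using Tm_R_zero by (simp only:)
next
  case (step V s Y)
  have XY: "(\<lambda>v. X (Y v)) \<in> Tm D m"
    by (rule star_orderD(5)[OF star_order_Tm X step(5)])
  have "(\<lambda>t\<in>carrier L.B. r \<odot>\<^bsub>L.B\<^esub> E X ((\<lambda>t\<in>carrier L.B. V t \<oplus>\<^bsub>L.B\<^esub> s \<odot>\<^bsub>L.B\<^esub> E Y t) t)) =
      (\<lambda>t\<in>carrier L.B. (\<lambda>t\<in>carrier L.B. r \<odot>\<^bsub>L.B\<^esub> E X (V t)) t \<oplus>\<^bsub>L.B\<^esub> (r \<otimes>\<^bsub>R\<^esub> s) \<odot>\<^bsub>L.B\<^esub> E (\<lambda>v. X (Y v)) t)"
    using step r X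
    by (intro restrict_ext)
      (simp add: Tm_R_closed E_closed linear_mapsD(2,3)[OF E_linear[OF X]] LR.smult_r_distr
        LR.smult_assoc1 E_comp[OF X step(5)])
  then show ?case
    using Tm_R_step[OF step(3) R.m_closed[OF r step(4)] XY] by (simp only:)
qed

lemma Tm_R_comp:
  assumes U: "U \<in> Tm_R D m R" and V: "V \<in> Tm_R D m R"
  shows "(\<lambda>t\<in>carrier L.B. U (V t)) \<in> Tm_R D m R"
  using U
proof (induct rule: Tm_R_induct)
  case zero
  have "(\<lambda>t\<in>carrier L.B. (\<lambda>t\<in>carrier L.B. \<zero>\<^bsub>L.B\<^esub>) (V t)) = (\<lambda>t\<in>carrier L.B. \<zero>\<^bsub>L.B\<^esub>)"
    using V by (intro restrict_ext) (simp add: Tm_R_closed)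
  then show ?case using Tm_R_zero by (simp only:)
next
  case (step U r X)
  have "(\<lambda>t\<in>carrier L.B. (\<lambda>t\<in>carrier L.B. U t \<oplus>\<^bsub>L.B\<^esub> r \<odot>\<^bsub>L.B\<^esub> E X t) (V t)) =
      (\<lambda>t\<in>carrier L.B. (\<lambda>t\<in>carrier L.B. U (V t)) t \<oplus>\<^bsub>L.B\<^esub> (\<lambda>t\<in>carrier L.B. r \<odot>\<^bsub>L.B\<^esub> E X (V t)) t)"
    using V by (intro restrict_ext) (simp add: Tm_R_closed)
  then show ?case
    using Tm_R_add[OF step(3) Tm_R_E_comp[OF step(4,5) V]] by (simp only:)
qed

text \<open>\<open>H\<close> is bilinear over \<open>R\<close>, so an adjoint is obtained term by
  term, with the same coefficients and the adjoints of the endomorphisms.\<close>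

lemma Tm_R_adjoint:
  assumes U: "U \<in> Tm_R D m R"
  shows "\<exists>U'\<in>Tm_R D m R. \<forall>t\<in>carrier L.B. \<forall>t'\<in>carrier L.B.
    H (U t) t' = H t (U' t') \<and> H t (U t') = H (U' t) t'"
  using U
proof (induct rule: Tm_R_induct)
  case zero
  have "H \<zero>\<^bsub>L.B\<^esub> t = \<zero>\<^bsub>K.B\<^esub>" "H t \<zero>\<^bsub>L.B\<^esub> = \<zero>\<^bsub>K.B\<^esub>" if "t \<in> carrier L.B" for t
    using H_add_left[of "\<zero>\<^bsub>L.B\<^esub>" "\<zero>\<^bsub>L.B\<^esub>" t] H_add_right[of t "\<zero>\<^bsub>L.B\<^esub>" "\<zero>\<^bsub>L.B\<^esub>"] that H_closed[of "\<zero>\<^bsub>L.B\<^esub>" t]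
      H_closed[of t "\<zero>\<^bsub>L.B\<^esub>"] by simp_all
  then show ?case
    by (intro bexI[OF _ Tm_R_zero]) simp
next
  case (step U r X)
  then obtain U' where U': "U' \<in> Tm_R D m R"
    "\<And>t t'. t \<in> carrier L.B \<Longrightarrow> t' \<in> carrier L.B \<Longrightarrow> H (U t) t' = H t (U' t') \<and> H t (U t') = H (U' t) t'"
    by blast
  have X': "adjoint D X \<in> Tm D m" by (rule star_orderD(7)[OF star_order_Tm step(5)])
  show ?case
    using step(1,4,5) U' X'
    by (intro bexI[OF _ Tm_R_step[OF U'(1) step(4) X']])
      (simp add: H_add_left H_add_right H_smult_left H_smult_right Tm_R_closed E_closed
        H_E_adjoint_left[OF step(5)] H_E_adjoint_right[OF step(5)])
qed

text \<open>h o U is quadratic in \<open>U\<close>, so the claim for generators does not extend to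
  sums by itself. Adding r X contributes r^2 times h o X and the cross term \<psi>(U' r X) with U'
  adjoint to \<open>U\<close>; both have witnesses in the span, and \<open>W\<close> is the sum of
  all witnesses.\<close>

lemma Tm_R_quad:
  assumes stable: "is_stabilization_index D m" and U: "U \<in> Tm_R D m R"
  shows "\<exists>Z\<in>Tm_R D m R. \<forall>t\<in>carrier L.B. \<forall>t'\<in>carrier L.B.
    H (U t) (U t') = H t (Z t') \<oplus>\<^bsub>K.B\<^esub> H (Z t) t'"
  using U
proof (induct rule: Tm_R_induct)
  case zero
  have "H \<zero>\<^bsub>L.B\<^esub> t = \<zero>\<^bsub>K.B\<^esub>" "H t \<zero>\<^bsub>L.B\<^esub> = \<zero>\<^bsub>K.B\<^esub>" if "t \<in> carrier L.B" for t
    using H_add_left[of "\<zero>\<^bsub>L.B\<^esub>" "\<zero>\<^bsub>L.B\<^esub>" t] H_add_right[of t "\<zero>\<^bsub>L.B\<^esub>" "\<zero>\<^bsub>L.B\<^esub>"] that H_closed[of "\<zero>\<^bsub>L.B\<^esub>" t]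
      H_closed[of t "\<zero>\<^bsub>L.B\<^esub>"] by simp_all
  then show ?case
    by (intro bexI[OF _ Tm_R_zero]) simp
next
  case (step U r X)
  then obtain Z where Z: "Z \<in> Tm_R D m R" and UZ:
    "\<And>t t'. t \<in> carrier L.B \<Longrightarrow> t' \<in> carrier L.B \<Longrightarrow> H (U t) (U t') = H t (Z t') \<oplus>\<^bsub>K.B\<^esub> H (Z t) t'"
    by blast
  obtain U' where U': "U' \<in> Tm_R D m R" and UU':
    "\<And>t t'. t \<in> carrier L.B \<Longrightarrow> t' \<in> carrier L.B \<Longrightarrow> H (U t) t' = H t (U' t') \<and> H t (U t') = H (U' t) t'"
    using Tm_R_adjoint[OF step(1)] by blast
  obtain Y where Y: "Y \<in> Tm D m" and XY: "quad_rel X Y"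
    using stable_quad_rel[OF stable step(5)] by blast
  note r = step(4) and X = step(5)
  have rX: "(\<lambda>t\<in>carrier L.B. r \<odot>\<^bsub>L.B\<^esub> E X t) \<in> Tm_R D m R" by (rule Tm_R_single[OF r X])
  define W where "W = (\<lambda>t\<in>carrier L.B. (\<lambda>t\<in>carrier L.B. Z t \<oplus>\<^bsub>L.B\<^esub> (r \<otimes>\<^bsub>R\<^esub> r) \<odot>\<^bsub>L.B\<^esub> E Y t) t \<oplus>\<^bsub>L.B\<^esub>
      (\<lambda>t\<in>carrier L.B. U' ((\<lambda>t\<in>carrier L.B. r \<odot>\<^bsub>L.B\<^esub> E X t) t)) t)"
  have W: "W \<in> Tm_R D m R"
    unfolding W_def by (rule Tm_R_add[OF Tm_R_step[OF Z _ Y] Tm_R_comp[OF U' rX]]) (simp add: r)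
  have "H (U t \<oplus>\<^bsub>L.B\<^esub> r \<odot>\<^bsub>L.B\<^esub> E X t) (U t' \<oplus>\<^bsub>L.B\<^esub> r \<odot>\<^bsub>L.B\<^esub> E X t') = H t (W t') \<oplus>\<^bsub>K.B\<^esub> H (W t) t'"
    if t: "t \<in> carrier L.B" "t' \<in> carrier L.B" for t t'
  proof -
    note closed = Tm_R_closed[OF step(1)] Tm_R_closed[OF Z] Tm_R_closed[OF U'] E_closed[OF X] E_closed[OF Y]
    have "H (U t) (r \<odot>\<^bsub>L.B\<^esub> E X t') = H t (U' (r \<odot>\<^bsub>L.B\<^esub> E X t'))"
      "H (r \<odot>\<^bsub>L.B\<^esub> E X t) (U t') = H (U' (r \<odot>\<^bsub>L.B\<^esub> E X t)) t'"
      using UU' t r by (simp_all add: closed)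
    moreover have "H (r \<odot>\<^bsub>L.B\<^esub> E X t) (r \<odot>\<^bsub>L.B\<^esub> E X t') =
        H t ((r \<otimes>\<^bsub>R\<^esub> r) \<odot>\<^bsub>L.B\<^esub> E Y t') \<oplus>\<^bsub>K.B\<^esub> H ((r \<otimes>\<^bsub>R\<^esub> r) \<odot>\<^bsub>L.B\<^esub> E Y t) t'"
      using t r
      by (simp add: closed H_smult_left H_smult_right H_closed KR.smult_assoc1 KR.smult_r_distr
          H_E_quad[OF X Y XY])
    ultimately show ?thesis
      using t r
      by (simp add: W_def closed H_add_left H_add_right H_closed UZ K.B.T.a_ac)
  qed
  then show ?case
    by (intro bexI[OF _ W]) simp
qed

end

section \<open>The action on points\<close>

context hermitian_space_over begin

text \<open>The bilinear form h + \<psi>(U). Every point of H is \<open>form_of\<close> of such a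
  form, so hermitian and quadratic forms are computed with in the same way.\<close>

definition form_of_endo :: "(('v \<times> 'r) frag set \<Rightarrow> ('v \<times> 'r) frag set) \<Rightarrow>
    ('v \<times> 'r) frag set \<Rightarrow> ('v \<times> 'r) frag set \<Rightarrow> ('k \<times> 'r) frag set" where
  "form_of_endo U t t' = H t t' \<oplus>\<^bsub>K.B\<^esub> (H t (U t') \<oplus>\<^bsub>K.B\<^esub> H (U t) t')"

lemma H_points_eq: "H_points D m R = (\<lambda>U. form_of D (carrier L.B) (form_of_endo U)) ` Tm_R D m R"
  unfolding H_points_def psi_R_def herm_R_def
  by (simp add: Setcompr_eq_image image_image form_add_form_of lat_R_eq alg_R_eq form_of_endo_def[abs_def])

lemma biadditive_form_of_endo:
  assumes "U \<in> Tm_R D m R"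
  shows "biadditive (form_of_endo U)"
  unfolding form_of_endo_def[abs_def]
  by (intro biadditive_add biadditive_H biadditive_compose[OF id_linear_map Tm_R_linear[OF assms]]
      biadditive_compose[OF Tm_R_linear[OF assms] id_linear_map])

lemma biadditiveD:
  assumes "biadditive f"
  shows "t \<in> carrier L.B \<Longrightarrow> t' \<in> carrier L.B \<Longrightarrow> f t t' \<in> carrier K.B"
    "t \<in> carrier L.B \<Longrightarrow> s \<in> carrier L.B \<Longrightarrow> t' \<in> carrier L.B \<Longrightarrow> f (t \<oplus>\<^bsub>L.B\<^esub> s) t' = f t t' \<oplus>\<^bsub>K.B\<^esub> f s t'"
    "t \<in> carrier L.B \<Longrightarrow> s \<in> carrier L.B \<Longrightarrow> t' \<in> carrier L.B \<Longrightarrow> f t' (t \<oplus>\<^bsub>L.B\<^esub> s) = f t' t \<oplus>\<^bsub>K.B\<^esub> f t' s"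
  using assms by (simp_all add: biadditive_def)

lemma
  assumes U: "U \<in> Tm_R D m R" and r: "r \<in> carrier R"
    and t: "t \<in> carrier L.B" "t' \<in> carrier L.B"
  shows form_of_endo_smult_left: "form_of_endo U (r \<odot>\<^bsub>L.B\<^esub> t) t' = r \<odot>\<^bsub>K.B\<^esub> form_of_endo U t t'"
    and form_of_endo_smult_right: "form_of_endo U t (r \<odot>\<^bsub>L.B\<^esub> t') = r \<odot>\<^bsub>K.B\<^esub> form_of_endo U t t'"
  using assms
  by (simp_all add: form_of_endo_def linear_mapsD(3)[OF Tm_R_linear[OF U]] H_smult_left H_smult_right
      H_closed Tm_R_closed[OF U] KR.smult_r_distr)

text \<open>Serves polarization, where the two off-diagonal values are collected into twice one of
  them.\<close>

lemma form_of_endo_sym: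
  assumes "quadratic_case D" "U \<in> Tm_R D m R" "t \<in> carrier L.B" "t' \<in> carrier L.B"
  shows "form_of_endo U t' t = form_of_endo U t t'"
  using assms
  by (simp add: form_of_endo_def H_sym[OF assms(1), of t t'] H_sym[OF assms(1), of t "U t'"]
      H_sym[OF assms(1), of "U t" t'] H_closed Tm_R_closed K.B.T.a_ac)

lemma M_points_eq: "M_points D m R = (\<lambda>V. \<lambda>t\<in>carrier L.B. t \<oplus>\<^bsub>L.B\<^esub> V t) ` Tm_R D m R"
  by (auto simp: M_points_def lat_R_eq)

lemma M_points_linear: "g \<in> M_points D m R \<Longrightarrow> g \<in> linear_maps R L.B L.B"
  unfolding M_points_eq
  using linear_maps_restrict[OF linear_maps_add[OF id_linear_map Tm_R_linear]] by blast

lemma M_points_closed: "g \<in> M_points D m R \<Longrightarrow> t \<in> carrier L.B \<Longrightarrow> g t \<in> carrier L.B"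
  using linear_mapsD(1)[OF M_points_linear] .

lemma M_points_extensional: "g \<in> M_points D m R \<Longrightarrow> g \<in> extensional (carrier L.B)"
  by (auto simp: M_points_eq)

lemma M_points_one: "(\<lambda>t\<in>carrier L.B. t) \<in> M_points D m R"
proof -
  have "(\<lambda>t\<in>carrier L.B. t) = (\<lambda>t\<in>carrier L.B. t \<oplus>\<^bsub>L.B\<^esub> (\<lambda>t\<in>carrier L.B. \<zero>\<^bsub>L.B\<^esub>) t)"
    by (intro restrict_ext) simp
  then show ?thesis
    unfolding M_points_eq using Tm_R_zero by (rule image_eqI)
qed

text \<open>(1 + U)(1 + V) = 1 + (U + V + U V).\<close>

lemma M_points_compose:
  assumes "g \<in> M_points D m R" "g' \<in> M_points D m R"
  shows "compose (carrier L.B) g g' \<in> M_points D m R"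
proof -
  obtain U V where U: "U \<in> Tm_R D m R" and g: "g = (\<lambda>t\<in>carrier L.B. t \<oplus>\<^bsub>L.B\<^esub> U t)"
    and V: "V \<in> Tm_R D m R" and g': "g' = (\<lambda>t\<in>carrier L.B. t \<oplus>\<^bsub>L.B\<^esub> V t)"
    using assms unfolding M_points_eq by blast
  define W where "W = (\<lambda>t\<in>carrier L.B. (\<lambda>t\<in>carrier L.B. U t \<oplus>\<^bsub>L.B\<^esub> V t) t \<oplus>\<^bsub>L.B\<^esub> (\<lambda>t\<in>carrier L.B. U (V t)) t)"
  have W: "W \<in> Tm_R D m R"
    unfolding W_def by (rule Tm_R_add[OF Tm_R_add[OF U V] Tm_R_comp[OF U V]])
  have "compose (carrier L.B) g g' = (\<lambda>t\<in>carrier L.B. t \<oplus>\<^bsub>L.B\<^esub> W t)"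
    unfolding compose_def
  proof (rule restrict_ext)
    fix t assume t: "t \<in> carrier L.B"
    then show "g (g' t) = t \<oplus>\<^bsub>L.B\<^esub> W t"
      by (simp add: g g' W_def Tm_R_closed[OF U] Tm_R_closed[OF V] linear_mapsD(2)[OF Tm_R_linear[OF U]]
          L.B.T.a_ac)
  qed
  then show ?thesis
    unfolding M_points_eq using W by (rule image_eqI)
qed

text \<open>An inverse in M is itself a unit, so only closure under products takes an argument:
  inverses compose in reverse order.\<close>

lemma M_star_group: "group (M_star_group D m R)"
proof (rule groupI)
  let ?G = "M_star_group D m R"
  have carrier: "carrier ?G = M_star_points D m R" and one: "\<one>\<^bsub>?G\<^esub> = (\<lambda>t\<in>carrier L.B. t)"
    and mult: "g \<otimes>\<^bsub>?G\<^esub> g' = compose (carrier L.B) g g'" for g g'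
    by (simp_all add: M_star_group_def lat_R_eq)
  have star: "g \<in> M_star_points D m R \<longleftrightarrow> g \<in> M_points D m R \<and> (\<exists>g'\<in>M_points D m R.
     compose (carrier L.B) g g' = (\<lambda>t\<in>carrier L.B. t) \<and>
     compose (carrier L.B) g' g = (\<lambda>t\<in>carrier L.B. t))" for g
    by (simp add: M_star_points_def lat_R_eq)
  have Pi: "g \<in> carrier L.B \<rightarrow> carrier L.B" if "g \<in> M_points D m R" for g
    using M_points_closed[OF that] by blast
  have assoc: "compose (carrier L.B) f (compose (carrier L.B) g k) =
      compose (carrier L.B) (compose (carrier L.B) f g) k" if "k \<in> M_points D m R" for f g k
    using compose_assoc[OF Pi[OF that]] .
  have id: "compose (carrier L.B) (\<lambda>t\<in>carrier L.B. t) g = g" "compose (carrier L.B) g (\<lambda>t\<in>carrier L.B. t) = g"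
    if "g \<in> M_points D m R" for g
    using Id_compose[OF Pi M_points_extensional] compose_Id[OF Pi M_points_extensional] that by blast+
  show "\<one>\<^bsub>?G\<^esub> \<in> carrier ?G"
    unfolding carrier one star using M_points_one id[OF M_points_one] by blast
  show "\<one>\<^bsub>?G\<^esub> \<otimes>\<^bsub>?G\<^esub> g = g" if "g \<in> carrier ?G" for g
    using that unfolding carrier one mult star by (blast intro: id)
  show "f \<otimes>\<^bsub>?G\<^esub> g \<otimes>\<^bsub>?G\<^esub> k = f \<otimes>\<^bsub>?G\<^esub> (g \<otimes>\<^bsub>?G\<^esub> k)"
    if "f \<in> carrier ?G" "g \<in> carrier ?G" "k \<in> carrier ?G" for f g k
    using that assoc[of k f g] unfolding carrier mult star by simp
  show "\<exists>g'\<in>carrier ?G. g' \<otimes>\<^bsub>?G\<^esub> g = \<one>\<^bsub>?G\<^esub>" if g: "g \<in> carrier ?G" for g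
  proof -
    obtain g' where g': "g \<in> M_points D m R" "g' \<in> M_points D m R"
      "compose (carrier L.B) g g' = (\<lambda>t\<in>carrier L.B. t)" "compose (carrier L.B) g' g = (\<lambda>t\<in>carrier L.B. t)"
      using g unfolding carrier star by blast
    then have "g' \<in> carrier ?G" unfolding carrier star by blast
    then show ?thesis unfolding mult one using g'(4) by (intro bexI[of _ g'])
  qed
  show "f \<otimes>\<^bsub>?G\<^esub> g \<in> carrier ?G" if fg: "f \<in> carrier ?G" "g \<in> carrier ?G" for f g
  proof -
    obtain f' g' where f: "f \<in> M_points D m R" and f': "f' \<in> M_points D m R"
      "compose (carrier L.B) f f' = (\<lambda>t\<in>carrier L.B. t)" "compose (carrier L.B) f' f = (\<lambda>t\<in>carrier L.B. t)"
      and g: "g \<in> M_points D m R" and g': "g' \<in> M_points D m R"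
      "compose (carrier L.B) g g' = (\<lambda>t\<in>carrier L.B. t)" "compose (carrier L.B) g' g = (\<lambda>t\<in>carrier L.B. t)"
      using fg unfolding carrier star by blast
    have "compose (carrier L.B) (compose (carrier L.B) f g) (compose (carrier L.B) g' f') = (\<lambda>t\<in>carrier L.B. t)"
      using assoc[OF f'(1), of "compose (carrier L.B) f g" g'] assoc[OF g'(1), of f g] f' g' id(2)[OF f] by metis
    moreover have "compose (carrier L.B) (compose (carrier L.B) g' f') (compose (carrier L.B) f g) = (\<lambda>t\<in>carrier L.B. t)"
      using assoc[OF g, of "compose (carrier L.B) g' f'" f] assoc[OF f, of g' f'] f' g' id(2)[OF g'(1)] by metis
    ultimately show ?thesis
      unfolding carrier mult star using M_points_compose[OF f g] M_points_compose[OF g'(1) f'(1)] by blast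
  qed
qed

text \<open>This is \<open>(h + \<psi>(U)) \<circ> (1 + V) = h + \<psi>(V + Z + W + V\<^sup>* W)\<close>, where \<open>h \<circ> V = \<psi>(Z)\<close> and
  \<open>W = U (1 + V)\<close>.\<close>

lemma form_of_endo_pullback:
  assumes stable: "is_stabilization_index D m"
    and U: "U \<in> Tm_R D m R" and g: "g \<in> M_points D m R"
  shows "\<exists>S\<in>Tm_R D m R. \<forall>t\<in>carrier L.B. \<forall>t'\<in>carrier L.B.
    form_of_endo U (g t) (g t') = form_of_endo S t t'"
proof -
  obtain V where V: "V \<in> Tm_R D m R" and g_eq: "g = (\<lambda>t\<in>carrier L.B. t \<oplus>\<^bsub>L.B\<^esub> V t)"
    using g unfolding M_points_eq by blast
  obtain Z where Z: "Z \<in> Tm_R D m R" and VZ: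
    "\<And>t t'. t \<in> carrier L.B \<Longrightarrow> t' \<in> carrier L.B \<Longrightarrow> H (V t) (V t') = H t (Z t') \<oplus>\<^bsub>K.B\<^esub> H (Z t) t'"
    using Tm_R_quad[OF stable V] by blast
  obtain V' where V': "V' \<in> Tm_R D m R" and VV':
    "\<And>t t'. t \<in> carrier L.B \<Longrightarrow> t' \<in> carrier L.B \<Longrightarrow> H (V t) t' = H t (V' t') \<and> H t (V t') = H (V' t) t'"
    using Tm_R_adjoint[OF V] by blast
  define W where "W = (\<lambda>t\<in>carrier L.B. U t \<oplus>\<^bsub>L.B\<^esub> (\<lambda>t\<in>carrier L.B. U (V t)) t)"
  have W: "W \<in> Tm_R D m R" unfolding W_def by (rule Tm_R_add[OF U Tm_R_comp[OF U V]])
  have Ug: "U (g t) = W t" if "t \<in> carrier L.B" for t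
    using that by (simp add: g_eq W_def linear_mapsD(2)[OF Tm_R_linear[OF U]] Tm_R_closed[OF V])
  define S where "S = (\<lambda>t\<in>carrier L.B. (\<lambda>t\<in>carrier L.B. V t \<oplus>\<^bsub>L.B\<^esub> Z t) t \<oplus>\<^bsub>L.B\<^esub>
    (\<lambda>t\<in>carrier L.B. W t \<oplus>\<^bsub>L.B\<^esub> (\<lambda>t\<in>carrier L.B. V' (W t)) t) t)"
  have S: "S \<in> Tm_R D m R"
    unfolding S_def by (intro Tm_R_add Tm_R_comp V Z W V')
  have "form_of_endo U (g t) (g t') = form_of_endo S t t'"
    if t: "t \<in> carrier L.B" "t' \<in> carrier L.B" for t t'
  proof -
    note closed = Tm_R_closed[OF V] Tm_R_closed[OF Z] Tm_R_closed[OF W] Tm_R_closed[OF V']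
    have "H (V t) (W t') = H t (V' (W t'))" "H (W t) (V t') = H (V' (W t)) t'"
      using VV' t by (simp_all add: closed)
    then show ?thesis
      using t unfolding form_of_endo_def Ug[OF t(1)] Ug[OF t(2)]
      by (simp add: S_def g_eq closed H_add_left H_add_right H_closed VZ K.B.T.a_ac)
  qed
  with S show ?thesis by blast
qed

lemma form_pullback_form_of:
  "(\<And>t. t \<in> C' \<Longrightarrow> g t \<in> C') \<Longrightarrow>
   form_pullback C' (form_of D C' b) g = form_of D C' (\<lambda>t t'. b (g t) (g t'))"
  by (auto simp: form_of_def fun_eq_iff)

lemma form_pullback_M_points: "g \<in> M_points D m R \<Longrightarrow>
   form_pullback (carrier L.B) (form_of D (carrier L.B) b) g = form_of D (carrier L.B) (\<lambda>t t'. b (g t) (g t'))"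
  by (rule form_pullback_form_of) (rule M_points_closed)

lemma form_of_cong:
  "(\<And>t t'. t \<in> C' \<Longrightarrow> t' \<in> C' \<Longrightarrow> b t t' = b' t t') \<Longrightarrow> form_of D C' b = form_of D C' b'"
  by (auto simp: form_of_def fun_eq_iff)

text \<open>Pulling back along a composite g o g' is pulling back along g and then along g', so the
  action is on the right. What stability secures is that the result is again a point of H.\<close>

lemma right_action:
  assumes stable: "is_stabilization_index D m"
  shows "right_group_action (M_star_group D m R) (H_points D m R) (form_pullback (carrier (lat_R D R)))"
proof -
  have star: "g \<in> M_points D m R" if "g \<in> carrier (M_star_group D m R)" for g
    using that by (simp add: M_star_group_def M_star_points_def)
  have "form_pullback (carrier L.B) f g \<in> H_points D m R"
    if f: "f \<in> H_points D m R" and g: "g \<in> M_points D m R" for f g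
  proof -
    obtain U where U: "U \<in> Tm_R D m R" and f_eq: "f = form_of D (carrier L.B) (form_of_endo U)"
      using f unfolding H_points_eq by blast
    obtain S where S: "S \<in> Tm_R D m R" and eq: "\<And>t t'. t \<in> carrier L.B \<Longrightarrow> t' \<in> carrier L.B \<Longrightarrow>
        form_of_endo U (g t) (g t') = form_of_endo S t t'"
      using form_of_endo_pullback[OF stable U g] by blast
    have "form_pullback (carrier L.B) f g = form_of D (carrier L.B) (form_of_endo S)"
      unfolding f_eq form_pullback_M_points[OF g] by (rule form_of_cong) (rule eq)
    then show ?thesis unfolding H_points_eq using S by blast
  qed
  moreover have "form_pullback (carrier L.B) f (\<lambda>t\<in>carrier L.B. t) = f" if f: "f \<in> H_points D m R" for f
  proof -
    obtain U where f_eq: "f = form_of D (carrier L.B) (form_of_endo U)"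
      using f unfolding H_points_eq by blast
    show ?thesis
      unfolding f_eq by (subst form_pullback_form_of) (auto intro: form_of_cong)
  qed
  moreover have "form_pullback (carrier L.B) f (compose (carrier L.B) g g') =
      form_pullback (carrier L.B) (form_pullback (carrier L.B) f g) g'"
    if f: "f \<in> H_points D m R" and g: "g \<in> M_points D m R" "g' \<in> M_points D m R" for f g g'
  proof -
    obtain U where f_eq: "f = form_of D (carrier L.B) (form_of_endo U)"
      using f unfolding H_points_eq by blast
    show ?thesis
      unfolding f_eq form_pullback_M_points[OF g(1)]
        form_pullback_M_points[OF g(2)]
        form_pullback_M_points[OF M_points_compose[OF g]]
      by (rule form_of_cong) (simp add: compose_def)
  qed
  ultimately show ?thesis
    unfolding right_group_action_def using M_star_group star
    by (simp add: M_star_group_def lat_R_eq)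
qed

end

section \<open>Functoriality and the action morphism\<close>

text \<open>2 need not be invertible in \<open>R\<close>, but the values of forms lie in K \<otimes>
  R, where multiplication by 1/2 in the first factor recovers an element from its double.\<close>

lemma (in hermitian_space_over) double_cancel:
  assumes "quadratic_case D" "x \<in> carrier K.B" "z \<in> carrier K.B" "x \<oplus>\<^bsub>K.B\<^esub> x = z \<oplus>\<^bsub>K.B\<^esub> z"
  shows "x = z"
proof -
  let ?f = "\<lambda>c. emb D (1 / 2) * c"
  have f: "?f \<in> linear_maps A (alg_module D) (alg_module D)"
    by (simp add: linear_maps_def hom_def distrib_left mult.commute flip: mult.assoc emb(3) del: emb(3))
  let ?F = "tensor_map A (alg_module D) R (alg_module D) R ?f (\<lambda>r. r)"
  note T = K.B.tensor_product_axioms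
  note F = tensor_map_pure[OF T T f id_linear_map] tensor_map_closed[OF T T f id_linear_map]
    tensor_map_add[OF T T f id_linear_map]
  have "?F (s \<oplus>\<^bsub>K.B\<^esub> s) = s" if "s \<in> carrier K.B" for s
    using that
  proof (induct rule: K.B.T_induct)
    case (pure c r)
    then have "?F (K.B.pure c r \<oplus>\<^bsub>K.B\<^esub> K.B.pure c r) = K.B.pure (?f c) r \<oplus>\<^bsub>K.B\<^esub> K.B.pure (?f c) r"
      by (simp add: F)
    also have "\<dots> = K.B.pure (?f c + ?f c) r"
      using K.B.pure_add_left[of "?f c" "?f c" r] pure by simp
    finally show ?case
      by (simp only: emb_half[OF assms(1)])
  next
    case (add s s')
    have "?F ((s \<oplus>\<^bsub>K.B\<^esub> s') \<oplus>\<^bsub>K.B\<^esub> (s \<oplus>\<^bsub>K.B\<^esub> s')) = ?F (s \<oplus>\<^bsub>K.B\<^esub> s) \<oplus>\<^bsub>K.B\<^esub> ?F (s' \<oplus>\<^bsub>K.B\<^esub> s')"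
      using add by (simp add: F K.B.T.a_ac)
    then show ?case using add by simp
  qed
  then show ?thesis using assms(2-4) by metis
qed

locale hermitian_base_change =
  Q: hermitian_space_over D n Q + R: hermitian_space_over D n R
  for D :: "('f::field, 'k::ring_1, 'v::ab_group_add) lattice_data" and n :: nat
    and Q :: "('f, 'q) module" and R :: "('f, 'r) module" +
  fixes y :: "'q \<Rightarrow> 'r"
  assumes y: "y \<in> alg_homs (base_ring D) Q R"
begin

abbreviation "PL \<equiv> lat_push D Q R y"
abbreviation "PK \<equiv> alg_push D Q R y"

lemma PL_rules:
  shows PL_pure: "x \<in> lat D \<Longrightarrow> q \<in> carrier Q \<Longrightarrow> PL (Q.L.B.pure x q) = R.L.B.pure x (y q)"
    and PL_closed: "t \<in> carrier Q.L.B \<Longrightarrow> PL t \<in> carrier R.L.B"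
    and PL_add: "t \<in> carrier Q.L.B \<Longrightarrow> t' \<in> carrier Q.L.B \<Longrightarrow> PL (t \<oplus>\<^bsub>Q.L.B\<^esub> t') = PL t \<oplus>\<^bsub>R.L.B\<^esub> PL t'"
  using tensor_map_pure[OF Q.L.B.tensor_product_axioms R.L.B.tensor_product_axioms id_linear_map alg_homs_linear[OF y]]
    tensor_map_closed[OF Q.L.B.tensor_product_axioms R.L.B.tensor_product_axioms id_linear_map alg_homs_linear[OF y]]
    tensor_map_add[OF Q.L.B.tensor_product_axioms R.L.B.tensor_product_axioms id_linear_map alg_homs_linear[OF y]]
  by (simp_all add: lat_push_def)

lemma PK_rules:
  shows PK_pure: "q \<in> carrier Q \<Longrightarrow> PK (Q.K.B.pure c q) = R.K.B.pure c (y q)"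
    and PK_closed: "s \<in> carrier Q.K.B \<Longrightarrow> PK s \<in> carrier R.K.B"
    and PK_add: "s \<in> carrier Q.K.B \<Longrightarrow> s' \<in> carrier Q.K.B \<Longrightarrow> PK (s \<oplus>\<^bsub>Q.K.B\<^esub> s') = PK s \<oplus>\<^bsub>R.K.B\<^esub> PK s'"
  using tensor_map_pure[OF Q.K.B.tensor_product_axioms R.K.B.tensor_product_axioms id_linear_map alg_homs_linear[OF y]]
    tensor_map_closed[OF Q.K.B.tensor_product_axioms R.K.B.tensor_product_axioms id_linear_map alg_homs_linear[OF y]]
    tensor_map_add[OF Q.K.B.tensor_product_axioms R.K.B.tensor_product_axioms id_linear_map alg_homs_linear[OF y]]
  by (simp_all add: alg_push_def)

lemma PL_smult:
  assumes "q \<in> carrier Q" "t \<in> carrier Q.L.B"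
  shows "PL (q \<odot>\<^bsub>Q.L.B\<^esub> t) = y q \<odot>\<^bsub>R.L.B\<^esub> PL t"
  using assms(2)
proof (induct rule: Q.L.B.T_induct)
  case (pure x r)
  then show ?case
    using assms(1) by (simp add: Q.L.smult_pure R.L.smult_pure PL_pure alg_homsD[OF y])
next
  case (add t t')
  then show ?case
    using assms(1) by (simp add: Q.LR.smult_r_distr R.LR.smult_r_distr PL_add PL_closed alg_homsD[OF y])
qed

lemma PK_smult:
  assumes "q \<in> carrier Q" "s \<in> carrier Q.K.B"
  shows "PK (q \<odot>\<^bsub>Q.K.B\<^esub> s) = y q \<odot>\<^bsub>R.K.B\<^esub> PK s"
  using assms(2)
proof (induct rule: Q.K.B.T_induct)
  case (pure c r)
  then show ?case
    using assms(1) by (simp add: Q.K.smult_pure R.K.smult_pure PK_pure alg_homsD[OF y])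
next
  case (add t t')
  then show ?case
    using assms(1) by (simp add: Q.KR.smult_r_distr R.KR.smult_r_distr PK_add PK_closed alg_homsD[OF y])
qed

lemma H_push:
  assumes "t \<in> carrier Q.L.B" "t' \<in> carrier Q.L.B"
  shows "R.H (PL t) (PL t') = PK (Q.H t t')"
  using assms(1)
proof (induct rule: Q.L.B.T_induct)
  case (pure x r)
  note xr = pure(1,2)
  from assms(2) show ?case
  proof (induct rule: Q.L.B.T_induct)
    case (pure z s)
    then show ?case using xr by (simp add: PL_pure Q.H_pure R.H_pure PK_pure alg_homsD[OF y])
  next
    case (add t t')
    then show ?case
      using Q.L.B.pure_closed[OF xr]
      by (simp add: PL_add PL_closed Q.H_add_right R.H_add_right PK_add Q.H_closed)
  qed
next
  case (add t s)
  then show ?case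
    using assms(2) by (simp add: PL_add PL_closed Q.H_add_left R.H_add_left PK_add Q.H_closed)
qed

lemma E_push:
  assumes X: "X \<in> Tm D m" and t: "t \<in> carrier Q.L.B"
  shows "R.E X (PL t) = PL (Q.E X t)"
  using t
proof (induct rule: Q.L.B.T_induct)
  case (pure x r)
  then show ?case
    using Q.star_orderD(2)[OF Q.star_order_Tm X]
    by (simp add: PL_pure Q.E_pure[OF X] R.E_pure[OF X] alg_homsD[OF y])
next
  case (add t t')
  then show ?case
    by (simp add: PL_add PL_closed Q.E_closed[OF X] linear_mapsD(2)[OF Q.E_linear[OF X]]
        linear_mapsD(2)[OF R.E_linear[OF X]])
qed

text \<open>The coefficients are pushed along \<open>y\<close>, while the endomorphisms of L stay
  the same.\<close>

lemma Tm_R_push: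
  assumes "U \<in> Tm_R D m Q"
  shows "\<exists>U'\<in>Tm_R D m R. \<forall>t\<in>carrier Q.L.B. U' (PL t) = PL (U t)"
  using assms
proof (induct rule: Q.Tm_R_induct)
  case zero
  have "PL \<zero>\<^bsub>Q.L.B\<^esub> = \<zero>\<^bsub>R.L.B\<^esub>"
    using PL_add[of "\<zero>\<^bsub>Q.L.B\<^esub>" "\<zero>\<^bsub>Q.L.B\<^esub>"] PL_closed[of "\<zero>\<^bsub>Q.L.B\<^esub>"] by simp
  then show ?case
    by (intro bexI[OF _ R.Tm_R_zero]) (simp add: PL_closed)
next
  case (step U r X)
  then obtain U' where U': "U' \<in> Tm_R D m R" "\<And>t. t \<in> carrier Q.L.B \<Longrightarrow> U' (PL t) = PL (U t)"
    by blast
  have yr: "y r \<in> carrier R" using alg_homsD(1)[OF y step(4)] .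
  show ?case
    using step(1,4,5)
    by (intro bexI[OF _ R.Tm_R_step[OF U'(1) yr step(5)]])
      (simp add: U'(2) PL_closed PL_add PL_smult E_push Q.E_closed Q.Tm_R_closed)
qed

text \<open>x \<otimes> r is r times x \<otimes> 1, and x \<otimes> 1 is the image of an element of
  L \<otimes> Q; hence this image generates over \<open>R\<close>.\<close>

lemma L_ext:
  assumes f: "f \<in> linear_maps R R.L.B R.L.B" and f': "f' \<in> linear_maps R R.L.B R.L.B"
    and eq: "\<And>t. t \<in> carrier Q.L.B \<Longrightarrow> f (PL t) = f' (PL t)"
    and t: "t \<in> carrier R.L.B"
  shows "f t = f' t"
proof (rule R.L_hom_eqI[OF f f' _ t])
  fix x r assume x: "x \<in> lat D" and r: "r \<in> carrier R"
  have pure: "R.L.B.pure x r = r \<odot>\<^bsub>R.L.B\<^esub> PL (Q.L.B.pure x \<one>\<^bsub>Q\<^esub>)"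
    using x r by (simp add: PL_pure alg_homsD[OF y] R.L.smult_pure)
  have Q1: "Q.L.B.pure x \<one>\<^bsub>Q\<^esub> \<in> carrier Q.L.B" using x by simp
  show "f (R.L.B.pure x r) = f' (R.L.B.pure x r)"
    unfolding pure using r Q1 by (simp add: linear_mapsD(3)[OF f] linear_mapsD(3)[OF f'] PL_closed eq)
qed

text \<open>A map and its inverse are pushed separately. The results are mutually inverse on the
  image of L \<otimes> Q, hence everywhere by \<open>L_ext\<close>, so invertibility survives the
  base change.\<close>

lemma M_star_push:
  assumes "g \<in> M_star_points D m Q"
  shows "\<exists>g'\<in>M_star_points D m R. \<forall>t\<in>carrier Q.L.B. g' (PL t) = PL (g t)"
proof -
  have push: "\<exists>g'\<in>M_points D m R. \<forall>t\<in>carrier Q.L.B. g' (PL t) = PL (g t)"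
    if g: "g \<in> M_points D m Q" for g
  proof -
    obtain V where V: "V \<in> Tm_R D m Q" "g = (\<lambda>t\<in>carrier Q.L.B. t \<oplus>\<^bsub>Q.L.B\<^esub> V t)"
      using g unfolding Q.M_points_eq by blast
    obtain V' where V': "V' \<in> Tm_R D m R" "\<And>t. t \<in> carrier Q.L.B \<Longrightarrow> V' (PL t) = PL (V t)"
      using Tm_R_push[OF V(1)] by blast
    have mem: "(\<lambda>t\<in>carrier R.L.B. t \<oplus>\<^bsub>R.L.B\<^esub> V' t) \<in> M_points D m R"
      unfolding R.M_points_eq using V'(1) by (rule imageI)
    show ?thesis
      by (intro bexI[OF _ mem]) (simp add: V(2) V'(2) PL_closed PL_add Q.Tm_R_closed[OF V(1)])
  qed
  obtain g' where g: "g \<in> M_points D m Q" and g': "g' \<in> M_points D m Q"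
    and inv: "compose (carrier Q.L.B) g g' = (\<lambda>t\<in>carrier Q.L.B. t)"
      "compose (carrier Q.L.B) g' g = (\<lambda>t\<in>carrier Q.L.B. t)"
    using assms unfolding M_star_points_def Q.lat_R_eq by blast
  have inv': "g (g' t) = t" "g' (g t) = t" if "t \<in> carrier Q.L.B" for t
    using fun_cong[OF inv(1), of t] fun_cong[OF inv(2), of t] that by (simp_all add: compose_def)
  obtain k where k: "k \<in> M_points D m R" "\<And>t. t \<in> carrier Q.L.B \<Longrightarrow> k (PL t) = PL (g t)"
    using push[OF g] by blast
  obtain k' where k': "k' \<in> M_points D m R" "\<And>t. t \<in> carrier Q.L.B \<Longrightarrow> k' (PL t) = PL (g' t)"
    using push[OF g'] by blast
  note closed = Q.M_points_closed[OF g] Q.M_points_closed[OF g']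
  have "k (k' t) = t" if "t \<in> carrier R.L.B" for t
    by (rule L_ext[OF R.linear_maps_comp[OF R.M_points_linear[OF k(1)] R.M_points_linear[OF k'(1)]] id_linear_map _ that])
      (simp add: k k' inv' closed)
  moreover have "k' (k t) = t" if "t \<in> carrier R.L.B" for t
    by (rule L_ext[OF R.linear_maps_comp[OF R.M_points_linear[OF k'(1)] R.M_points_linear[OF k(1)]] id_linear_map _ that])
      (simp add: k k' inv' closed)
  ultimately have "k \<in> M_star_points D m R"
    unfolding M_star_points_def R.lat_R_eq using k(1) k'(1)
    by (intro CollectI conjI bexI[of _ k']) (auto simp: compose_def intro!: restrict_ext)
  with k(2) show ?thesis by blast
qed

lemma form_of_endo_push:
  assumes U: "U \<in> Tm_R D m Q" "U' \<in> Tm_R D m R"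
    and UU': "\<And>t. t \<in> carrier Q.L.B \<Longrightarrow> U' (PL t) = PL (U t)"
    and t: "t \<in> carrier Q.L.B" "t' \<in> carrier Q.L.B"
  shows "R.form_of_endo U' (PL t) (PL t') = PK (Q.form_of_endo U t t')"
  using t
  by (simp add: R.form_of_endo_def Q.form_of_endo_def UU' H_push Q.Tm_R_closed[OF U(1)] PK_add Q.H_closed)

text \<open>In the quadratic case the base change relation compares diagonal values only. Expanding
  at the sum of two vectors and cancelling the squares gives the off-diagonal values twice, and
  \<open>double_cancel\<close> halves them.\<close>

lemma is_form_base_change_iff:
  assumes U: "U \<in> Tm_R D m Q" and U': "U' \<in> Tm_R D m R"
  shows "is_form_base_change D Q R y (form_of D (carrier Q.L.B) (Q.form_of_endo U))
       (form_of D (carrier R.L.B) (R.form_of_endo U')) \<longleftrightarrow>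
     (\<forall>t\<in>carrier Q.L.B. \<forall>t'\<in>carrier Q.L.B.
        R.form_of_endo U' (PL t) (PL t') = PK (Q.form_of_endo U t t'))"
    (is "?bc \<longleftrightarrow> ?eq")
proof (cases "quadratic_case D")
  case True
  let ?b = "Q.form_of_endo U" and ?b' = "R.form_of_endo U'"
  have bc: "?bc \<longleftrightarrow> (\<forall>t\<in>carrier Q.L.B. ?b' (PL t) (PL t) = PK (?b t t))"
    using True by (simp add: form_of_def Q.lat_R_eq PL_closed)
  have "?b' (PL t) (PL t') = PK (?b t t')"
    if diag: "\<And>t. t \<in> carrier Q.L.B \<Longrightarrow> ?b' (PL t) (PL t) = PK (?b t t)"
      and t: "t \<in> carrier Q.L.B" "t' \<in> carrier Q.L.B" for t t'
  proof -
    note b = Q.biadditiveD[OF Q.biadditive_form_of_endo[OF U]]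
    note b' = R.biadditiveD[OF R.biadditive_form_of_endo[OF U']]
    let ?p = "?b' (PL t) (PL t) \<oplus>\<^bsub>R.K.B\<^esub> ?b' (PL t') (PL t')"
    have p: "?p \<in> carrier R.K.B" using t by (simp add: b' PL_closed)
    have "?p \<oplus>\<^bsub>R.K.B\<^esub> (?b' (PL t) (PL t') \<oplus>\<^bsub>R.K.B\<^esub> ?b' (PL t) (PL t')) =
        ?b' (PL (t \<oplus>\<^bsub>Q.L.B\<^esub> t')) (PL (t \<oplus>\<^bsub>Q.L.B\<^esub> t'))"
      using t R.form_of_endo_sym[OF True U', of "PL t" "PL t'"]
      by (simp add: PL_add PL_closed b' R.K.B.T.a_ac)
    also have "\<dots> = PK (?b (t \<oplus>\<^bsub>Q.L.B\<^esub> t') (t \<oplus>\<^bsub>Q.L.B\<^esub> t'))"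
      using t by (intro diag) simp
    also have "\<dots> = ?p \<oplus>\<^bsub>R.K.B\<^esub> (PK (?b t t') \<oplus>\<^bsub>R.K.B\<^esub> PK (?b t t'))"
      using t Q.form_of_endo_sym[OF True U, of t t']
      by (simp add: PK_add PK_closed b diag R.K.B.T.a_ac)
    finally have "?b' (PL t) (PL t') \<oplus>\<^bsub>R.K.B\<^esub> ?b' (PL t) (PL t') = PK (?b t t') \<oplus>\<^bsub>R.K.B\<^esub> PK (?b t t')"
      using p t by (simp add: b b' PL_closed PK_closed)
    from R.double_cancel[OF True _ _ this] show ?thesis
      using t by (simp add: b b' PL_closed PK_closed)
  qed
  then show ?thesis unfolding bc by blast
next
  case False
  then show ?thesis
    by (simp add: form_of_def Q.lat_R_eq PL_closed)
qed

end

section \<open>Composition of base changes and the induced map on points\<close>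

lemma
  assumes "hermitian_base_change D n Q R y" "hermitian_base_change D n R P z" "hermitian_base_change D n Q P x"
    and comp: "\<And>q. q \<in> carrier Q \<Longrightarrow> z (y q) = x q"
  shows lat_push_compose: "t \<in> carrier (lat_R D Q) \<Longrightarrow> lat_push D R P z (lat_push D Q R y t) = lat_push D Q P x t"
    and alg_push_compose: "s \<in> carrier (alg_R D Q) \<Longrightarrow> alg_push D R P z (alg_push D Q R y s) = alg_push D Q P x s"
proof -
  interpret y: hermitian_base_change D n Q R y by fact
  interpret z: hermitian_base_change D n R P z by fact
  interpret x: hermitian_base_change D n Q P x by fact
  show "lat_push D R P z (lat_push D Q R y t) = lat_push D Q P x t" if "t \<in> carrier (lat_R D Q)"
    using that unfolding y.Q.lat_R_eq
  proof (induct rule: y.Q.L.B.T_induct)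
    case (pure l q)
    then show ?case by (simp add: y.PL_pure z.PL_pure x.PL_pure comp alg_homsD[OF y.y])
  next
    case (add t t')
    then show ?case by (simp add: y.PL_add z.PL_add x.PL_add y.PL_closed)
  qed
  show "alg_push D R P z (alg_push D Q R y s) = alg_push D Q P x s" if "s \<in> carrier (alg_R D Q)"
    using that unfolding y.Q.alg_R_eq
  proof (induct rule: y.Q.K.B.T_induct)
    case (pure c q)
    then show ?case by (simp add: y.PK_pure z.PK_pure x.PK_pure comp alg_homsD[OF y.y])
  next
    case (add s s')
    then show ?case by (simp add: y.PK_add z.PK_add x.PK_add y.PK_closed)
  qed
qed

lemma (in hermitian_space) hermitian_space_over: "algebra A R \<Longrightarrow> hermitian_space_over D n R"
  by (intro hermitian_space_over.intro hermitian_space_axioms)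

lemma (in hermitian_space) hermitian_base_change:
  "algebra A Q \<Longrightarrow> algebra A R \<Longrightarrow> y \<in> alg_homs A Q R \<Longrightarrow> hermitian_base_change D n Q R y"
  by (simp add: hermitian_base_change_def hermitian_base_change_axioms_def hermitian_space_over)

context hermitian_space begin

text \<open>\<open>L \<otimes> S\<close> is generated over \<open>S\<close> by the image of \<open>L \<otimes> Q\<close>, for each of the factors \<open>Q\<close>
  of \<open>S\<close>. Hence an \<open>R\<close>-valued endomorphism or form which is the base change of the universal one
  along \<open>Q \<rightarrow> S \<rightarrow> R\<close> is also the base change along \<open>S \<rightarrow> R\<close> of the one over \<open>S\<close>.\<close>

lemma endo_base_change_factor:
  fixes Q :: "('f, 'q) module" and S :: "('f, 's) module" and R :: "('f, 'r) module"
  assumes alg: "algebra A Q" "algebra A S" "algebra A R"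
    and i: "i \<in> alg_homs A Q S" and g: "g \<in> alg_homs A S R" and x: "x \<in> alg_homs A Q R"
    and gi: "\<And>q. q \<in> carrier Q \<Longrightarrow> g (i q) = x q"
    and w: "w \<in> M_points D m Q" and wS: "wS \<in> M_points D m S" and f: "f \<in> M_points D m R"
    and w_wS: "\<And>t. t \<in> carrier (lat_R D Q) \<Longrightarrow> wS (lat_push D Q S i t) = lat_push D Q S i (w t)"
    and w_f: "\<And>t. t \<in> carrier (lat_R D Q) \<Longrightarrow> f (lat_push D Q R x t) = lat_push D Q R x (w t)"
    and t: "t \<in> carrier (lat_R D S)"
  shows "f (lat_push D S R g t) = lat_push D S R g (wS t)"
proof -
  interpret Q: hermitian_space_over D n Q by (rule hermitian_space_over[OF alg(1)])
  interpret S: hermitian_space_over D n S by (rule hermitian_space_over[OF alg(2)])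
  interpret R: hermitian_space_over D n R by (rule hermitian_space_over[OF alg(3)])
  interpret i: hermitian_base_change D n Q S i by (rule hermitian_base_change[OF alg(1,2) i])
  interpret g: hermitian_base_change D n S R g by (rule hermitian_base_change[OF alg(2,3) g])
  interpret x: hermitian_base_change D n Q R x by (rule hermitian_base_change[OF alg(1,3) x])
  note push = lat_push_compose[OF i.hermitian_base_change_axioms g.hermitian_base_change_axioms
      x.hermitian_base_change_axioms gi]
  note lin = linear_mapsD[OF S.M_points_linear[OF wS]] linear_mapsD[OF R.M_points_linear[OF f]]
  show ?thesis
    using t unfolding S.lat_R_eq
  proof (induct rule: S.L.B.T_induct)
    case (pure l s)
    let ?l = "Q.L.B.pure l \<one>\<^bsub>Q\<^esub>"
    have l: "?l \<in> carrier (lat_R D Q)" using pure by (simp add: Q.lat_R_eq)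
    have l': "?l \<in> carrier Q.L.B" "w ?l \<in> carrier Q.L.B"
      using l Q.M_points_closed[OF w] by (simp_all add: Q.lat_R_eq)
    have pure_eq: "S.L.B.pure l s = s \<odot>\<^bsub>S.L.B\<^esub> i.PL ?l"
      using pure by (simp add: i.PL_pure alg_homsD[OF i] S.L.smult_pure)
    have "f (g.PL (S.L.B.pure l s)) = g s \<odot>\<^bsub>R.L.B\<^esub> x.PL (w ?l)"
      unfolding pure_eq using pure l l'
      by (simp add: g.PL_smult i.PL_closed push lin alg_homsD[OF g] w_f x.PL_closed)
    also have "\<dots> = g.PL (wS (S.L.B.pure l s))"
      unfolding pure_eq using pure l l' Q.M_points_closed[OF w]
      by (simp add: lin w_wS i.PL_closed g.PL_smult push Q.lat_R_eq)
    finally show ?case .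
  next
    case (add t t')
    then show ?case by (simp add: g.PL_add g.PL_closed lin)
  qed
qed

lemma form_base_change_factor:
  fixes Q :: "('f, 'q) module" and S :: "('f, 's) module" and R :: "('f, 'r) module"
  assumes alg: "algebra A Q" "algebra A S" "algebra A R"
    and i: "i \<in> alg_homs A Q S" and g: "g \<in> alg_homs A S R" and x: "x \<in> alg_homs A Q R"
    and gi: "\<And>q. q \<in> carrier Q \<Longrightarrow> g (i q) = x q"
    and U: "U \<in> Tm_R D m Q" and US: "US \<in> Tm_R D m S" and UR: "UR \<in> Tm_R D m R"
    and U_US: "\<And>t. t \<in> carrier (lat_R D Q) \<Longrightarrow> US (lat_push D Q S i t) = lat_push D Q S i (U t)"
    and bc: "is_form_base_change D Q R x
      (form_of D (carrier (lat_R D Q)) (hermitian_space_over.form_of_endo D Q U))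
      (form_of D (carrier (lat_R D R)) (hermitian_space_over.form_of_endo D R UR))"
    and t: "t \<in> carrier (lat_R D S)" "t' \<in> carrier (lat_R D S)"
  shows "hermitian_space_over.form_of_endo D R UR (lat_push D S R g t) (lat_push D S R g t') =
    alg_push D S R g (hermitian_space_over.form_of_endo D S US t t')"
proof -
  interpret Q: hermitian_space_over D n Q by (rule hermitian_space_over[OF alg(1)])
  interpret S: hermitian_space_over D n S by (rule hermitian_space_over[OF alg(2)])
  interpret R: hermitian_space_over D n R by (rule hermitian_space_over[OF alg(3)])
  interpret i: hermitian_base_change D n Q S i by (rule hermitian_base_change[OF alg(1,2) i])
  interpret g: hermitian_base_change D n S R g by (rule hermitian_base_change[OF alg(2,3) g])
  interpret x: hermitian_base_change D n Q R x by (rule hermitian_base_change[OF alg(1,3) x])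
  note push = lat_push_compose[OF i.hermitian_base_change_axioms g.hermitian_base_change_axioms
      x.hermitian_base_change_axioms gi]
    alg_push_compose[OF i.hermitian_base_change_axioms g.hermitian_base_change_axioms
      x.hermitian_base_change_axioms gi]
  have U_US': "US (i.PL t) = i.PL (U t)" if "t \<in> carrier Q.L.B" for t
    using U_US that by (simp add: Q.lat_R_eq)
  \<comment> \<open>The hypothesis compares forms, which in the quadratic case means diagonals;
    polarization supplies the bilinear identity.\<close>
  have bc': "R.form_of_endo UR (x.PL t) (x.PL t') = x.PK (Q.form_of_endo U t t')"
    if "t \<in> carrier Q.L.B" "t' \<in> carrier Q.L.B" for t t'
    using bc that unfolding Q.lat_R_eq R.lat_R_eq x.is_form_base_change_iff[OF U UR] by blast
  note bS = S.biadditiveD[OF S.biadditive_form_of_endo[OF US]]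
  note bR = R.biadditiveD[OF R.biadditive_form_of_endo[OF UR]]
  note bQ = Q.biadditiveD[OF Q.biadditive_form_of_endo[OF U]]
  \<comment> \<open>Scalars of \<open>S\<close> can be pulled out of both arguments, so the claim
    reduces to vectors l \<otimes> 1 coming from L \<otimes> Q, where it is
    \<open>bc'\<close>.\<close>
  have pure_pure: "R.form_of_endo UR (g.PL (S.L.B.pure l s)) (g.PL (S.L.B.pure l' s')) =
      g.PK (S.form_of_endo US (S.L.B.pure l s) (S.L.B.pure l' s'))"
    if ls: "l \<in> lat D" "s \<in> carrier S" "l' \<in> lat D" "s' \<in> carrier S" for l s l' s'
  proof -
    let ?l = "Q.L.B.pure l \<one>\<^bsub>Q\<^esub>" and ?l' = "Q.L.B.pure l' \<one>\<^bsub>Q\<^esub>"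
    have l: "?l \<in> carrier Q.L.B" "?l' \<in> carrier Q.L.B"
      using ls by simp_all
    have pure_eq: "S.L.B.pure l s = s \<odot>\<^bsub>S.L.B\<^esub> i.PL ?l" "S.L.B.pure l' s' = s' \<odot>\<^bsub>S.L.B\<^esub> i.PL ?l'"
      using ls by (simp_all add: i.PL_pure alg_homsD[OF i] S.L.smult_pure)
    have "R.form_of_endo UR (g.PL (S.L.B.pure l s)) (g.PL (S.L.B.pure l' s')) =
        g s' \<odot>\<^bsub>R.K.B\<^esub> (g s \<odot>\<^bsub>R.K.B\<^esub> x.PK (Q.form_of_endo U ?l ?l'))"
      unfolding pure_eq using ls l
      by (simp add: g.PL_smult i.PL_closed push Q.lat_R_eq alg_homsD[OF g] x.PL_closed
          R.form_of_endo_smult_left[OF UR] R.form_of_endo_smult_right[OF UR] bc')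
    also have "\<dots> = g.PK (S.form_of_endo US (S.L.B.pure l s) (S.L.B.pure l' s'))"
      unfolding pure_eq using ls l
      by (simp add: i.PL_closed S.form_of_endo_smult_left[OF US] S.form_of_endo_smult_right[OF US]
          g.PK_smult bS i.form_of_endo_push[OF U US U_US'] push Q.alg_R_eq bQ i.PK_closed)
    finally show ?thesis .
  qed
  show ?thesis
    using t(1) unfolding S.lat_R_eq
  proof (induct rule: S.L.B.T_induct)
    case (pure l s)
    note ls = pure(1,2)
    from t(2) show ?case
      unfolding S.lat_R_eq
    proof (induct rule: S.L.B.T_induct)
      case (pure l' s')
      then show ?case using pure_pure ls by simp
    next
      case (add t t')
      then show ?case
        using S.L.B.pure_closed[OF ls]
        by (simp add: g.PL_add g.PL_closed bR bS g.PK_add)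
    qed
  next
    case (add t s)
    then show ?case
      using t(2) by (simp add: S.lat_R_eq g.PL_add g.PL_closed bR bS g.PK_add)
  qed
qed

text \<open>Let k be the point of \<open>S\<close> with components y and x. Then f and g are base
  changes along k of the universal form and the universal endomorphism over \<open>S\<close>, so f o
  g is the base change along k of their composite, which in turn is the base change of
  \<open>u\<close> along \<phi>. As \<open>R\<close> is arbitrary, one \<phi> serves algebras of
  every carrier type.\<close>

lemma induces_action:
  fixes OH :: "('f, 'oh) module" and OM :: "('f, 'om) module" and R :: "('f, 'r) module"
  defines "S \<equiv> tensor_algebra A OH OM"
  defines "i1 \<equiv> \<lambda>s\<in>carrier OH. pure_tensor A OH OM s \<one>\<^bsub>OM\<^esub>"
    and "i2 \<equiv> \<lambda>s\<in>carrier OM. pure_tensor A OH OM \<one>\<^bsub>OH\<^esub> s"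
  assumes stable: "is_stabilization_index D m"
    and alg: "algebra A OH" "algebra A OM" "algebra A R"
    and U: "U \<in> Tm_R D m OH" and US: "US \<in> Tm_R D m S"
    and U_US: "\<And>t. t \<in> carrier (lat_R D OH) \<Longrightarrow> US (lat_push D OH S i1 t) = lat_push D OH S i1 (U t)"
    and w: "w \<in> M_points D m OM" and wS: "wS \<in> M_points D m S"
    and w_wS: "\<And>t. t \<in> carrier (lat_R D OM) \<Longrightarrow> wS (lat_push D OM S i2 t) = lat_push D OM S i2 (w t)"
    and u: "u = form_of D (carrier (lat_R D OH)) (hermitian_space_over.form_of_endo D OH U)"
    and \<phi>: "\<phi> \<in> alg_homs A OH S"
    and \<phi>_bc: "is_form_base_change D OH S \<phi> u (form_pullback (carrier (lat_R D S))
       (form_of D (carrier (lat_R D S)) (hermitian_space_over.form_of_endo D S US)) wS)"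
  shows "induces_action D m OH u OM w \<phi> R"
  unfolding induces_action_def
proof (intro ballI impI, elim conjE)
  fix f g y x
  assume f: "f \<in> H_points D m R" and g: "g \<in> M_star_points D m R"
    and y: "y \<in> alg_homs A OH R" and x: "x \<in> alg_homs A OM R"
    and yf: "is_form_base_change D OH R y u f" and xg: "is_endo_base_change D OM R x w g"
  interpret P: tensor_algebra_pair A OH OM using alg by (simp add: tensor_algebra_pair_def)
  have alg_S: "algebra A S" unfolding S_def by (rule P.algebra_T)
  interpret OH: hermitian_space_over D n OH by (rule hermitian_space_over[OF alg(1)])
  interpret S: hermitian_space_over D n S by (rule hermitian_space_over[OF alg_S])
  interpret R: hermitian_space_over D n R by (rule hermitian_space_over[OF alg(3)])
  define k where "k = point_pair A OH OM R y x"
  have k: "k \<in> alg_homs A S R"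
    unfolding k_def S_def by (rule P.point_pair_alg_homs[OF alg(3) y x])
  have k1: "k (i1 s) = y s" if "s \<in> carrier OH" for s
    using that by (simp add: k_def i1_def P.point_pair_pure[OF alg(3) y x] alg_homsD[OF y] alg_homsD[OF x])
  have k2: "k (i2 s) = x s" if "s \<in> carrier OM" for s
    using that by (simp add: k_def i2_def P.point_pair_pure[OF alg(3) y x] alg_homsD[OF y] alg_homsD[OF x])
  have i1: "i1 \<in> alg_homs A OH S" unfolding i1_def S_def by (rule P.inclusion_left)
  have i2: "i2 \<in> alg_homs A OM S" unfolding i2_def S_def by (rule P.inclusion_right)
  have kphi: "compose (carrier OH) k \<phi> \<in> alg_homs A OH R"
    by (rule alg_homs_compose[OF alg(1) \<phi> k])
  interpret phi: hermitian_base_change D n OH S \<phi> by (rule hermitian_base_change[OF alg(1) alg_S \<phi>])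
  interpret k: hermitian_base_change D n S R k by (rule hermitian_base_change[OF alg_S alg(3) k])
  interpret kphi: hermitian_base_change D n OH R "compose (carrier OH) k \<phi>"
    by (rule hermitian_base_change[OF alg(1,3) kphi])
  have push: "k.PL (phi.PL t) = kphi.PL t" if "t \<in> carrier OH.L.B" for t
    using lat_push_compose[OF phi.hermitian_base_change_axioms k.hermitian_base_change_axioms
        kphi.hermitian_base_change_axioms, of t] that by (simp add: compose_def OH.lat_R_eq)
  have push': "k.PK (phi.PK t) = kphi.PK t" if "t \<in> carrier OH.K.B" for t
    using alg_push_compose[OF phi.hermitian_base_change_axioms k.hermitian_base_change_axioms
        kphi.hermitian_base_change_axioms, of t] that by (simp add: compose_def OH.alg_R_eq)
  obtain UR where UR: "UR \<in> Tm_R D m R" and f_eq: "f = form_of D (carrier R.L.B) (R.form_of_endo UR)"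
    using f unfolding R.H_points_eq by blast
  have gM: "g \<in> M_points D m R" using g by (simp add: M_star_points_def)
  have g_push: "g (k.PL t) = k.PL (wS t)" if "t \<in> carrier S.L.B" for t
    using endo_base_change_factor[OF alg(2) alg_S alg(3) i2 k x k2 w wS gM w_wS] xg that
    by (simp add: is_endo_base_change_def S.lat_R_eq)
  have f_push: "R.form_of_endo UR (k.PL t) (k.PL t') = k.PK (S.form_of_endo US t t')"
    if "t \<in> carrier S.L.B" "t' \<in> carrier S.L.B" for t t'
    using form_base_change_factor[OF alg(1) alg_S alg(3) i1 k y k1 U US UR U_US yf[unfolded u f_eq, folded R.lat_R_eq]] that
    by (simp add: S.lat_R_eq R.lat_R_eq)
  \<comment> \<open>Both pulled back forms are brought back to the shape h + \<psi>, to which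
    \<open>is_form_base_change_iff\<close> applies.\<close>
  obtain WS where WS: "WS \<in> Tm_R D m S" and WS_eq: "\<And>t t'. t \<in> carrier S.L.B \<Longrightarrow> t' \<in> carrier S.L.B \<Longrightarrow>
      S.form_of_endo US (wS t) (wS t') = S.form_of_endo WS t t'"
    using S.form_of_endo_pullback[OF stable US wS] by blast
  obtain WR where WR: "WR \<in> Tm_R D m R" and WR_eq: "\<And>t t'. t \<in> carrier R.L.B \<Longrightarrow> t' \<in> carrier R.L.B \<Longrightarrow>
      R.form_of_endo UR (g t) (g t') = R.form_of_endo WR t t'"
    using R.form_of_endo_pullback[OF stable UR gM] by blast
  have pullback_S: "form_pullback (carrier S.L.B) (form_of D (carrier S.L.B) (S.form_of_endo US)) wS =
      form_of D (carrier S.L.B) (S.form_of_endo WS)"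
    unfolding S.form_pullback_M_points[OF wS] by (rule S.form_of_cong) (rule WS_eq)
  have pullback_R: "form_pullback (carrier R.L.B) f g = form_of D (carrier R.L.B) (R.form_of_endo WR)"
    unfolding f_eq R.form_pullback_M_points[OF gM] by (rule R.form_of_cong) (rule WR_eq)
  have phi_push: "S.form_of_endo WS (phi.PL t) (phi.PL t') = phi.PK (OH.form_of_endo U t t')"
    if "t \<in> carrier OH.L.B" "t' \<in> carrier OH.L.B" for t t'
    using \<phi>_bc that
    unfolding u OH.lat_R_eq S.lat_R_eq pullback_S phi.is_form_base_change_iff[OF U WS] by blast
  note bQ = OH.biadditiveD[OF OH.biadditive_form_of_endo[OF U]]
  show "is_form_base_change D OH R (compose (carrier OH) (point_pair A OH OM R y x) \<phi>) u
          (form_pullback (carrier (lat_R D R)) f g)"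
    unfolding k_def[symmetric] u OH.lat_R_eq R.lat_R_eq pullback_R kphi.is_form_base_change_iff[OF U WR]
  proof (intro ballI)
    fix t t' assume t: "t \<in> carrier OH.L.B" "t' \<in> carrier OH.L.B"
    note closed = S.M_points_closed[OF wS] phi.PL_closed k.PL_closed
    have "R.form_of_endo WR (kphi.PL t) (kphi.PL t') = R.form_of_endo UR (g (k.PL (phi.PL t))) (g (k.PL (phi.PL t')))"
      using t by (simp add: push[symmetric] WR_eq closed)
    also have "\<dots> = k.PK (S.form_of_endo WS (phi.PL t) (phi.PL t'))"
      using t by (simp add: g_push f_push WS_eq closed)
    also have "\<dots> = kphi.PK (OH.form_of_endo U t t')"
      using t by (simp add: phi_push push' bQ)
    finally show "R.form_of_endo WR (kphi.PL t) (kphi.PL t') = kphi.PK (OH.form_of_endo U t t')" .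
  qed
qed

end

text \<open>Representability is asked for at the carrier type of the coordinate ring of the product,
  because the comorphism arises by classifying a form over that ring. The action on points is
  asserted at this type and at an arbitrary one, with the same \<phi>.\<close>

theorem theorem3p19:
  fixes D :: "('f::field, 'k::ring_1, 'v::ab_group_add) lattice_data" and n \<alpha> :: nat
  assumes "hermitian_lattice D n"
    and "is_stabilization_index D \<alpha>"
  shows "(\<forall>R :: ('f, 'r) module. flat_algebra (base_ring D) R \<longrightarrow>
            right_group_action (M_star_group D \<alpha> R) (H_points D \<alpha> R)
              (form_pullback (carrier (lat_R D R)))) \<and>
         (\<forall>(OH :: ('f, 'oh) module) u (OM :: ('f, 'om) module) w.
            represents_H TYPE(('oh \<times> 'om) frag set) D \<alpha> OH u \<and>
            represents_M_star TYPE(('oh \<times> 'om) frag set) D \<alpha> OM w \<longrightarrow>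
            (\<exists>\<phi> \<in> alg_homs (base_ring D) OH (tensor_algebra (base_ring D) OH OM).
               (\<forall>R :: ('f, ('oh \<times> 'om) frag set) module. flat_algebra (base_ring D) R \<longrightarrow>
                  induces_action D \<alpha> OH u OM w \<phi> R) \<and>
               (\<forall>R :: ('f, 'r) module. flat_algebra (base_ring D) R \<longrightarrow>
                  induces_action D \<alpha> OH u OM w \<phi> R)))"
proof (intro conjI allI impI, goal_cases)
  interpret hermitian_space D n by unfold_locales (rule assms(1))
  {
    case (1 R)
    then interpret hermitian_space_over D n R
      by (intro hermitian_space_over) (simp add: flat_algebra_def)
    show ?case by (rule right_action[OF assms(2)])
  next
    case (2 OH u OM w)
    define S where "S = tensor_algebra A OH OM"
    have OH: "algebra A OH" "flat A OH" and u_mem: "u \<in> H_points D \<alpha> OH"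
      and OM: "algebra A OM" "flat A OM" and w_mem: "w \<in> M_star_points D \<alpha> OM"
      using 2 by (auto simp: represents_H_def represents_M_star_def flat_algebra_def)
    interpret P: tensor_algebra_pair A OH OM using OH OM by (simp add: tensor_algebra_pair_def)
    have alg_S: "algebra A S" unfolding S_def by (rule P.algebra_T)
    \<comment> \<open>\<open>represents_H\<close> classifies forms over flat algebras only.\<close>
    have flat_S: "flat_algebra A S"
      unfolding flat_algebra_def S_def
      using P.algebra_T flat_tensor_algebra[OF A_valuation_domain OH(1) OM(1) OH(2) OM(2)] by blast
    interpret S: hermitian_space_over D n S by (rule hermitian_space_over[OF alg_S])
    interpret OH: hermitian_space_over D n OH by (rule hermitian_space_over[OF OH(1)])
    interpret OM: hermitian_space_over D n OM by (rule hermitian_space_over[OF OM(1)])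
    note incl = P.inclusion_left P.inclusion_right
    interpret i1: hermitian_base_change D n OH S "\<lambda>s\<in>carrier OH. pure_tensor A OH OM s \<one>\<^bsub>OM\<^esub>"
      by (rule hermitian_base_change[OF OH(1) alg_S]) (unfold S_def, rule incl)
    interpret i2: hermitian_base_change D n OM S "\<lambda>s\<in>carrier OM. pure_tensor A OH OM \<one>\<^bsub>OH\<^esub> s"
      by (rule hermitian_base_change[OF OM(1) alg_S]) (unfold S_def, rule incl)
    obtain U where U: "U \<in> Tm_R D \<alpha> OH" and u: "u = form_of D (carrier OH.L.B) (OH.form_of_endo U)"
      using u_mem unfolding OH.H_points_eq by blast
    obtain US where US: "US \<in> Tm_R D \<alpha> S" and U_US: "\<forall>t\<in>carrier OH.L.B. US (i1.PL t) = i1.PL (U t)"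
      using i1.Tm_R_push[OF U] by blast
    \<comment> \<open>The image of the universal endomorphism over \<open>S\<close> is again
      invertible, so it belongs to the group that acts on forms over \<open>S\<close>.\<close>
    obtain wS where wS: "wS \<in> M_star_points D \<alpha> S" and w_wS: "\<forall>t\<in>carrier OM.L.B. wS (i2.PL t) = i2.PL (w t)"
      using i2.M_star_push[OF w_mem] by blast
    let ?uS = "form_of D (carrier (lat_R D S)) (S.form_of_endo US)"
    have "?uS \<in> H_points D \<alpha> S"
      unfolding S.H_points_eq S.lat_R_eq using US by (rule imageI)
    then have "form_pullback (carrier (lat_R D S)) ?uS wS \<in> H_points D \<alpha> S"
      using S.right_action[OF assms(2)] wS unfolding right_group_action_def
      by (simp add: M_star_group_def)
    \<comment> \<open>\<phi> classifies the result of the universal action: the universal form over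
      \<open>S\<close> pulled back along the universal endomorphism over \<open>S\<close>.\<close>
    then obtain \<phi> where \<phi>: "\<phi> \<in> alg_homs A OH S"
      "is_form_base_change D OH S \<phi> u (form_pullback (carrier (lat_R D S)) ?uS wS)"
      using 2 flat_S unfolding represents_H_def by blast
    have wM: "w \<in> M_points D \<alpha> OM" "wS \<in> M_points D \<alpha> S"
      using w_mem wS by (simp_all add: M_star_points_def)
    note action = induces_action[OF assms(2) OH(1) OM(1) _ U, folded S_def, OF _ US _ wM _ _ \<phi>]
    show ?case
    proof (intro bexI[of _ \<phi>] conjI allI impI)
      show "\<phi> \<in> alg_homs A OH (tensor_algebra A OH OM)" using \<phi>(1) by (simp add: S_def)
      show "induces_action D \<alpha> OH u OM w \<phi> R" if "flat_algebra A R" for R :: "('f, ('oh \<times> 'om) frag set) module"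
        using that U_US w_wS u by (intro action) (simp_all add: flat_algebra_def OH.lat_R_eq OM.lat_R_eq)
      show "induces_action D \<alpha> OH u OM w \<phi> R" if "flat_algebra A R" for R :: "('f, 'r) module"
        using that U_US w_wS u by (intro action) (simp_all add: flat_algebra_def OH.lat_R_eq OM.lat_R_eq)
    qed
  }
qed

end
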